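(* Let $Q$ be a face operator. A triplet $(\overline Q^{W},\overline Q^{S},\overline Q^{SW})\in\mathcal Q_{\infty_W,1}\times\mathcal Q_{1,\infty_S}\times\mathcal Q_{\infty_W,\infty_S}$, with blocks $B^W_{ab}$ ($a,b\in\{S,N,E\}$), $B^S_{ab}$ ($a,b\in\{N,W,E\}$) and $C_{ab}$ ($a,b\in\{N,E\}$), is a South-West corner system of fixed points of $Q$ with identity morphisms if and only if the following three conditions hold. (1) With $K=B^W_{EE}+Q_{WW}$, for all $a,b\in\{S,N\}$: $B^W_{EE}=Q_{EE}-Q_{EW}K^{-1}Q_{WE}$, $\;B^W_{aE}=D_1^L\begin{pmatrix}-B^W_{aE}K^{-1}Q_{WE}\\ Q_{aE}-Q_{aW}K^{-1}Q_{WE}\end{pmatrix}$, $\;B^W_{ab}=D^L_1\left[\begin{pmatrix}B^W_{ab}&0\\ 0&Q_{ab}\end{pmatrix}-\begin{pmatrix}B^W_{aE}\\ Q_{aW}\end{pmatrix}K^{-1}\begin{pmatrix}B^W_{Eb}&Q_{Wb}\end{pmatrix}\right](D^L_1)^*$. (2) With $K'=B^S_{NN}+Q_{SS}$, for all $a,b\in\{W,E\}$: $B^S_{NN}=Q_{NN}-Q_{NS}K'^{-1}Q_{SN}$, $\;B^S_{aN}=D_1^L\begin{pmatrix}-B^S_{aN}K'^{-1}Q_{SN}\\ Q_{aN}-Q_{aS}K'^{-1}Q_{SN}\end{pmatrix}$, $\;B^S_{ab}=D^L_1\left[\begin{pmatrix}B^S_{ab}&0\\ 0&Q_{ab}\end{pmatrix}-\begin{pmatrix}B^S_{aN}\\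 Q_{aS}\end{pmatrix}K'^{-1}\begin{pmatrix}B^S_{Nb}&Q_{Sb}\end{pmatrix}\right](D^L_1)^*$. (3) $\overline Q^{SW}$ satisfies the two fixed point equations $\overline Q^{SW}=\overline Q^{SW}|\overline Q^{S}$ (gluing along the vertical half-line) and $\overline Q^{SW}=\overline Q^{SW}/\overline Q^{W}$ (gluing along the horizontal half-line); that is, with the invertible operators $L_2=C_{EE}+B^S_{WW}$ and $L_1=C_{NN}+B^W_{SS}$, $$C_{EE}=B^S_{EE}-B^S_{EW}L_2^{-1}B^S_{WE},$$ $$C_{NE}=(C_{EN})^*=D_1^L\begin{pmatrix}-C_{NE}L_2^{-1}B^S_{WE}\\ B^S_{NE}-B^S_{NW}L_2^{-1}B^S_{WE}\end{pmatrix},$$ $$C_{NN}=D_1^L\left[\begin{pmatrix}C_{NN}&0\\ 0&B^S_{NN}\end{pmatrix}-\begin{pmatrix}C_{NE}\\ B^S_{NW}\end{pmatrix}L_2^{-1}\begin{pmatrix}C_{EN}&B^S_{WN}\end{pmatrix}\right](D_1^L)^*$$ for the first one, and $$C_{NN}=B^W_{NN}-B^W_{NS}L_1^{-1}B^W_{SN},$$ $$C_{EN}=(C_{NE})^*=D_1^L\begin{pmatrix}-C_{EN}L_1^{-1}B^W_{SN}\\ B^W_{EN}-B^W_{ES}L_1^{-1}B^W_{SN}\end{pmatrix},$$ $$C_{EE}=D_1^L\left[\begin{pmatrix}C_{EE}&0\\ 0&B^W_{EE}\end{pmatrix}-\begin{pmatrix}C_{EN}\\ B^W_{ES}\end{pmatrix}L_1^{-1}\begin{pmatrix}C_{NE}&B^W_{SE}\end{pmatrix}\right](D_1^L)^*$$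 for the second one.
   Context: $\mathcal H_1,\mathcal H_2$ are finite-dimensional (real or complex) Hilbert spaces. A face operator is a self-adjoint positive definite operator $Q$ on $\mathcal H_1\oplus\mathcal H_1\oplus\mathcal H_2\oplus\mathcal H_2$, the summands being attached to the South, North, West, East sides ($S,N,W,E$) of a unit square, with blocks $Q_{ab}$. Schur complement: $\mathrm{Schur}_{V_2}(M)=M_{11}-M_{12}M_{22}^{-1}M_{21}$ for $M$ on $V_1\oplus V_2$ with $M_{22}$ invertible. Half-line spaces: $\mathcal W_W=\ell^2(\mathbb Z_{<0};\mathcal H_1)$, $\mathcal W_S=\ell^2(\mathbb Z_{<0};\mathcal H_2)$. Shifts: for $\mathcal H=\mathcal H_1$ or $\mathcal H_2$, $D_p^L:\ell^2(\mathbb Z_{<0};\mathcal H)\oplus\mathcal H^p\to\ell^2(\mathbb Z_{<0};\mathcal H)$ is the unitary $D^L_p(w,h)(k)=h_{k+1+p}$ for $-p\le k<0$, $=w(k+p)$ for $k<-p$. Shapes and their sides: rectangle $(p,q)$, $p,q\geq 1$: $S,N$ sides $\mathcal H_1^p$ (left to right), $W,E$ sides $\mathcal H_2^q$ (bottom to top); West half-strip $(\infty_W,q)$: $S,N$ sides $\mathcal W_W$, $E$ side $\mathcal H_2^q$; South half-strip $(p,\infty_S)$: $N$ side $\mathcal H_1^p$, $W,E$ sides $\mathcal W_S$; South-West corner $(\infty_W,\infty_S)$: $N$ side $\mathcal W_W$, $E$ side $\mathcal W_S$. For each shape $c$, $\mathcal Q_c$ is the set of bounded self-adjoint operators $M$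 on the orthogonal sum of the side spaces with $\inf_{x\neq0}\langle x,Mx\rangle/\langle x,x\rangle>0$; block indices refer to sides. Gluing: two adjacent shapes sharing a full side with space $V$ are glued by adding their quadratic forms with a common variable on the shared side and taking the Schur complement with respect to $V$; concatenated segments are identified by $\mathcal H_i^{p}\oplus\mathcal H_i^{p'}=\mathcal H_i^{p+p'}$ and the concatenation of a half-line and a segment of length $p$ is identified with the half-line through conjugation by $D_p^L$. $M|M'$ denotes the gluing with $M'$ to the East of $M$ (shared vertical side) and $M/M'$ the gluing with $M'$ to the North of $M$ (shared horizontal side). Let $Q^{[p,q]}\in\mathcal Q_{p,q}$ be the gluing of $p\times q$ copies of $Q$ along a grid, $\overline Q^{[\infty_W,q]}\in\mathcal Q_{\infty_W,q}$ the vertical stacking of $q$ copies of $\overline Q^W$, and $\overline Q^{[p,\infty_S]}\in\mathcal Q_{p,\infty_S}$ the horizontal gluing of $p$ copies of $\overline Q^S$. Definitions. $\overline Q^S$ is a South fixed point of $Q$ with identity morphisms if for all $p,q\geq1$: $\overline Q^{[p,\infty_S]}/Q^{[p,q]}=\overline Q^{[p,\infty_S]}$ and, for all $r\ge1$, $B\in\mathcal Q_{p,r}$, $(\overline Q^{[p,\infty_S]}/Q^{[p,q]})/B=\overline Q^{[p,\infty_S]}/B$. $\overline Q^W$ is a West fixed point of $Q$ with identity morphisms if for all $p,q\ge1$: $\overline Q^{[\infty_W,q]}|Q^{[p,q]}=\overline Q^{[\infty_W,q]}$ and, for all $r\ge1$, $B\in\mathcal Q_{r,q}$, $(\overline Q^{[\infty_W,q]}|Q^{[p,q]})|B=\overline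 Q^{[\infty_W,q]}|B$. The triplet is a South-West corner system of fixed points of $Q$ with identity morphisms if: (i) $\overline Q^S$ is a South fixed point with identity morphisms and for all $p\ge0$, $q\ge1$, $r\ge1$ and all $B\in\mathcal Q_{\infty_W,r}$, $$\big((\overline Q^{SW}|\overline Q^{[p,\infty_S]})\,/\,(\overline Q^{[\infty_W,q]}|Q^{[p,q]})\big)/B=(\overline Q^{SW}|\overline Q^{[p,\infty_S]})/B;$$ (ii) $\overline Q^W$ is a West fixed point with identity morphisms and for all $q\ge0$, $p\ge1$, $r\ge1$ and all $B\in\mathcal Q_{r,\infty_S}$, $$\big((\overline Q^{SW}/\overline Q^{[\infty_W,q]})\,|\,(\overline Q^{[p,\infty_S]}/Q^{[p,q]})\big)|B=(\overline Q^{SW}/\overline Q^{[\infty_W,q]})|B$$ (for $p=0$ in (i), resp. $q=0$ in (ii), the factors of zero width, resp. zero height, are omitted). *)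

theory Defs
  imports "HOL-Analysis.Analysis" "HOL-Library.Function_Algebras" "HOL-Library.FuncSet"
begin

(* Scalars. Up to isomorphism the only instances of this class are the real and the complex
   numbers: by the last two axioms every element is a root of a quadratic with real coefficients. *)

class rc_field = real_normed_field + banach +
  fixes rc_cnj :: "'a \<Rightarrow> 'a" and rc_re :: "'a \<Rightarrow> real"
  assumes rc_cnj_add: "rc_cnj (x + y) = rc_cnj x + rc_cnj y"
    and rc_cnj_mult: "rc_cnj (x * y) = rc_cnj x * rc_cnj y"
    and rc_cnj_cnj: "rc_cnj (rc_cnj x) = x"
    and rc_mult_cnj: "x * rc_cnj x = (norm x)\<^sup>2 *\<^sub>R 1"
    and rc_add_cnj: "x + rc_cnj x = (2 * rc_re x) *\<^sub>R 1"

instantiation real :: rc_field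
begin
definition "rc_cnj (x::real) = x"
definition "rc_re (x::real) = x"
instance
  by standard (simp_all add: rc_cnj_real_def rc_re_real_def flip: power2_eq_square)
end

instantiation complex :: rc_field
begin
definition "rc_cnj (z::complex) = cnj z"
definition "rc_re (z::complex) = Re z"
instance
  by standard (simp_all add: rc_cnj_complex_def rc_re_complex_def complex_add_cnj
      scaleR_conv_of_real flip: complex_norm_square)
end

(* A finite-dimensional Hilbert space over 'k is carried by a whole type. The type also provides
   the underlying real inner product space, whose norm is then the Hilbert space norm. The inner
   product is linear in its second argument; dimension 0 is allowed. *)

record ('k, 'h) hilbert =
  smult :: "'k \<Rightarrow> 'h \<Rightarrow> 'h"
  ip :: "'h \<Rightarrow> 'h \<Rightarrow> 'k"

locale fd_hilbert =
  fixes H :: "('k::rc_field, 'h::real_inner) hilbert"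
  assumes finite_dim: "\<exists>B. finite_dimensional_vector_space (smult H) B"
    and smult_of_real: "smult H (of_real r) x = r *\<^sub>R x"
    and ip_add_right: "ip H x (y + z) = ip H x y + ip H x z"
    and ip_smult_right: "ip H x (smult H c y) = c * ip H x y"
    and ip_commute: "ip H y x = rc_cnj (ip H x y)"
    and re_ip: "rc_re (ip H x y) = inner x y"


(* Extent of a shape in one direction: p unit lengths, or a half-line towards West or South. *)

datatype extent = Seg nat | Half

fun idx :: "extent \<Rightarrow> int set" where
  "idx (Seg p) = {1..int p}"
| "idx Half = {..<0}"

(* The p-th power of H is the space of functions supported on {1..p}; in particular its first
   power is identified with H. Half gives the square-summable functions on the negative integers. *)

definition side :: "extent \<Rightarrow> (int \<Rightarrow> 'h::real_inner) set" where
  "side a = {f. (\<forall>k. k \<notin> idx a \<longrightarrow> f k = 0) \<and> (\<lambda>k. (norm (f k))\<^sup>2) summable_on UNIV}"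

definition sip :: "('k::rc_field, 'h::real_inner) hilbert \<Rightarrow> (int \<Rightarrow> 'h) \<Rightarrow> (int \<Rightarrow> 'h) \<Rightarrow> 'k" where
  "sip H f g = (\<Sum>\<^sub>\<infinity>k. ip H (f k) (g k))"

definition DL :: "nat \<Rightarrow> (int \<Rightarrow> 'h) \<times> (int \<Rightarrow> 'h) \<Rightarrow> (int \<Rightarrow> 'h::real_inner)" where
  "DL p = (\<lambda>(w, h) k. if - int p \<le> k \<and> k < 0 then h (k + 1 + int p)
                     else if k < - int p then w (k + int p) else 0)"

definition adjoint_on ::
  "('u \<Rightarrow> 'u \<Rightarrow> 'k) \<Rightarrow> 'u set \<Rightarrow> ('v \<Rightarrow> 'v \<Rightarrow> 'k) \<Rightarrow> ('u \<Rightarrow> 'v) \<Rightarrow> 'v \<Rightarrow> 'u" where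
  "adjoint_on ipU U ipV T y = (THE x. x \<in> U \<and> (\<forall>u\<in>U. ipV (T u) y = ipU u x))"

definition DLadj ::
  "('k::rc_field, 'h::real_inner) hilbert \<Rightarrow> nat \<Rightarrow> (int \<Rightarrow> 'h) \<Rightarrow> (int \<Rightarrow> 'h) \<times> (int \<Rightarrow> 'h)" where
  "DLadj H p = adjoint_on (\<lambda>(w, h) (w', h'). sip H w w' + sip H h h')
                 (side Half \<times> side (Seg p)) (sip H) (DL p)"

fun ext_plus :: "extent \<Rightarrow> nat \<Rightarrow> extent" where
  "ext_plus (Seg p) p' = Seg (p + p')"
| "ext_plus Half p' = Half"

fun cat :: "extent \<Rightarrow> nat \<Rightarrow> (int \<Rightarrow> 'h) \<times> (int \<Rightarrow> 'h) \<Rightarrow> (int \<Rightarrow> 'h::real_inner)" where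
  "cat (Seg p) p' (f, g) = (\<lambda>k. if k \<le> int p then f k else g (k - int p))"
| "cat Half p' (f, g) = DL p' (f, g)"

(* Only used for extents that are finite. *)
fun seg_len :: "extent \<Rightarrow> nat" where
  "seg_len (Seg p) = p"
| "seg_len Half = 0"


(* Horizontal sides carry H1, vertical sides carry H2. The orthogonal sum of the side spaces of a
   shape is a set of quadruples, in which the component of a side that the shape does not have
   (West for infinite width, South for infinite height) is 0. *)

datatype hside = South | North
datatype vside = West | East

type_synonym ('a, 'b) bdry = "(hside \<Rightarrow> int \<Rightarrow> 'a) \<times> (vside \<Rightarrow> int \<Rightarrow> 'b)"

definition bspace :: "extent \<Rightarrow> extent \<Rightarrow> ('a::real_inner, 'b::real_inner) bdry set" where
  "bspace a b = {(f, g). f South \<in> (if b = Half then {0} else side a) \<and> f North \<in> side a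
                       \<and> g West \<in> (if a = Half then {0} else side b) \<and> g East \<in> side b}"

definition bip :: "('k::rc_field, 'a::real_inner) hilbert \<Rightarrow> ('k, 'b::real_inner) hilbert \<Rightarrow>
    ('a, 'b) bdry \<Rightarrow> ('a, 'b) bdry \<Rightarrow> 'k" where
  "bip H1 H2 x y = (\<Sum>s\<in>{South, North}. sip H1 (fst x s) (fst y s))
                 + (\<Sum>s\<in>{West, East}. sip H2 (snd x s) (snd y s))"

definition bnorm :: "('k::rc_field, 'a::real_inner) hilbert \<Rightarrow> ('k, 'b::real_inner) hilbert \<Rightarrow>
    ('a, 'b) bdry \<Rightarrow> real" where
  "bnorm H1 H2 x = sqrt (rc_re (bip H1 H2 x x))"

definition bscale :: "('k::rc_field, 'a::real_inner) hilbert \<Rightarrow> ('k, 'b::real_inner) hilbert \<Rightarrow>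
    'k \<Rightarrow> ('a, 'b) bdry \<Rightarrow> ('a, 'b) bdry" where
  "bscale H1 H2 c x = (\<lambda>s k. smult H1 c (fst x s k), \<lambda>s k. smult H2 c (snd x s k))"

(* An operator together with its shape. The operator is extensional on the sum of the side spaces
   (it takes the value undefined elsewhere), so that = is equality of operators. *)

datatype ('a, 'b) shaped_op =
  Shaped_op (width: extent) (height: extent) (act: "('a, 'b) bdry \<Rightarrow> ('a, 'b) bdry")

definition self_adjoint_op :: "('k::rc_field, 'a::real_inner) hilbert \<Rightarrow>
    ('k, 'b::real_inner) hilbert \<Rightarrow> extent \<Rightarrow> extent \<Rightarrow> ('a, 'b) shaped_op \<Rightarrow> bool" where
  "self_adjoint_op H1 H2 a b M \<longleftrightarrow> width M = a \<and> height M = b \<and>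
     act M \<in> bspace a b \<rightarrow>\<^sub>E bspace a b \<and>
     (\<forall>x\<in>bspace a b. \<forall>y\<in>bspace a b. act M (x + y) = act M x + act M y) \<and>
     (\<forall>c. \<forall>x\<in>bspace a b. act M (bscale H1 H2 c x) = bscale H1 H2 c (act M x)) \<and>
     (\<forall>x\<in>bspace a b. \<forall>y\<in>bspace a b. bip H1 H2 (act M x) y = bip H1 H2 x (act M y))"

definition face_operator :: "('k::rc_field, 'a::real_inner) hilbert \<Rightarrow>
    ('k, 'b::real_inner) hilbert \<Rightarrow> ('a, 'b) shaped_op \<Rightarrow> bool" where
  "face_operator H1 H2 Q \<longleftrightarrow> self_adjoint_op H1 H2 (Seg 1) (Seg 1) Q \<and>
     (\<forall>x\<in>bspace (Seg 1) (Seg 1). x \<noteq> 0 \<longrightarrow> 0 < rc_re (bip H1 H2 x (act Q x)))"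

(* The last conjunct says that the infimum of the Rayleigh quotient is positive, also when the
   space is {0} and the infimum is taken over the empty set. *)

definition Qset :: "('k::rc_field, 'a::real_inner) hilbert \<Rightarrow> ('k, 'b::real_inner) hilbert \<Rightarrow>
    extent \<Rightarrow> extent \<Rightarrow> ('a, 'b) shaped_op set" where
  "Qset H1 H2 a b = {M. self_adjoint_op H1 H2 a b M \<and>
     (\<exists>C. \<forall>x\<in>bspace a b. bnorm H1 H2 (act M x) \<le> C * bnorm H1 H2 x) \<and>
     (\<exists>c>0. \<forall>x\<in>bspace a b. c * rc_re (bip H1 H2 x x) \<le> rc_re (bip H1 H2 x (act M x)))}"


(* Schur complement with respect to the second summand, whose carrier is V2. *)

definition schur :: "'v set \<Rightarrow> ('u::ab_group_add \<times> 'v::ab_group_add \<Rightarrow> 'u \<times> 'v) \<Rightarrow> 'u \<Rightarrow> 'u" where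
  "schur V2 G u =
     fst (G (u, 0)) - fst (G (0, inv_into V2 (\<lambda>v. snd (G (0, v))) (snd (G (u, 0)))))"

definition set_h :: "hside \<Rightarrow> (int \<Rightarrow> 'a) \<Rightarrow> ('a, 'b) bdry \<Rightarrow> ('a, 'b) bdry" where
  "set_h s f x = ((fst x)(s := f), snd x)"

definition set_v :: "vside \<Rightarrow> (int \<Rightarrow> 'b) \<Rightarrow> ('a, 'b) bdry \<Rightarrow> ('a, 'b) bdry" where
  "set_v s g x = (fst x, (snd x)(s := g))"

(* In both gluings, form_sum is the operator of the sum of the two quadratic forms with a common
   variable v on the shared side, as a function of ((x, x'), v) where x and x' vanish on the shared
   side; join then identifies (x, x') with boundary data of the glued shape.

   "M beside M'" has M' to the East of M, "M below M'" has M' to the North of M. The second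
   operand must be finite in the direction of gluing. *)

definition h_form_sum :: "('a, 'b) shaped_op \<Rightarrow> ('a, 'b) shaped_op \<Rightarrow>
    (('a, 'b) bdry \<times> ('a, 'b) bdry) \<times> (int \<Rightarrow> 'b) \<Rightarrow>
    (('a::real_inner, 'b::real_inner) bdry \<times> ('a, 'b) bdry) \<times> (int \<Rightarrow> 'b)" where
  "h_form_sum M M' = (\<lambda>((x, x'), v).
     let y = act M (set_v East v x); y' = act M' (set_v West v x')
     in ((set_v East 0 y, set_v West 0 y'), snd y East + snd y' West))"

definition h_join :: "('a, 'b) shaped_op \<Rightarrow> ('a, 'b) shaped_op \<Rightarrow>
    ('a, 'b) bdry \<times> ('a, 'b) bdry \<Rightarrow> ('a::real_inner, 'b::real_inner) bdry" where
  "h_join M M' = (\<lambda>(x, x').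
     (\<lambda>s. cat (width M) (seg_len (width M')) (fst x s, fst x' s),
      \<lambda>s. case s of West \<Rightarrow> snd x West | East \<Rightarrow> snd x' East))"

definition h_outer :: "('a, 'b) shaped_op \<Rightarrow> ('a, 'b) shaped_op \<Rightarrow>
    (('a::real_inner, 'b::real_inner) bdry \<times> ('a, 'b) bdry) set" where
  "h_outer M M' = {x \<in> bspace (width M) (height M). snd x East = 0} \<times>
                  {x' \<in> bspace (width M') (height M'). snd x' West = 0}"

definition beside :: "('a::real_inner, 'b::real_inner) shaped_op \<Rightarrow> ('a, 'b) shaped_op \<Rightarrow>
    ('a, 'b) shaped_op" (infixl \<open>beside\<close> 65) where
  "M beside M' =
     (let a = ext_plus (width M) (seg_len (width M')); b = height M
      in Shaped_op a b (\<lambda>z\<in>bspace a b.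
           h_join M M' (schur (side b) (h_form_sum M M')
             (inv_into (h_outer M M') (h_join M M') z))))"

definition v_form_sum :: "('a, 'b) shaped_op \<Rightarrow> ('a, 'b) shaped_op \<Rightarrow>
    (('a, 'b) bdry \<times> ('a, 'b) bdry) \<times> (int \<Rightarrow> 'a) \<Rightarrow>
    (('a::real_inner, 'b::real_inner) bdry \<times> ('a, 'b) bdry) \<times> (int \<Rightarrow> 'a)" where
  "v_form_sum M M' = (\<lambda>((x, x'), v).
     let y = act M (set_h North v x); y' = act M' (set_h South v x')
     in ((set_h North 0 y, set_h South 0 y'), fst y North + fst y' South))"

definition v_join :: "('a, 'b) shaped_op \<Rightarrow> ('a, 'b) shaped_op \<Rightarrow>
    ('a, 'b) bdry \<times> ('a, 'b) bdry \<Rightarrow> ('a::real_inner, 'b::real_inner) bdry" where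
  "v_join M M' = (\<lambda>(x, x').
     (\<lambda>s. case s of South \<Rightarrow> fst x South | North \<Rightarrow> fst x' North,
      \<lambda>s. cat (height M) (seg_len (height M')) (snd x s, snd x' s)))"

definition v_outer :: "('a, 'b) shaped_op \<Rightarrow> ('a, 'b) shaped_op \<Rightarrow>
    (('a::real_inner, 'b::real_inner) bdry \<times> ('a, 'b) bdry) set" where
  "v_outer M M' = {x \<in> bspace (width M) (height M). fst x North = 0} \<times>
                  {x' \<in> bspace (width M') (height M'). fst x' South = 0}"

definition below :: "('a::real_inner, 'b::real_inner) shaped_op \<Rightarrow> ('a, 'b) shaped_op \<Rightarrow>
    ('a, 'b) shaped_op" (infixl \<open>below\<close> 65) where
  "M below M' =
     (let a = width M; b = ext_plus (height M) (seg_len (height M'))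
      in Shaped_op a b (\<lambda>z\<in>bspace a b.
           v_join M M' (schur (side a) (v_form_sum M M')
             (inv_into (v_outer M M') (v_join M M') z))))"

(* Gluings of n copies, for n \<ge> 1. *)

definition hstack :: "nat \<Rightarrow> ('a::real_inner, 'b::real_inner) shaped_op \<Rightarrow> ('a, 'b) shaped_op" where
  "hstack n M = ((\<lambda>X. X beside M) ^^ (n - 1)) M"

definition vstack :: "nat \<Rightarrow> ('a::real_inner, 'b::real_inner) shaped_op \<Rightarrow> ('a, 'b) shaped_op" where
  "vstack n M = ((\<lambda>X. X below M) ^^ (n - 1)) M"

definition grid :: "('a::real_inner, 'b::real_inner) shaped_op \<Rightarrow> nat \<Rightarrow> nat \<Rightarrow> ('a, 'b) shaped_op"
  where "grid Q p q = vstack q (hstack p Q)"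


definition south_fixed_point :: "('k::rc_field, 'a::real_inner) hilbert \<Rightarrow>
    ('k, 'b::real_inner) hilbert \<Rightarrow> ('a, 'b) shaped_op \<Rightarrow> ('a, 'b) shaped_op \<Rightarrow> bool" where
  "south_fixed_point H1 H2 Q QS \<longleftrightarrow> (\<forall>p\<ge>1. \<forall>q\<ge>1.
     hstack p QS below grid Q p q = hstack p QS \<and>
     (\<forall>r\<ge>1. \<forall>B \<in> Qset H1 H2 (Seg p) (Seg r).
        (hstack p QS below grid Q p q) below B = hstack p QS below B))"

definition west_fixed_point :: "('k::rc_field, 'a::real_inner) hilbert \<Rightarrow>
    ('k, 'b::real_inner) hilbert \<Rightarrow> ('a, 'b) shaped_op \<Rightarrow> ('a, 'b) shaped_op \<Rightarrow> bool" where
  "west_fixed_point H1 H2 Q QW \<longleftrightarrow> (\<forall>p\<ge>1. \<forall>q\<ge>1.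
     vstack q QW beside grid Q p q = vstack q QW \<and>
     (\<forall>r\<ge>1. \<forall>B \<in> Qset H1 H2 (Seg r) (Seg q).
        (vstack q QW beside grid Q p q) beside B = vstack q QW beside B))"

definition sw_corner_system :: "('k::rc_field, 'a::real_inner) hilbert \<Rightarrow>
    ('k, 'b::real_inner) hilbert \<Rightarrow> ('a, 'b) shaped_op \<Rightarrow>
    ('a, 'b) shaped_op \<Rightarrow> ('a, 'b) shaped_op \<Rightarrow> ('a, 'b) shaped_op \<Rightarrow> bool" where
  "sw_corner_system H1 H2 Q QW QS QSW \<longleftrightarrow>
     south_fixed_point H1 H2 Q QS \<and>
     (\<forall>p. \<forall>q\<ge>1. \<forall>r\<ge>1. \<forall>B \<in> Qset H1 H2 Half (Seg r).
        let M = (if p = 0 then QSW else QSW beside hstack p QS);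
            M' = (if p = 0 then vstack q QW else vstack q QW beside grid Q p q)
        in (M below M') below B = M below B) \<and>
     west_fixed_point H1 H2 Q QW \<and>
     (\<forall>q. \<forall>p\<ge>1. \<forall>r\<ge>1. \<forall>B \<in> Qset H1 H2 (Seg r) Half.
        let M = (if q = 0 then QSW else QSW below vstack q QW);
            M' = (if q = 0 then hstack p QS else hstack p QS below grid Q p q)
        in (M beside M') beside B = M beside B)"


(* Blocks, from the side b to the side a; the suffix gives the directions of a and b. *)

definition blk_hh :: "('a::real_inner, 'b::real_inner) shaped_op \<Rightarrow> hside \<Rightarrow> hside \<Rightarrow>
    (int \<Rightarrow> 'a) \<Rightarrow> int \<Rightarrow> 'a" where
  "blk_hh M a b f = fst (act M (set_h b f 0)) a"

definition blk_hv :: "('a::real_inner, 'b::real_inner) shaped_op \<Rightarrow> hside \<Rightarrow> vside \<Rightarrow>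
    (int \<Rightarrow> 'b) \<Rightarrow> int \<Rightarrow> 'a" where
  "blk_hv M a b g = fst (act M (set_v b g 0)) a"

definition blk_vh :: "('a::real_inner, 'b::real_inner) shaped_op \<Rightarrow> vside \<Rightarrow> hside \<Rightarrow>
    (int \<Rightarrow> 'a) \<Rightarrow> int \<Rightarrow> 'b" where
  "blk_vh M a b f = snd (act M (set_h b f 0)) a"

definition blk_vv :: "('a::real_inner, 'b::real_inner) shaped_op \<Rightarrow> vside \<Rightarrow> vside \<Rightarrow>
    (int \<Rightarrow> 'b) \<Rightarrow> int \<Rightarrow> 'b" where
  "blk_vv M a b g = snd (act M (set_v b g 0)) a"

definition col :: "('u \<Rightarrow> 'v) \<Rightarrow> ('u \<Rightarrow> 'w) \<Rightarrow> 'u \<Rightarrow> 'v \<times> 'w" where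
  "col A B u = (A u, B u)"

definition row :: "('u \<Rightarrow> 'w::ab_group_add) \<Rightarrow> ('v \<Rightarrow> 'w) \<Rightarrow> 'u \<times> 'v \<Rightarrow> 'w" where
  "row A B = (\<lambda>(u, v). A u + B v)"

definition diag :: "('u \<Rightarrow> 'u') \<Rightarrow> ('v \<Rightarrow> 'v') \<Rightarrow> 'u \<times> 'v \<Rightarrow> 'u' \<times> 'v'" where
  "diag A B = (\<lambda>(u, v). (A u, B v))"

(* Below, sums, differences and negatives of operators are the pointwise ones on functions. *)

definition west_eqs :: "('k::rc_field, 'a::real_inner) hilbert \<Rightarrow>
    ('a, 'b::real_inner) shaped_op \<Rightarrow> ('a, 'b) shaped_op \<Rightarrow> bool" where
  "west_eqs H1 Q BW \<longleftrightarrow>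
    (let K = blk_vv BW East East + blk_vv Q West West;
         Ki = inv_into (side (Seg 1)) K
     in (\<forall>h \<in> side (Seg 1). blk_vv BW East East h =
           (blk_vv Q East East - (blk_vv Q East West \<circ> Ki \<circ> blk_vv Q West East)) h) \<and>
        (\<forall>a. \<forall>h \<in> side (Seg 1). blk_hv BW a East h =
           DL 1 (col (- (blk_hv BW a East \<circ> Ki \<circ> blk_vv Q West East))
                     (blk_hv Q a East - (blk_hv Q a West \<circ> Ki \<circ> blk_vv Q West East)) h)) \<and>
        (\<forall>a b. \<forall>f \<in> side Half. blk_hh BW a b f =
           DL 1 ((diag (blk_hh BW a b) (blk_hh Q a b)
                  - (col (blk_hv BW a East) (blk_hv Q a West) \<circ> Ki
                     \<circ> row (blk_vh BW East b) (blk_vh Q West b))) (DLadj H1 1 f))))"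

definition south_eqs :: "('k::rc_field, 'b::real_inner) hilbert \<Rightarrow>
    ('a::real_inner, 'b) shaped_op \<Rightarrow> ('a, 'b) shaped_op \<Rightarrow> bool" where
  "south_eqs H2 Q BS \<longleftrightarrow>
    (let K = blk_hh BS North North + blk_hh Q South South;
         Ki = inv_into (side (Seg 1)) K
     in (\<forall>h \<in> side (Seg 1). blk_hh BS North North h =
           (blk_hh Q North North - (blk_hh Q North South \<circ> Ki \<circ> blk_hh Q South North)) h) \<and>
        (\<forall>a. \<forall>h \<in> side (Seg 1). blk_vh BS a North h =
           DL 1 (col (- (blk_vh BS a North \<circ> Ki \<circ> blk_hh Q South North))
                     (blk_vh Q a North - (blk_vh Q a South \<circ> Ki \<circ> blk_hh Q South North)) h)) \<and>
        (\<forall>a b. \<forall>f \<in> side Half. blk_vv BS a b f =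
           DL 1 ((diag (blk_vv BS a b) (blk_vv Q a b)
                  - (col (blk_vh BS a North) (blk_vh Q a South) \<circ> Ki
                     \<circ> row (blk_hv BS North b) (blk_hv Q South b))) (DLadj H2 1 f))))"

definition corner_eqs_S :: "('k::rc_field, 'a::real_inner) hilbert \<Rightarrow>
    ('k, 'b::real_inner) hilbert \<Rightarrow> ('a, 'b) shaped_op \<Rightarrow> ('a, 'b) shaped_op \<Rightarrow> bool" where
  "corner_eqs_S H1 H2 BS C \<longleftrightarrow>
    (let L2 = blk_vv C East East + blk_vv BS West West;
         Li = inv_into (side Half) L2
     in (\<forall>g \<in> side Half. blk_vv C East East g =
           (blk_vv BS East East - (blk_vv BS East West \<circ> Li \<circ> blk_vv BS West East)) g) \<and>
        (\<forall>g \<in> side Half.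
           blk_hv C North East g
             = adjoint_on (sip H1) (side Half) (sip H2) (blk_vh C East North) g \<and>
           blk_hv C North East g =
           DL 1 (col (- (blk_hv C North East \<circ> Li \<circ> blk_vv BS West East))
                     (blk_hv BS North East - (blk_hv BS North West \<circ> Li \<circ> blk_vv BS West East)) g)) \<and>
        (\<forall>f \<in> side Half. blk_hh C North North f =
           DL 1 ((diag (blk_hh C North North) (blk_hh BS North North)
                  - (col (blk_hv C North East) (blk_hv BS North West) \<circ> Li
                     \<circ> row (blk_vh C East North) (blk_vh BS West North))) (DLadj H1 1 f))))"

definition corner_eqs_W :: "('k::rc_field, 'a::real_inner) hilbert \<Rightarrow>
    ('k, 'b::real_inner) hilbert \<Rightarrow> ('a, 'b) shaped_op \<Rightarrow> ('a, 'b) shaped_op \<Rightarrow> bool" where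
  "corner_eqs_W H1 H2 BW C \<longleftrightarrow>
    (let L1 = blk_hh C North North + blk_hh BW South South;
         Li = inv_into (side Half) L1
     in (\<forall>f \<in> side Half. blk_hh C North North f =
           (blk_hh BW North North - (blk_hh BW North South \<circ> Li \<circ> blk_hh BW South North)) f) \<and>
        (\<forall>f \<in> side Half.
           blk_vh C East North f
             = adjoint_on (sip H2) (side Half) (sip H1) (blk_hv C North East) f \<and>
           blk_vh C East North f =
           DL 1 (col (- (blk_vh C East North \<circ> Li \<circ> blk_hh BW South North))
                     (blk_vh BW East North - (blk_vh BW East South \<circ> Li \<circ> blk_hh BW South North)) f)) \<and>
        (\<forall>g \<in> side Half. blk_vv C East East g =
           DL 1 ((diag (blk_vv C East East) (blk_vv BW East East)
                  - (col (blk_vh C East North) (blk_vh BW East South) \<circ> Li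
                     \<circ> row (blk_hv C North East) (blk_hv BW South East))) (DLadj H2 1 g))))"

end

theory Submission
  imports Defs
begin

text \<open>Only the underlying real inner products matter. Eliminating the shared side of two coercive
  symmetric operators amounts to inverting a coercive operator on one side, which is possible on
  the half-line too, since \<open>\<ell>\<^sup>2\<close> over a finite-dimensional space is complete (Lax-Milgram via a
  contraction). So a gluing is the composition of two relations between boundary values and fluxes:
  the values on the shared side agree and the fluxes through it cancel. In this form associativity
  and the interchange law are immediate, and they reduce all fixed point identities to those for a
  single row, column, or corner step. Conversely, gluing with an operator that couples its two
  opposite sides by half the identity is injective, so the identities tested against all
  \<open>B\<close> already give the bare fixed point equations of the corner.\<close>

subsection \<open>Scalars and finite-dimensional Hilbert spaces\<close>

text \<open>Iterated gluings must stay invertible, so a property stable under elimination is needed.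
  It is a two-sided bound \<open>c |x|^2 <= <M x, x> <= C |x|^2\<close> on the form: the solution of
  the gluing relation minimises the total energy over the shared variable, which preserves both
  bounds. A face operator is merely positive definite, and its bounds must come from finite
  dimension, given over the scalars and first transferred to the reals. The factor one half in the
  cancellation argument is a compromise: the coupling of opposite sides has to be invertible, yet
  small enough to leave the operator positive. Identity plus half an exchange has its form between
  1/2 and 3/2 of the squared norm. Horizontal and vertical gluings are separate definitions, so
  facts on the vertical one are pulled back by transposition. This respects operators only on their
  carriers, hence the distinction between agreement and equality. The four systems of block
  equations are instances of a single one, again up to transposition, and the missing off-diagonal
  blocks are recovered by symmetry.\<close>

lemma rc_cnj_0: "rc_cnj (0::'k::rc_field) = 0"
  using rc_cnj_add[of "0::'k" 0] by simp

text \<open>The axioms do not state this; cancel \<open>of_real r\<close> in the instance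
  \<open>x = of_real r\<close> of \<open>rc_mult_cnj\<close>.\<close>

lemma rc_cnj_of_real: "rc_cnj (of_real r :: 'k::rc_field) = of_real r"
proof (cases "r = 0")
  case False
  have "(of_real r :: 'k) * rc_cnj (of_real r) = of_real r * of_real r"
    by (simp add: rc_mult_cnj scaleR_conv_of_real power2_eq_square flip: of_real_mult)
  with False show ?thesis by simp
qed (simp add: rc_cnj_0)

lemma norm_rc_cnj: "norm (rc_cnj x) = norm (x::'k::rc_field)"
proof (cases "x = 0")
  case False
  have "norm x * norm (rc_cnj x) = norm (x * rc_cnj x)" by (simp add: norm_mult)
  also have "\<dots> = norm x * norm x" by (simp add: rc_mult_cnj power2_eq_square)
  finally show ?thesis using False by simp
qed (simp add: rc_cnj_0)

lemma bounded_linear_rc_cnj: "bounded_linear (rc_cnj :: 'k::rc_field \<Rightarrow> 'k)"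
proof (rule bounded_linear_intro[where K = 1])
  show "rc_cnj (r *\<^sub>R x) = r *\<^sub>R rc_cnj x" for r and x :: 'k
    by (simp add: scaleR_conv_of_real rc_cnj_mult rc_cnj_of_real)
qed (simp_all add: rc_cnj_add norm_rc_cnj)

lemma of_real_rc_re: "of_real (2 * rc_re x) = x + rc_cnj (x::'k::rc_field)"
  by (simp add: rc_add_cnj scaleR_conv_of_real)

lemma bounded_linear_rc_re: "bounded_linear (rc_re :: 'k::rc_field \<Rightarrow> real)"
proof (rule bounded_linear_intro[where K = 1])
  show "rc_re (x + y) = rc_re x + rc_re y" for x y :: 'k
  proof -
    have "of_real (2 * rc_re (x + y)) = (of_real (2 * (rc_re x + rc_re y)) :: 'k)"
      unfolding distrib_left of_real_add
      by (simp add: rc_cnj_add of_real_rc_re del: of_real_mult)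
    then show ?thesis unfolding of_real_eq_iff by simp
  qed
  show "rc_re (r *\<^sub>R x) = r *\<^sub>R rc_re x" for r and x :: 'k
  proof -
    interpret bounded_linear "rc_cnj :: 'k \<Rightarrow> 'k" by (rule bounded_linear_rc_cnj)
    have "of_real (2 * rc_re (r *\<^sub>R x)) = r *\<^sub>R (x + rc_cnj x)"
      by (simp add: of_real_rc_re scaleR scaleR_right_distrib del: of_real_mult)
    also have "\<dots> = of_real (2 * (r * rc_re x))"
      by (simp add: scaleR_conv_of_real flip: of_real_rc_re)
    finally show ?thesis unfolding of_real_eq_iff by simp
  qed
  show "norm (rc_re x) \<le> norm x * 1" for x :: 'k
  proof -
    have "2 * \<bar>rc_re x\<bar> = norm (x + rc_cnj x)" by (simp add: rc_add_cnj)
    also have "\<dots> \<le> 2 * norm x" using norm_triangle_ineq[of x "rc_cnj x"] by (simp add: norm_rc_cnj)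
    finally show ?thesis by simp
  qed
qed

lemma rc_re_of_real: "rc_re (of_real r :: 'k::rc_field) = r"
proof -
  have "(of_real (2 * rc_re (of_real r :: 'k)) :: 'k) = of_real (2 * r)"
    unfolding of_real_rc_re by (simp add: rc_cnj_of_real)
  then show ?thesis unfolding of_real_eq_iff by simp
qed

text \<open>Finite dimension over the scalars has to become finite dimension over the reals.
  Subtracting real parts leaves skew elements, \<open>rc_cnj v = - v\<close>, whose squares are
  nonpositive reals. The square of one is thus a nonnegative multiple of the square of a nonzero
  other one, and in a field the elements themselves are then proportional.\<close>

lemma rc_span_finite: "\<exists>i::'k::rc_field. \<forall>x. \<exists>s t. x = s *\<^sub>R 1 + t *\<^sub>R i"
proof -
  have lin: "linear (rc_cnj :: 'k \<Rightarrow> 'k)" by (rule bounded_linear.linear[OF bounded_linear_rc_cnj])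
  show ?thesis
  proof (cases "\<exists>u::'k. rc_cnj u = - u \<and> u \<noteq> 0")
    case True
    then obtain u :: 'k where u: "rc_cnj u = - u" "u \<noteq> 0" by blast
    have sq: "v * v = - ((norm v)\<^sup>2 *\<^sub>R 1)" if "rc_cnj v = - v" for v :: 'k
      using rc_mult_cnj[of v] that by (metis minus_minus mult_minus_right)
    show ?thesis
    proof (rule exI[of _ u], rule allI)
      fix x :: 'k
      define v where "v = x - rc_re x *\<^sub>R 1"
      have "rc_cnj x = rc_re x *\<^sub>R 1 + rc_re x *\<^sub>R 1 - x"
        using rc_add_cnj[of x] unfolding mult_2 scaleR_left_distrib by (metis add_diff_cancel_left')
      moreover have "rc_cnj v = rc_cnj x - rc_re x *\<^sub>R 1"
        using rc_cnj_of_real[of 1, where ?'k = 'k]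
        by (simp add: v_def linear_diff[OF lin] linear_scale[OF lin])
      ultimately have cv: "rc_cnj v = - v"
        unfolding v_def by (simp only: diff_diff_eq) simp
      \<comment> \<open>The factor \<open>t\<close> gives \<open>v\<close> and \<open>t u\<close>
        equal squares; a vanishing product in a field leaves \<open>v = t u\<close> or
        \<open>v = - t u\<close>.\<close>
      define t where "t = norm v / norm u"
      have "(v - t *\<^sub>R u) * (v + t *\<^sub>R u) = v * v - t\<^sup>2 *\<^sub>R (u * u)"
        by (simp add: algebra_simps power2_eq_square)
      also have "\<dots> = 0"
        using u(2) by (simp add: sq[OF cv] sq[OF u(1)] t_def power_divide)
      finally have "v = t *\<^sub>R u \<or> v = (- t) *\<^sub>R u" by (auto simp: add_eq_0_iff)
      then show "\<exists>s t. x = s *\<^sub>R 1 + t *\<^sub>R u"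
        unfolding v_def by (metis diff_add_cancel add.commute)
    qed
  next
    case False
    \<comment> \<open>Without nonzero skew elements every scalar is real, and 0 serves as the second
      generator.\<close>
    show ?thesis
    proof (rule exI[of _ 0], rule allI)
      fix x :: 'k
      have "rc_cnj x = rc_re x *\<^sub>R 1 + rc_re x *\<^sub>R 1 - x"
        using rc_add_cnj[of x] unfolding mult_2 scaleR_left_distrib by (metis add_diff_cancel_left')
      moreover have "rc_cnj (x - rc_re x *\<^sub>R 1) = rc_cnj x - rc_re x *\<^sub>R 1"
        using rc_cnj_of_real[of 1, where ?'k = 'k]
        by (simp add: linear_diff[OF lin] linear_scale[OF lin])
      ultimately have "rc_cnj (x - rc_re x *\<^sub>R 1) = - (x - rc_re x *\<^sub>R 1)"
        by (simp only: diff_diff_eq) simp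
      with False have "x - rc_re x *\<^sub>R 1 = 0" by blast
      then have "x = rc_re x *\<^sub>R 1" by simp
      then show "\<exists>s t. x = s *\<^sub>R 1 + t *\<^sub>R (0::'k)" by auto
    qed
  qed
qed

context fd_hilbert
begin

lemma ip_add_left: "ip H (x + y) z = ip H x z + ip H y z"
  by (metis ip_add_right ip_commute rc_cnj_add)

lemma ip_scaleR_right: "ip H x (r *\<^sub>R y) = r *\<^sub>R ip H x y"
  by (simp add: ip_smult_right scaleR_conv_of_real flip: smult_of_real)

lemma ip_scaleR_left: "ip H (r *\<^sub>R x) y = r *\<^sub>R ip H x y"
  unfolding ip_commute[of _ y] ip_scaleR_right
  by (rule linear_scale[OF bounded_linear.linear[OF bounded_linear_rc_cnj]])

lemma norm_smult: "norm (smult H c x) = norm c * norm x"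
proof -
  have "ip H (smult H c x) (smult H c x) = c * rc_cnj c * ip H x x"
    by (metis ip_commute ip_smult_right mult.assoc rc_cnj_mult)
  then have "rc_re (ip H (smult H c x) (smult H c x)) = rc_re ((norm c)\<^sup>2 *\<^sub>R ip H x x)"
    by (simp add: rc_mult_cnj)
  also have "\<dots> = (norm c)\<^sup>2 * rc_re (ip H x x)"
    by (simp add: linear_scale[OF bounded_linear.linear[OF bounded_linear_rc_re]])
  finally have "(norm (smult H c x))\<^sup>2 = (norm c * norm x)\<^sup>2"
    by (simp add: re_ip power_mult_distrib dot_square_norm)
  then show ?thesis by simp
qed

text \<open>Reduced to the real Cauchy-Schwarz inequality: multiplying \<open>y\<close> by the
  conjugate of \<open>ip H x y\<close> makes the inner product real and equal to the squared norm of
  \<open>ip H x y\<close>.\<close>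

lemma norm_ip_le: "norm (ip H x y) \<le> norm x * norm y"
proof -
  define z where "z = ip H x y"
  have "(norm z)\<^sup>2 = rc_re (of_real ((norm z)\<^sup>2) :: 'k)" by (simp only: rc_re_of_real)
  also have "of_real ((norm z)\<^sup>2) = rc_cnj z * z"
    by (simp add: mult.commute[of "rc_cnj z"] rc_mult_cnj scaleR_conv_of_real)
  also have "rc_re \<dots> = inner x (smult H (rc_cnj z) y)"
    by (simp add: z_def flip: re_ip ip_smult_right)
  also have "\<dots> \<le> norm x * (norm z * norm y)"
    using norm_cauchy_schwarz[of x "smult H (rc_cnj z) y"] by (simp add: norm_smult norm_rc_cnj)
  finally have "norm z * norm z \<le> norm z * (norm x * norm y)" by (simp add: power2_eq_square ac_simps)
  then show ?thesis
    by (cases "norm z = 0") (auto simp: z_def)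
qed

lemma bounded_bilinear_ip: "bounded_bilinear (ip H)"
  by standard (auto simp: ip_add_left ip_add_right ip_scaleR_left ip_scaleR_right
      intro!: exI[of _ 1] norm_ip_le)

text \<open>A basis over the scalars together with its multiples by the second generator from
  \<open>rc_span_finite\<close> spans over the reals.\<close>

lemma real_span_finite: "\<exists>S. finite S \<and> span S = (UNIV :: 'h set)"
proof -
  obtain B where B: "finite_dimensional_vector_space (smult H) B" using finite_dim by blast
  interpret V: finite_dimensional_vector_space "smult H" B by (rule B)
  obtain i :: 'k where i: "\<And>x. \<exists>s t. x = s *\<^sub>R 1 + t *\<^sub>R i" using rc_span_finite by blast
  define S where "S = B \<union> smult H i ` B"
  have "x \<in> span S" for x
  proof -
    have "x \<in> V.span B" by (simp add: V.span_Basis)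
    then obtain u where u: "x = (\<Sum>b\<in>B. smult H (u b) b)"
      using V.span_finite[OF V.finite_Basis] by auto
    have "smult H (u b) b \<in> span S" if "b \<in> B" for b
    proof -
      obtain s t where st: "u b = s *\<^sub>R 1 + t *\<^sub>R i" using i by blast
      have "smult H (u b) b = s *\<^sub>R b + t *\<^sub>R smult H i b"
        unfolding st scaleR_conv_of_real[of s 1] scaleR_conv_of_real[of t i]
        by (simp add: V.scale_left_distrib smult_of_real flip: V.scale_scale)
      also have "\<dots> \<in> span S"
        using that by (intro span_add span_scale span_base) (auto simp: S_def)
      finally show ?thesis .
    qed
    then show ?thesis unfolding u by (intro span_sum)
  qed
  moreover have "finite S" by (simp add: S_def V.finite_Basis)
  ultimately show ?thesis by blast
qed

end

section \<open>Orthogonal coordinates, completeness and coercivity in finite dimension\<close>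

lemma orthogonal_expansion:
  fixes S :: "'v::real_inner set"
  assumes "finite S" and "span S = UNIV"
  obtains E :: "'v set" where "finite E" and "\<And>x. x = (\<Sum>e\<in>E. (inner x e / inner e e) *\<^sub>R e)"
proof -
  obtain E where E: "finite E" "span E = span S" "pairwise orthogonal E"
    using basis_orthogonal[OF assms(1)] by blast
  have "x = (\<Sum>e\<in>E. (inner x e / inner e e) *\<^sub>R e)" for x
  proof -
    define d where "d = x - (\<Sum>e\<in>E. (inner x e / inner e e) *\<^sub>R e)"
    have "orthogonal d e" if "e \<in> E" for e
    proof -
      have "inner (\<Sum>e'\<in>E. (inner x e' / inner e' e') *\<^sub>R e') e
          = (\<Sum>e'\<in>E. (inner x e' / inner e' e') * inner e' e)"
        by (simp add: inner_sum_left)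
      \<comment> \<open>\<open>E\<close> may contain 0; its coefficient is then
        \<open>0 / 0 = 0\<close>, so the identity holds for it as well.\<close>
      also have "\<dots> = (\<Sum>e'\<in>E. if e' = e then inner x e else 0)"
        by (intro sum.cong refl) (use E(3) that in \<open>auto simp: pairwise_def orthogonal_def\<close>)
      also have "\<dots> = inner x e" using E(1) that by simp
      finally show ?thesis by (simp add: d_def orthogonal_def inner_diff_left)
    qed
    then have "orthogonal d d"
      using orthogonal_to_span[of d E d] E(2) assms(2) by (auto simp: orthogonal_commute)
    then show ?thesis by (simp add: d_def orthogonal_def)
  qed
  with E(1) that show ?thesis by blast
qed

lemma complete_finite_span:
  fixes S :: "'v::real_inner set"
  assumes "finite S" and "span S = UNIV"
  shows "complete (UNIV :: 'v set)"
proof -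
  obtain E :: "'v set" where E: "finite E" "\<And>x. x = (\<Sum>e\<in>E. (inner x e / inner e e) *\<^sub>R e)"
    using orthogonal_expansion[OF assms] by metis
  show ?thesis
    unfolding complete_def
  proof (intro allI impI)
    fix f :: "nat \<Rightarrow> 'v"
    assume f: "(\<forall>n. f n \<in> UNIV) \<and> Cauchy f"
    have "convergent (\<lambda>n. inner (f n) e)" for e
      using f by (intro Cauchy_convergent bounded_linear.Cauchy[OF bounded_linear_inner_left]) auto
    then obtain l where l: "\<And>e. (\<lambda>n. inner (f n) e) \<longlonglongrightarrow> l e"
      unfolding convergent_def by metis
    have "(\<lambda>n. \<Sum>e\<in>E. (inner (f n) e / inner e e) *\<^sub>R e) \<longlonglongrightarrow> (\<Sum>e\<in>E. (l e / inner e e) *\<^sub>R e)"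
      unfolding divide_inverse by (intro tendsto_intros l)
    then show "\<exists>x\<in>UNIV. f \<longlonglongrightarrow> x" unfolding E(2)[symmetric] by blast
  qed
qed

lemma linear_bound_finite_span:
  fixes S :: "'v::real_inner set" and T :: "'v \<Rightarrow> 'v"
  assumes "finite S" and "span S = UNIV" and "linear T"
  obtains C where "C > 0" and "\<And>x. norm (T x) \<le> C * norm x"
proof -
  obtain E :: "'v set" where E: "finite E" "\<And>x. x = (\<Sum>e\<in>E. (inner x e / inner e e) *\<^sub>R e)"
    using orthogonal_expansion[OF assms(1,2)] by metis
  \<comment> \<open>The summand 1 makes \<open>C\<close> positive even when the sum vanishes;
    \<open>pos_def_coercive\<close> divides by such a constant.\<close>
  define C where "C = (\<Sum>e\<in>E. norm e / inner e e * norm (T e)) + 1"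
  have "norm (T x) \<le> C * norm x" for x
  proof -
    have "T x = (\<Sum>e\<in>E. (inner x e / inner e e) *\<^sub>R T e)"
      by (subst E(2)[of x]) (simp add: linear_sum[OF assms(3)] linear_scale[OF assms(3)])
    also have "norm \<dots> \<le> (\<Sum>e\<in>E. norm e / inner e e * norm (T e) * norm x)"
    proof (rule sum_norm_le)
      fix e
      have "norm ((inner x e / inner e e) *\<^sub>R T e) = \<bar>inner x e\<bar> * (norm (T e) / inner e e)" by simp
      also have "\<dots> \<le> (norm x * norm e) * (norm (T e) / inner e e)"
        by (intro mult_right_mono Cauchy_Schwarz_ineq2) simp
      finally show "norm ((inner x e / inner e e) *\<^sub>R T e)
          \<le> norm e / inner e e * norm (T e) * norm x" by (simp add: ac_simps)
    qed
    also have "\<dots> = (\<Sum>e\<in>E. norm e / inner e e * norm (T e)) * norm x"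
      by (simp only: sum_distrib_right)
    also have "\<dots> \<le> C * norm x" by (intro mult_right_mono) (simp_all add: C_def)
    finally show ?thesis .
  qed
  moreover have "C > 0" unfolding C_def by (intro add_nonneg_pos sum_nonneg) auto
  ultimately show ?thesis using that by blast
qed

text \<open>No compactness of the unit sphere is involved: \<open>T\<close> is injective, hence
  surjective with a linear right inverse, and the bound \<open>K\<close> of this inverse yields the
  lower constant \<open>1 / K\<close>.\<close>

lemma pos_def_coercive:
  fixes S :: "'v::real_inner set" and T :: "'v \<Rightarrow> 'v"
  assumes S: "finite S" "span S = UNIV" and "linear T"
    and sym: "\<And>x y. inner (T x) y = inner x (T y)"
    and pos: "\<And>x. x \<noteq> 0 \<Longrightarrow> inner (T x) x > 0"
  obtains c C where "c > 0" and "\<And>x. c * inner x x \<le> inner (T x) x"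
    and "\<And>x. inner (T x) x \<le> C * inner x x"
proof -
  obtain B where B: "B \<subseteq> S" "independent B" "span B = span S" 
    by (metis maximal_independent_subset span_span subset_antisym span_mono)
  have "finite_dimensional_vector_space ((*\<^sub>R) :: real \<Rightarrow> 'v \<Rightarrow> 'v) B"
    using B S finite_subset by unfold_locales (auto simp: dependent_raw_def span_raw_def)
  then interpret V: finite_dimensional_vector_space "(*\<^sub>R) :: real \<Rightarrow> 'v \<Rightarrow> 'v" B .
  have inj: "inj T"
    using pos by (subst linear_injective_0[OF \<open>linear T\<close>]) (metis inner_zero_left less_irrefl)
  then have "surj T"
    using V.linear_inj_imp_surj[of T] \<open>linear T\<close> unfolding linear_def by blast
  obtain U where U: "linear U" "T \<circ> U = id"
    using linear_surjective_right_inverse[OF \<open>linear T\<close> \<open>surj T\<close>] by blast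
  obtain K where K: "K > 0" "\<And>x. norm (U x) \<le> K * norm x"
    using linear_bound_finite_span[OF S U(1)] by metis
  obtain C where C: "\<And>x. norm (T x) \<le> C * norm x"
    using linear_bound_finite_span[OF S \<open>linear T\<close>] by metis
  have nn: "inner (T x) x \<ge> 0" for x using pos[of x] by (cases "x = 0") auto
  have lower: "1 / K * inner x x \<le> inner (T x) x" for x
  proof -
    define u where "u = U x"
    have Tu: "T u = x" using U(2) unfolding u_def by (metis comp_apply id_apply)
    \<comment> \<open>With \<open>T u = x\<close>, nonnegativity of the form at
      \<open>u - K x\<close> plays the role of a Cauchy-Schwarz inequality for the form of
      \<open>T\<close>.\<close>
    have "inner (T (u - K *\<^sub>R x)) (u - K *\<^sub>R x)
        = inner x u - 2 * K * inner x x + K * K * inner (T x) x"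
      using sym[of x u] by (simp add: linear_diff[OF \<open>linear T\<close>] linear_scale[OF \<open>linear T\<close>] Tu
          inner_diff_left inner_diff_right algebra_simps)
    moreover have "inner x u \<le> K * inner x x"
    proof -
      have "inner x u \<le> norm x * norm u" by (rule norm_cauchy_schwarz)
      also have "\<dots> \<le> norm x * (K * norm x)" using K(2)[of x] by (simp add: u_def mult_left_mono)
      finally show ?thesis by (simp add: dot_square_norm power2_eq_square ac_simps)
    qed
    ultimately have "K * inner x x \<le> K * (K * inner (T x) x)"
      using nn[of "u - K *\<^sub>R x"] by (simp add: ac_simps)
    then show ?thesis using K(1) by (simp add: field_simps)
  qed
  have upper: "inner (T x) x \<le> C * inner x x" for x
  proof -
    have "inner (T x) x \<le> norm (T x) * norm x" by (rule norm_cauchy_schwarz)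
    also have "\<dots> \<le> C * norm x * norm x" using C by (intro mult_right_mono) auto
    finally show ?thesis by (simp add: dot_square_norm power2_eq_square ac_simps)
  qed
  show ?thesis using that[OF _ lower upper] K(1) by simp
qed

subsection \<open>Square-summable sequences\<close>

text \<open>The ambient space without the support condition of \<open>side\<close>, since shifts
  move the support.\<close>

definition l2 :: "(int \<Rightarrow> 'h::real_inner) set" where
  "l2 = {f. (\<lambda>k. (norm (f k))\<^sup>2) summable_on UNIV}"

text \<open>Stated for any bounded bilinear map, so as to serve both \<open>inner\<close> and the
  scalar-valued \<open>ip H\<close>. The products are dominated by a multiple of the sum of the
  squared norms.\<close>

lemma summable_on_bounded_bilinear:
  fixes B :: "'h::real_inner \<Rightarrow> 'h \<Rightarrow> 'c::banach"
  assumes B: "bounded_bilinear B" and f: "f \<in> l2" and g: "g \<in> l2"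
  shows "(\<lambda>k. B (f k) (g k)) summable_on UNIV"
proof -
  obtain K where K: "K > 0" "\<And>x y. norm (B x y) \<le> norm x * norm y * K"
    using bounded_bilinear.pos_bounded[OF B] by blast
  have sum: "(\<lambda>k. K * ((norm (f k))\<^sup>2 + (norm (g k))\<^sup>2)) summable_on UNIV"
    using f g by (intro summable_on_cmult_right summable_on_add) (auto simp: l2_def)
  have le: "norm (B (f k) (g k)) \<le> K * ((norm (f k))\<^sup>2 + (norm (g k))\<^sup>2)" for k
  proof -
    have "norm (f k) * norm (g k) \<le> (norm (f k))\<^sup>2 + (norm (g k))\<^sup>2"
      using sum_squares_bound[of "norm (f k)" "norm (g k)"] mult_nonneg_nonneg[of "norm (f k)" "norm (g k)"]
      by (simp del: mult_nonneg_nonneg)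
    then have "K * (norm (f k) * norm (g k)) \<le> K * ((norm (f k))\<^sup>2 + (norm (g k))\<^sup>2)"
      using K(1) by simp
    with K(2)[of "f k" "g k"] show ?thesis by (simp add: ac_simps)
  qed
  show ?thesis
    by (rule abs_summable_summable, rule Infinite_Sum.abs_summable_on_comparison_test'[OF sum le])
qed

lemma l2_zero: "0 \<in> l2"
  by (simp add: l2_def)

lemma l2_add: "f + g \<in> l2" if "f \<in> l2" "g \<in> l2"
proof -
  have sum: "(\<lambda>k. 2 * (norm (f k))\<^sup>2 + 2 * (norm (g k))\<^sup>2) summable_on UNIV"
    using that by (intro summable_on_add summable_on_cmult_right) (auto simp: l2_def)
  have le: "norm ((norm ((f + g) k))\<^sup>2) \<le> 2 * (norm (f k))\<^sup>2 + 2 * (norm (g k))\<^sup>2" for k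
  proof -
    \<comment> \<open>Parallelogram law; dropping the second square gives the majorant.\<close>
    have "(norm (f k + g k))\<^sup>2 + (norm (f k - g k))\<^sup>2 = 2 * (norm (f k))\<^sup>2 + 2 * (norm (g k))\<^sup>2"
      by (simp add: power2_norm_eq_inner inner_add_left inner_add_right inner_diff_left
          inner_diff_right inner_commute)
    then show ?thesis by (smt (verit) norm_power plus_fun_apply real_norm_def abs_norm_cancel zero_le_power2)
  qed
  have "(\<lambda>k. norm ((norm ((f + g) k))\<^sup>2)) summable_on UNIV"
    by (rule Infinite_Sum.abs_summable_on_comparison_test'[OF sum le])
  then show ?thesis by (simp add: l2_def)
qed

definition scale_seq :: "real \<Rightarrow> (int \<Rightarrow> 'h) \<Rightarrow> int \<Rightarrow> 'h::real_inner" where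
  "scale_seq r f = (\<lambda>k. r *\<^sub>R f k)"

lemma l2_scale: "f \<in> l2 \<Longrightarrow> scale_seq r f \<in> l2"
  by (simp add: l2_def scale_seq_def power_mult_distrib summable_on_cmult_right)

lemma l2_diff: "f - g \<in> l2" if "f \<in> l2" "g \<in> l2"
proof -
  have "f - g = f + scale_seq (- 1) g" by (auto simp: scale_seq_def fun_eq_iff)
  then show ?thesis using l2_add[OF that(1) l2_scale[OF that(2)]] by metis
qed

definition shift :: "int \<Rightarrow> (int \<Rightarrow> 'h) \<Rightarrow> int \<Rightarrow> 'h::real_inner" where
  "shift s f = (\<lambda>k. f (k + s))"

lemma bij_add_int: "bij (\<lambda>k::int. k + s)"
  by (rule bij_betwI[where g = "\<lambda>k. k - s"]) auto

lemma l2_shift: "shift s f \<in> l2 \<longleftrightarrow> f \<in> l2"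
  using summable_on_reindex_bij_betw[OF bij_add_int, of "\<lambda>k. (norm (f k))\<^sup>2" s]
  by (simp add: l2_def shift_def)

definition bsum :: "('h \<Rightarrow> 'h \<Rightarrow> 'c) \<Rightarrow> (int \<Rightarrow> 'h) \<Rightarrow> (int \<Rightarrow> 'h) \<Rightarrow> 'c::banach" where
  "bsum B f g = (\<Sum>\<^sub>\<infinity>k. B (f k) (g k))"

lemma sip_eq_bsum: "sip H = bsum (ip H)"
  by (simp add: sip_def bsum_def fun_eq_iff)

lemma bsum_shift: "bsum B (shift s f) (shift s g) = bsum B f g"
  using infsum_reindex_bij_betw[OF bij_add_int, of "\<lambda>k. B (f k) (g k)" s]
  by (simp add: bsum_def shift_def)

context
  fixes B :: "'h::real_inner \<Rightarrow> 'h \<Rightarrow> 'c::banach"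
  assumes B: "bounded_bilinear B"
begin

lemma bsum_add_left:
  "f \<in> l2 \<Longrightarrow> f' \<in> l2 \<Longrightarrow> g \<in> l2 \<Longrightarrow> bsum B (f + f') g = bsum B f g + bsum B f' g"
  by (simp add: bsum_def bounded_bilinear.add_left[OF B] infsum_add summable_on_bounded_bilinear[OF B])

lemma bsum_add_right:
  "f \<in> l2 \<Longrightarrow> g \<in> l2 \<Longrightarrow> g' \<in> l2 \<Longrightarrow> bsum B f (g + g') = bsum B f g + bsum B f g'"
  by (simp add: bsum_def bounded_bilinear.add_right[OF B] infsum_add summable_on_bounded_bilinear[OF B])

lemma bsum_scale_left: "f \<in> l2 \<Longrightarrow> g \<in> l2 \<Longrightarrow> bsum B (scale_seq r f) g = r *\<^sub>R bsum B f g"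
  unfolding bsum_def scale_seq_def bounded_bilinear.scaleR_left[OF B]
  by (intro infsumI has_sum_bounded_linear[OF bounded_linear_scaleR_right] has_sum_infsum
      summable_on_bounded_bilinear[OF B])

lemma bsum_scale_right: "f \<in> l2 \<Longrightarrow> g \<in> l2 \<Longrightarrow> bsum B f (scale_seq r g) = r *\<^sub>R bsum B f g"
  unfolding bsum_def scale_seq_def bounded_bilinear.scaleR_right[OF B]
  by (intro infsumI has_sum_bounded_linear[OF bounded_linear_scaleR_right] has_sum_infsum
      summable_on_bounded_bilinear[OF B])

lemma bsum_disjoint: "(\<And>k. f k = 0 \<or> g k = 0) \<Longrightarrow> bsum B f g = 0"
  unfolding bsum_def
  by (rule infsum_0) (metis bounded_bilinear.zero_left[OF B] bounded_bilinear.zero_right[OF B])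

lemma bsum_0: "bsum B 0 g = 0" "bsum B f 0 = 0"
  by (rule bsum_disjoint, simp)+

end

section \<open>The real inner product of sequences and the Cauchy-Schwarz inequality\<close>

abbreviation rip :: "(int \<Rightarrow> 'h::real_inner) \<Rightarrow> (int \<Rightarrow> 'h) \<Rightarrow> real" where
  "rip \<equiv> bsum inner"

lemma rip_commute: "rip f g = rip g f"
  by (simp add: bsum_def inner_commute)

lemma rip_self: "rip f f = (\<Sum>\<^sub>\<infinity>k. (norm (f k))\<^sup>2)"
  by (simp add: bsum_def dot_square_norm)

lemma rip_nonneg: "0 \<le> rip f f"
  unfolding rip_self by (rule infsum_nonneg) simp

lemma norm_sum_le_rip: "f \<in> l2 \<Longrightarrow> finite F \<Longrightarrow> (\<Sum>k\<in>F. (norm (f k))\<^sup>2) \<le> rip f f"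
  unfolding rip_self by (rule finite_sum_le_infsum) (auto simp: l2_def)

lemma norm_le_rip: "f \<in> l2 \<Longrightarrow> (norm (f k))\<^sup>2 \<le> rip f f"
  using norm_sum_le_rip[of f "{k}"] by simp

lemma rip_pos: "f \<in> l2 \<Longrightarrow> f \<noteq> 0 \<Longrightarrow> 0 < rip f f"
proof -
  assume f: "f \<in> l2" "f \<noteq> 0"
  then obtain k where "f k \<noteq> 0" by (auto simp: fun_eq_iff)
  then have "0 < (norm (f k))\<^sup>2" by simp
  also have "\<dots> \<le> rip f f" by (rule norm_le_rip[OF f(1)])
  finally show ?thesis .
qed

lemmas rip_add_left = bsum_add_left[OF bounded_bilinear_inner]
lemmas rip_scale_left = bsum_scale_left[OF bounded_bilinear_inner]
lemmas rip_scale_right = bsum_scale_right[OF bounded_bilinear_inner]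

lemma (in fd_hilbert) rc_re_sip: "f \<in> l2 \<Longrightarrow> g \<in> l2 \<Longrightarrow> rc_re (sip H f g) = rip f g"
  unfolding sip_eq_bsum bsum_def re_ip[symmetric]
  by (intro infsumI[symmetric] has_sum_bounded_linear[OF bounded_linear_rc_re] has_sum_infsum
      summable_on_bounded_bilinear[OF bounded_bilinear_ip])

lemma rip_diff_left: "rip (f - g) h = rip f h - rip g h" if "f \<in> l2" "g \<in> l2" "h \<in> l2"
  using rip_add_left[of "f - g" g h] that by (simp add: l2_diff)

lemma rip_Cauchy_Schwarz: "(rip f g)\<^sup>2 \<le> rip f f * rip g g" if "f \<in> l2" "g \<in> l2"
proof (cases "g = 0")
  case True
  then show ?thesis by (simp add: bsum_0[OF bounded_bilinear_inner])
next
  case False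
  let ?a = "rip f f" and ?b = "rip f g" and ?c = "rip g g"
  \<comment> \<open>\<open>?u - ?v\<close> is the component of \<open>f\<close> orthogonal to
    \<open>g\<close>, multiplied by \<open>?c\<close> to avoid a division.\<close>
  let ?u = "scale_seq ?c f" and ?v = "scale_seq ?b g"
  have uv: "?u \<in> l2" "?v \<in> l2" using that by (simp_all add: l2_scale)
  have "0 \<le> rip (?u - ?v) (?u - ?v)" by (rule rip_nonneg)
  also have "\<dots> = rip (?u - ?v) ?u - rip (?u - ?v) ?v"
    unfolding rip_diff_left[OF uv l2_diff[OF uv]] by (simp only: rip_commute)
  also have "\<dots> = (rip ?u ?u - rip ?v ?u) - (rip ?u ?v - rip ?v ?v)"
    unfolding rip_diff_left[OF uv uv(1)] rip_diff_left[OF uv uv(2)] ..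
  also have "\<dots> = ?c * (?a * ?c - ?b\<^sup>2)"
    using that by (simp add: rip_scale_left rip_scale_right l2_scale rip_commute[of g f]
        power2_eq_square algebra_simps)
  finally show ?thesis using rip_pos[OF that(2) False] by (simp add: zero_le_mult_iff)
qed

lemma side_def': "side a = {f \<in> l2. \<forall>k. k \<notin> idx a \<longrightarrow> f k = 0}"
  by (auto simp: side_def l2_def)

lemma side_l2: "f \<in> side a \<Longrightarrow> f \<in> l2"
  by (simp add: side_def')

lemma side_zero: "0 \<in> side a"
  by (simp add: side_def' l2_zero)

lemma side_diff: "f \<in> side a \<Longrightarrow> g \<in> side a \<Longrightarrow> f - g \<in> side a"
  by (simp add: side_def' l2_diff)

lemma side_add: "f \<in> side a \<Longrightarrow> g \<in> side a \<Longrightarrow> f + g \<in> side a"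
  by (simp add: side_def' l2_add)

lemma side_scale: "f \<in> side a \<Longrightarrow> scale_seq r f \<in> side a"
  by (simp add: side_def' l2_scale) (simp add: scale_seq_def)

subsection \<open>Symmetric coercive operators\<close>

text \<open>Common frame for a single side with \<open>rip\<close> and for boundary data with
  \<open>rbip\<close>. Working on a carrier set rather than a type allows sides of every extent in
  one type of sequences.\<close>

locale form_space =
  fixes S :: "'x::ab_group_add set" and form :: "'x \<Rightarrow> 'x \<Rightarrow> real"
  assumes zero_mem: "0 \<in> S"
    and diff_mem: "x \<in> S \<Longrightarrow> y \<in> S \<Longrightarrow> x - y \<in> S"
    and form_commute: "x \<in> S \<Longrightarrow> y \<in> S \<Longrightarrow> form x y = form y x"
    and form_diff_left: "x \<in> S \<Longrightarrow> y \<in> S \<Longrightarrow> z \<in> S \<Longrightarrow> form (x - y) z = form x z - form y z"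
    and form_pos: "x \<in> S \<Longrightarrow> x \<noteq> 0 \<Longrightarrow> 0 < form x x"
begin

lemma minus_mem: "x \<in> S \<Longrightarrow> - x \<in> S"
  using diff_mem[of 0 x] zero_mem by simp

lemma add_mem: "x \<in> S \<Longrightarrow> y \<in> S \<Longrightarrow> x + y \<in> S"
  using diff_mem[of x "- y"] minus_mem by simp

lemma form_zero_left: "z \<in> S \<Longrightarrow> form 0 z = 0"
  using form_diff_left[of 0 0 z] zero_mem by simp

lemma form_diff_right: "x \<in> S \<Longrightarrow> y \<in> S \<Longrightarrow> z \<in> S \<Longrightarrow> form z (x - y) = form z x - form z y"
  using form_diff_left[of x y z] by (simp add: form_commute diff_mem)

lemma form_add_left: "x \<in> S \<Longrightarrow> y \<in> S \<Longrightarrow> z \<in> S \<Longrightarrow> form (x + y) z = form x z + form y z"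
  using form_diff_left[of "x + y" y z] by (simp add: add_mem)

lemma form_add_right: "x \<in> S \<Longrightarrow> y \<in> S \<Longrightarrow> z \<in> S \<Longrightarrow> form z (x + y) = form z x + form z y"
  using form_add_left[of x y z] by (simp add: form_commute add_mem)

lemma form_nonneg: "x \<in> S \<Longrightarrow> 0 \<le> form x x"
  using form_pos[of x] by (cases "x = 0") (auto simp: form_zero_left zero_mem)

lemma form_eqI:
  assumes "x \<in> S" "y \<in> S" and eq: "\<And>z. z \<in> S \<Longrightarrow> form x z = form y z"
  shows "x = y"
proof (rule ccontr)
  assume "x \<noteq> y"
  then have "0 < form (x - y) (x - y)" using assms by (intro form_pos diff_mem) auto
  also have "\<dots> = 0" using assms by (simp add: form_diff_left diff_mem)
  finally show False by simp
qed

end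

text \<open>Additivity is a consequence of symmetry, because the form is definite.\<close>

definition sym_op :: "'x set \<Rightarrow> ('x \<Rightarrow> 'x \<Rightarrow> real) \<Rightarrow> ('x \<Rightarrow> 'x) \<Rightarrow> bool" where
  "sym_op S form L \<longleftrightarrow> (\<forall>x\<in>S. L x \<in> S) \<and> (\<forall>x\<in>S. \<forall>y\<in>S. form (L x) y = form x (L y))"

text \<open>Both bounds concern the form. An upper bound in this shape passes to a gluing by
  comparison with a trial value; \<open>sym_op_norm_le\<close> recovers a norm bound where the
  contraction argument needs it.\<close>

definition coercive_op :: "'x set \<Rightarrow> ('x \<Rightarrow> 'x \<Rightarrow> real) \<Rightarrow> ('x \<Rightarrow> 'x) \<Rightarrow> bool" where
  "coercive_op S form L \<longleftrightarrow> sym_op S form L \<and>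
     (\<exists>c>0. \<exists>C. \<forall>x\<in>S. c * form x x \<le> form (L x) x \<and> form (L x) x \<le> C * form x x)"

context form_space
begin

lemma sym_op_diff:
  assumes "sym_op S form L" "x \<in> S" "y \<in> S"
  shows "L (x - y) = L x - L y"
proof (rule form_eqI)
  have Lm: "L u \<in> S" if "u \<in> S" for u using assms(1) that by (simp add: sym_op_def)
  then show "L (x - y) \<in> S" "L x - L y \<in> S" using assms(2,3) by (simp_all add: diff_mem)
  fix z assume z: "z \<in> S"
  have sym: "form (L u) z = form u (L z)" if "u \<in> S" for u
    using assms(1) that z by (simp add: sym_op_def)
  show "form (L (x - y)) z = form (L x - L y) z"
    using assms(2,3) z Lm by (simp only: sym diff_mem form_diff_left)
qed

lemma sym_op_zero: "sym_op S form L \<Longrightarrow> L 0 = 0"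
  using sym_op_diff[of L 0 0] zero_mem by simp

lemma sym_op_add:
  assumes "sym_op S form L" "x \<in> S" "y \<in> S"
  shows "L (x + y) = L x + L y"
  using sym_op_diff[OF assms(1), of "x + y" y] assms by (simp add: add_mem)

lemma coercive_op_kernel:
  assumes "coercive_op S form L" "x \<in> S" "form (L x) x \<le> 0"
  shows "x = 0"
proof (rule ccontr)
  assume "x \<noteq> 0"
  with assms(2) have "0 < form x x" by (rule form_pos)
  moreover obtain c where "c > 0" "c * form x x \<le> form (L x) x"
    using assms(1,2) by (auto simp: coercive_op_def)
  ultimately have "0 < form (L x) x" by (meson mult_pos_pos less_le_trans)
  with assms(3) show False by simp
qed

lemma coercive_op_inj_on:
  assumes "coercive_op S form L"
  shows "inj_on L S"
proof (rule inj_onI)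
  fix x y assume xy: "x \<in> S" "y \<in> S" "L x = L y"
  have s: "sym_op S form L" using assms by (simp add: coercive_op_def)
  have "form (L (x - y)) (x - y) = 0"
    using sym_op_diff[OF s xy(1,2)] xy by (simp add: form_zero_left diff_mem)
  then show "x = y" using coercive_op_kernel[OF assms, of "x - y"] xy by (simp add: diff_mem)
qed

end

interpretation side: form_space "side a" rip
proof
  show "rip x y = rip y x" for x y :: "int \<Rightarrow> 'a" by (rule rip_commute)
qed (auto simp: side_zero side_diff intro: rip_diff_left rip_pos side_l2)

section \<open>Completeness of a side\<close>

lemma Metric_space_side: "Metric_space (side a) (\<lambda>f g. sqrt (rip (f - g) (f - g)))"
proof
  fix x y z :: "int \<Rightarrow> 'a"
  show "0 \<le> sqrt (rip (x - y) (x - y))" by (simp add: rip_nonneg)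
  show "sqrt (rip (x - y) (x - y)) = sqrt (rip (y - x) (y - x))"
    by (simp add: rip_self norm_minus_commute)
  assume xy: "x \<in> side a" "y \<in> side a"
  show "sqrt (rip (x - y) (x - y)) = 0 \<longleftrightarrow> x = y"
    using side.form_pos[of "x - y" a] side_diff[OF xy]
    by (cases "x = y") (auto simp: bsum_0[OF bounded_bilinear_inner])
  assume z: "z \<in> side a"
  let ?f = "x - y" and ?g = "y - z"
  have fg: "?f \<in> side a" "?g \<in> side a" using xy z by (simp_all add: side_diff)
  have "rip ?f ?g \<le> sqrt (rip ?f ?f) * sqrt (rip ?g ?g)"
    unfolding real_sqrt_mult[symmetric]
    by (rule real_le_rsqrt) (rule rip_Cauchy_Schwarz[OF fg[THEN side_l2]])
  moreover have "rip (x - z) (x - z) = rip ?f ?f + 2 * rip ?f ?g + rip ?g ?g"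
  proof -
    have "x - z = ?f + ?g" by simp
    then show ?thesis
      using fg side.form_add_left[OF fg] side.form_add_right[OF fg] side_add[OF fg]
        rip_commute[of ?g ?f] by simp
  qed
  ultimately have "rip (x - z) (x - z) \<le> (sqrt (rip ?f ?f) + sqrt (rip ?g ?g))\<^sup>2"
    by (simp add: power2_sum rip_nonneg)
  then show "sqrt (rip (x - z) (x - z)) \<le> sqrt (rip ?f ?f) + sqrt (rip ?g ?g)"
    by (intro real_le_lsqrt add_nonneg_nonneg) (simp_all add: rip_nonneg)
qed

text \<open>The pointwise limit exists since the fibre is complete. Every finite partial sum of the
  squared distance passes to the limit with a bound independent of the finite set, which gives
  summability and convergence together.\<close>

lemma side_complete:
  assumes "complete (UNIV :: 'h::real_inner set)"
  shows "Metric_space.mcomplete (side a :: (int \<Rightarrow> 'h) set) (\<lambda>f g. sqrt (rip (f - g) (f - g)))"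
proof -
  interpret Metric_space "side a :: (int \<Rightarrow> 'h) set" "\<lambda>f g. sqrt (rip (f - g) (f - g))"
    by (rule Metric_space_side)
  show ?thesis
    unfolding mcomplete_def
  proof (intro allI impI)
    fix \<sigma> :: "nat \<Rightarrow> int \<Rightarrow> 'h"
    assume \<sigma>: "MCauchy \<sigma>"
    then have mem: "\<sigma> n \<in> side a" for n by (auto simp: MCauchy_def)
    have Cauchy: "\<exists>N. \<forall>n\<ge>N. \<forall>m\<ge>N. rip (\<sigma> n - \<sigma> m) (\<sigma> n - \<sigma> m) < e\<^sup>2" if "e > 0" for e
    proof -
      have less: "r < e\<^sup>2" if "sqrt r < e" for r
        using real_sqrt_less_iff[of r "e\<^sup>2"] that \<open>e > 0\<close> by simp
      have "\<exists>N. \<forall>n m. N \<le> n \<longrightarrow> N \<le> m \<longrightarrow> sqrt (rip (\<sigma> n - \<sigma> m) (\<sigma> n - \<sigma> m)) < e"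
        using \<sigma>[unfolded MCauchy_def, THEN conjunct2, THEN spec, THEN mp, OF that] .
      then obtain N where "\<forall>n m. N \<le> n \<longrightarrow> N \<le> m \<longrightarrow> sqrt (rip (\<sigma> n - \<sigma> m) (\<sigma> n - \<sigma> m)) < e"
        by (rule exE)
      then show ?thesis by (intro exI[of _ N] allI impI less) simp
    qed
    have "Cauchy (\<lambda>n. \<sigma> n k)" for k
    proof (rule metric_CauchyI)
      fix e :: real assume e: "e > 0"
      then obtain N where N: "\<And>n m. n \<ge> N \<Longrightarrow> m \<ge> N \<Longrightarrow> rip (\<sigma> n - \<sigma> m) (\<sigma> n - \<sigma> m) < e\<^sup>2"
        using Cauchy[OF e] by blast
      have "dist (\<sigma> m k) (\<sigma> n k) < e" if "m \<ge> N" "n \<ge> N" for m n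
      proof -
        have "(norm ((\<sigma> m - \<sigma> n) k))\<^sup>2 < e\<^sup>2"
          using norm_le_rip[OF side_l2[OF side_diff[OF mem mem]], of m n k] N[OF that] by simp
        then show ?thesis using e by (simp add: dist_norm power2_less_imp_less)
      qed
      then show "\<exists>M. \<forall>m\<ge>M. \<forall>n\<ge>M. dist (\<sigma> m k) (\<sigma> n k) < e" by blast
    qed
    then have "\<exists>l. (\<lambda>n. \<sigma> n k) \<longlonglongrightarrow> l" for k
      using assms unfolding complete_def by auto
    then obtain l where l: "\<And>k. (\<lambda>n. \<sigma> n k) \<longlonglongrightarrow> l k" by metis
    have close: "\<exists>N. \<forall>n\<ge>N. \<sigma> n - l \<in> l2 \<and> rip (\<sigma> n - l) (\<sigma> n - l) \<le> e\<^sup>2" if e: "e > 0" for e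
    proof -
      obtain N where N: "\<And>n m. n \<ge> N \<Longrightarrow> m \<ge> N \<Longrightarrow> rip (\<sigma> n - \<sigma> m) (\<sigma> n - \<sigma> m) < e\<^sup>2"
        using Cauchy[OF e] by blast
      have "\<sigma> n - l \<in> l2 \<and> rip (\<sigma> n - l) (\<sigma> n - l) \<le> e\<^sup>2" if n: "n \<ge> N" for n
      proof -
        \<comment> \<open>Finite partial sums, because \<open>\<sigma> n - l\<close> is not yet
          known to be square-summable.\<close>
        have le: "(\<Sum>k\<in>F. (norm ((\<sigma> n - l) k))\<^sup>2) \<le> e\<^sup>2" if "finite F" for F
        proof (rule tendsto_upperbound)
          show "(\<lambda>m. \<Sum>k\<in>F. (norm ((\<sigma> n - \<sigma> m) k))\<^sup>2) \<longlonglongrightarrow> (\<Sum>k\<in>F. (norm ((\<sigma> n - l) k))\<^sup>2)"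
            unfolding minus_apply by (intro tendsto_intros l)
          show "\<forall>\<^sub>F m in sequentially. (\<Sum>k\<in>F. (norm ((\<sigma> n - \<sigma> m) k))\<^sup>2) \<le> e\<^sup>2"
            using norm_sum_le_rip[OF side_l2[OF side_diff[OF mem mem]] that] N[OF n]
            by (intro eventually_sequentiallyI[of N]) (meson less_imp_le order_trans)
        qed simp
        have "\<sigma> n - l \<in> l2"
          unfolding l2_def mem_Collect_eq
          by (rule nonneg_bdd_above_summable_on) (auto intro!: bdd_aboveI[where M = "e\<^sup>2"] le[unfolded minus_apply])
        moreover from this have "rip (\<sigma> n - l) (\<sigma> n - l) \<le> e\<^sup>2"
          unfolding rip_self l2_def mem_Collect_eq by (rule infsum_le_finite_sums) (rule le)
        ultimately show ?thesis ..
      qed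
      then show ?thesis by blast
    qed
    obtain n where "\<sigma> n - l \<in> l2" using close[of 1] by auto
    then have "l \<in> l2" using l2_diff[OF side_l2[OF mem[of n]], of "\<sigma> n - l"] by simp
    moreover have "l k = 0" if "k \<notin> idx a" for k
    proof -
      have "\<sigma> n k = 0" for n using mem[of n] that by (simp add: side_def')
      then show ?thesis using LIMSEQ_unique[OF l[of k], of 0] by simp
    qed
    ultimately have lm: "l \<in> side a" by (simp add: side_def')
    have lim: "\<exists>N. \<forall>n\<ge>N. sqrt (rip (\<sigma> n - l) (\<sigma> n - l)) < e" if e: "e > 0" for e
    proof -
      obtain N where N: "\<And>n. n \<ge> N \<Longrightarrow> rip (\<sigma> n - l) (\<sigma> n - l) \<le> (e/2)\<^sup>2"
        using close[of "e/2"] half_gt_zero[OF e] by blast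
      have "sqrt (rip (\<sigma> n - l) (\<sigma> n - l)) < e" if "n \<ge> N" for n
      proof -
        have "sqrt (rip (\<sigma> n - l) (\<sigma> n - l)) \<le> e/2"
          using N[OF that] \<open>e > 0\<close> by (intro real_le_lsqrt) (auto simp: rip_nonneg)
        then show ?thesis using \<open>e > 0\<close> by simp
      qed
      then show ?thesis by blast
    qed
    have "limitin mtopology \<sigma> l sequentially"
      unfolding limit_metric_sequentially
    proof (intro conjI allI impI lm)
      fix e :: real assume "e > 0"
      from lim[OF this] show "\<exists>N. \<forall>n\<ge>N. \<sigma> n \<in> side a \<and> sqrt (rip (\<sigma> n - l) (\<sigma> n - l)) < e"
        using mem by simp
    qed
    then show "\<exists>x. limitin mtopology \<sigma> x sequentially" by blast
  qed
qed

section \<open>Lax-Milgram on a side\<close>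

lemma sym_op_scale:
  assumes "sym_op (side a) rip L" "x \<in> side a"
  shows "L (scale_seq r x) = scale_seq r (L x)"
proof (rule side.form_eqI[of _ a])
  have Lm: "L y \<in> side a" if "y \<in> side a" for y using assms(1) that by (simp add: sym_op_def)
  then show "L (scale_seq r x) \<in> side a" "scale_seq r (L x) \<in> side a"
    using assms(2) by (simp_all add: side_scale)
  fix z :: "int \<Rightarrow> 'a" assume z: "z \<in> side a"
  have sym: "rip (L u) z = rip u (L z)" if "u \<in> side a" for u
    using assms(1) that z by (simp add: sym_op_def)
  show "rip (L (scale_seq r x)) z = rip (scale_seq r (L x)) z"
    using assms(2) z Lm
    by (simp only: sym side_scale rip_scale_left side_l2[of _ a])
qed

text \<open>A form bound becomes a norm bound by evaluating the nonnegative form of \<open>T\<close>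
  at \<open>r x - T x\<close> and estimating \<open>rip (T x) x\<close> and
  \<open>rip (T (T x)) (T x)\<close> by \<open>bounds\<close>.\<close>

lemma sym_op_norm_le:
  assumes T: "sym_op (side a) rip T" and r: "r > 0"
    and bounds: "\<And>x. x \<in> side a \<Longrightarrow> 0 \<le> rip (T x) x \<and> rip (T x) x \<le> r * rip x x"
    and x: "x \<in> side a"
  shows "rip (T x) (T x) \<le> r\<^sup>2 * rip x x"
proof -
  have Tm: "y \<in> side a \<Longrightarrow> T y \<in> side a" for y using T by (simp add: sym_op_def)
  let ?y = "scale_seq r x"
  have y: "?y \<in> side a" using x by (rule side_scale)
  have "0 \<le> rip (T (?y - T x)) (?y - T x)" using bounds x y Tm by (simp add: side_diff)
  also have "\<dots> = rip (T ?y) ?y - rip (T ?y) (T x) - rip (T (T x)) ?y + rip (T (T x)) (T x)"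
    using x y Tm by (simp add: side.sym_op_diff[OF T] side.form_diff_left[of _ a]
        side.form_diff_right[of _ a] side_diff)
  also have "rip (T (T x)) ?y = rip (T x) (T ?y)" using T x y Tm by (simp add: sym_op_def)
  also have "rip (T ?y) ?y - rip (T ?y) (T x) - rip (T x) (T ?y) = r\<^sup>2 * rip (T x) x - 2 * r * rip (T x) (T x)"
    using x Tm by (simp add: sym_op_scale[OF T] rip_scale_left rip_scale_right side_l2[of _ a] l2_scale
        power2_eq_square)
  also have "\<dots> + rip (T (T x)) (T x) \<le> r\<^sup>2 * (r * rip x x) - 2 * r * rip (T x) (T x) + r * rip (T x) (T x)"
    using bounds[OF x] bounds[OF Tm[OF x]] r by (intro add_mono diff_mono mult_left_mono) auto
  finally have "r * rip (T x) (T x) \<le> r * (r\<^sup>2 * rip x x)" by (simp add: algebra_simps)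
  then show ?thesis using r by simp
qed

lemma coercive_op_bij:
  fixes L :: "(int \<Rightarrow> 'h::real_inner) \<Rightarrow> int \<Rightarrow> 'h"
  assumes complete: "complete (UNIV :: 'h set)" and L: "coercive_op (side a) rip L"
  shows "bij_betw L (side a) (side a)"
proof -
  have sym: "sym_op (side a) rip L" using L by (simp add: coercive_op_def)
  then have Lm: "x \<in> side a \<Longrightarrow> L x \<in> side a" for x by (simp add: sym_op_def)
  obtain c C0 where c: "c > 0" and lower: "\<And>x. x \<in> side a \<Longrightarrow> c * rip x x \<le> rip (L x) x"
    and upper: "\<And>x. x \<in> side a \<Longrightarrow> rip (L x) x \<le> C0 * rip x x"
    using L unfolding coercive_op_def by blast
  \<comment> \<open>Enlarged so that the form of \<open>1 - L / C\<close> lies between 0 and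
    \<open>1 - c / C\<close>, and so that \<open>C > c\<close> makes the latter number positive;
    \<open>C0\<close> may have any sign.\<close>
  define C where "C = \<bar>C0\<bar> + 2 * c"
  have C: "C > c" using c by (simp add: C_def)
  have upper': "rip (L x) x \<le> C * rip x x" if "x \<in> side a" for x
  proof -
    have "C0 * rip x x \<le> C * rip x x"
      using c by (intro mult_right_mono rip_nonneg) (simp add: C_def)
    with upper[OF that] show ?thesis by simp
  qed
  define T where "T = (\<lambda>x. x - scale_seq (1/C) (L x))"
  define r where "r = 1 - c / C"
  have r: "0 < r" "r < 1" using c C by (simp_all add: r_def)
  have Tm: "x \<in> side a \<Longrightarrow> T x \<in> side a" for x by (simp add: T_def side_diff side_scale Lm)
  have Tip: "rip (T x) y = rip x y - rip (L x) y / C" if "x \<in> side a" "y \<in> side a" for x y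
    using that by (simp add: T_def side.form_diff_left[of _ a] side_scale Lm rip_scale_left side_l2[of _ a])
  have T: "sym_op (side a) rip T"
    unfolding sym_op_def
  proof (intro conjI ballI)
    fix x y :: "int \<Rightarrow> 'h" assume xy: "x \<in> side a" "y \<in> side a"
    have "rip (L x) y = rip (L y) x" using sym xy by (simp add: sym_op_def rip_commute)
    then show "rip (T x) y = rip x (T y)"
      unfolding rip_commute[of x "T y"] Tip[OF xy] Tip[OF xy(2,1)] by (simp add: rip_commute)
  qed (rule Tm)
  have bounds: "0 \<le> rip (T x) x \<and> rip (T x) x \<le> r * rip x x" if "x \<in> side a" for x
  proof -
    have "rip (L x) x / C \<le> rip x x"
      using upper'[OF that] c C by (simp add: pos_divide_le_eq mult.commute)
    moreover have "c * rip x x / C \<le> rip (L x) x / C"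
      using lower[OF that] c C by (intro divide_right_mono) auto
    ultimately show ?thesis by (simp add: Tip[OF that that] r_def left_diff_distrib)
  qed
  interpret Metric_space "side a :: (int \<Rightarrow> 'h) set" "\<lambda>f g. sqrt (rip (f - g) (f - g))"
    by (rule Metric_space_side)
  have surj: "\<exists>x\<in>side a. L x = y" if y: "y \<in> side a" for y
  proof -
    \<comment> \<open>A fixed point of \<open>f\<close> solves \<open>L x = y\<close>, since
      \<open>f x - x\<close> is \<open>y - L x\<close> divided by \<open>C\<close>.\<close>
    define f where "f = (\<lambda>x. T x + scale_seq (1/C) y)"
    have fm: "f \<in> side a \<rightarrow> side a" using y by (auto simp: f_def intro!: side_add side_scale Tm)
    have contr: "sqrt (rip (f u - f v) (f u - f v)) \<le> r * sqrt (rip (u - v) (u - v))"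
      if "u \<in> side a" "v \<in> side a" for u v
    proof -
      have "f u - f v = T (u - v)" using that by (simp add: f_def side.sym_op_diff[OF T])
      then have "rip (f u - f v) (f u - f v) \<le> r\<^sup>2 * rip (u - v) (u - v)"
        using sym_op_norm_le[OF T r(1) bounds] that by (simp add: side_diff)
      then have "sqrt (rip (f u - f v) (f u - f v)) \<le> sqrt (r\<^sup>2 * rip (u - v) (u - v))" by simp
      then show ?thesis using r by (simp add: real_sqrt_mult)
    qed
    obtain x where x: "x \<in> side a" "f x = x"
      using Banach_fixedpoint_thm[OF side_complete[OF complete] _ fm r(2) contr] side_zero by blast
    then have "scale_seq (1/C) (L x) = scale_seq (1/C) y" by (simp add: f_def T_def algebra_simps)
    then have "L x = y" using c C by (auto simp: scale_seq_def fun_eq_iff)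
    with x show ?thesis by blast
  qed
  have "L ` side a = side a" using Lm surj by blast
  then show ?thesis using side.coercive_op_inj_on[OF L] by (simp add: bij_betw_def)
qed

subsection \<open>Concatenation of sides\<close>

text \<open>\<open>cat_shift\<close> is the displacement of the first piece to the left and
  \<open>cat_cut\<close> its last position after concatenation. With these two numbers both clauses
  of \<open>cat\<close> become a sum of two shifted sequences.\<close>

fun cat_shift :: "extent \<Rightarrow> nat \<Rightarrow> int" where
  "cat_shift (Seg n) p = 0"
| "cat_shift Half p = int p"

fun cat_cut :: "extent \<Rightarrow> nat \<Rightarrow> int" where
  "cat_cut (Seg n) p = int n"
| "cat_cut Half p = - int p - 1"

lemma side_eq_0: "f \<in> side a \<Longrightarrow> k \<notin> idx a \<Longrightarrow> f k = 0"
  by (simp add: side_def)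

lemma idx_cat_left: "k + cat_shift a p \<in> idx a \<Longrightarrow> k \<le> cat_cut a p"
  by (cases a) auto

lemma idx_cat_right: "k - cat_cut a p \<in> idx (Seg p) \<Longrightarrow> cat_cut a p < k"
  by (cases a) auto

lemma cat_eq_shift:
  assumes "f \<in> side a" "g \<in> side (Seg p)"
  shows "cat a p (f, g) = shift (cat_shift a p) f + shift (- cat_cut a p) g"
proof
  fix k
  show "cat a p (f, g) k = (shift (cat_shift a p) f + shift (- cat_cut a p) g) k"
    using side_eq_0[OF assms(1), of "k + cat_shift a p"] side_eq_0[OF assms(2), of "k + - cat_cut a p"]
    by (cases a) (auto simp: shift_def DL_def add.assoc)
qed

lemma cat_mem:
  assumes "f \<in> side a" "g \<in> side (Seg p)"
  shows "cat a p (f, g) \<in> side (ext_plus a p)"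
proof -
  have "cat a p (f, g) \<in> l2"
    unfolding cat_eq_shift[OF assms] using assms by (simp add: l2_add l2_shift side_l2)
  moreover have "cat a p (f, g) k = 0" if "k \<notin> idx (ext_plus a p)" for k
    unfolding cat_eq_shift[OF assms]
    using that side_eq_0[OF assms(1), of "k + cat_shift a p"] side_eq_0[OF assms(2), of "k + - cat_cut a p"]
    by (cases a) (auto simp: shift_def)
  ultimately show ?thesis by (simp add: side_def')
qed

lemma cat_add:
  assumes "f \<in> side a" "f' \<in> side a" "g \<in> side (Seg p)" "g' \<in> side (Seg p)"
  shows "cat a p (f + f', g + g') = cat a p (f, g) + cat a p (f', g')"
  using assms by (simp add: cat_eq_shift side_add) (simp add: shift_def fun_eq_iff)

lemma cat_diff:
  assumes "f \<in> side a" "f' \<in> side a" "g \<in> side (Seg p)" "g' \<in> side (Seg p)"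
  shows "cat a p (f - f', g - g') = cat a p (f, g) - cat a p (f', g')"
  using assms by (simp add: cat_eq_shift side_diff) (simp add: shift_def fun_eq_iff)

lemma cat_zero: "cat a p (0, 0) = 0"
  by (simp add: cat_eq_shift side_zero) (simp add: shift_def fun_eq_iff)

text \<open>The shifted pieces have disjoint supports, and a sum over all integers is shift
  invariant. For \<open>Half\<close> this is the isometry of \<open>DL p\<close>.\<close>

lemma bsum_cat:
  fixes B :: "'h::real_inner \<Rightarrow> 'h \<Rightarrow> 'c::banach"
  assumes B: "bounded_bilinear B" and f: "f \<in> side a" "f' \<in> side a"
    and g: "g \<in> side (Seg p)" "g' \<in> side (Seg p)"
  shows "bsum B (cat a p (f, g)) (cat a p (f', g')) = bsum B f f' + bsum B g g'"
proof -
  let ?s = "shift (cat_shift a p)" and ?t = "shift (- cat_cut a p)"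
  have mem: "?s f \<in> l2" "?s f' \<in> l2" "?t g \<in> l2" "?t g' \<in> l2"
    using f g by (simp_all add: l2_shift side_l2)
  have disj: "?s u k = 0 \<or> ?t v k = 0" if "u \<in> side a" "v \<in> side (Seg p)" for u v k
    using idx_cat_left[of k a p] idx_cat_right[of k a p] side_eq_0[OF that(1), of "k + cat_shift a p"]
      side_eq_0[OF that(2), of "k - cat_cut a p"]
    unfolding shift_def by (metis not_le uminus_add_conv_diff add.commute)
  have "bsum B (?s f) (?t g') = 0" "bsum B (?t g) (?s f') = 0"
    by (rule bsum_disjoint[OF B], use disj f g in blast)+
  then show ?thesis
    using f g mem
    by (simp add: cat_eq_shift bsum_add_left[OF B] bsum_add_right[OF B] l2_add bsum_shift)
qed

lemmas rip_cat = bsum_cat[OF bounded_bilinear_inner]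

text \<open>By \<open>cat_diff\<close> and the isometry \<open>rip_cat\<close>: a pair of
  differences mapped to 0 has vanishing norm in both components.\<close>

lemma cat_inject:
  assumes f: "f \<in> side a" "f' \<in> side a" and g: "g \<in> side (Seg p)" "g' \<in> side (Seg p)"
    and eq: "cat a p (f, g) = cat a p (f', g')"
  shows "f = f' \<and> g = g'"
proof -
  have d: "f - f' \<in> side a" "g - g' \<in> side (Seg p)" using f g by (simp_all add: side_diff)
  have "cat a p (f - f', g - g') = 0" using eq by (simp add: cat_diff[OF f g])
  then have "rip (f - f') (f - f') + rip (g - g') (g - g') = 0"
    using rip_cat[OF d(1) d(1) d(2) d(2)] by (simp add: bsum_0[OF bounded_bilinear_inner])
  then have "rip (f - f') (f - f') = 0" "rip (g - g') (g - g') = 0"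
    using rip_nonneg[of "f - f'"] rip_nonneg[of "g - g'"] by auto
  then show ?thesis
    using side.form_pos[OF d(1)] side.form_pos[OF d(2)] by (metis eq_iff_diff_eq_0 less_irrefl)
qed

lemma l2_restrict: "f \<in> l2 \<Longrightarrow> (\<lambda>k. if k \<in> A then f k else 0) \<in> l2"
proof -
  assume "f \<in> l2"
  then have sum: "(\<lambda>k. (norm (f k))\<^sup>2) summable_on UNIV" by (simp add: l2_def)
  have "(\<lambda>k. norm ((norm (if k \<in> A then f k else 0))\<^sup>2)) summable_on UNIV"
    by (rule Infinite_Sum.abs_summable_on_comparison_test'[OF sum]) simp
  then show ?thesis by (simp add: l2_def)
qed

lemma cat_surj:
  assumes h: "h \<in> side (ext_plus a p)"
  obtains f g where "f \<in> side a" "g \<in> side (Seg p)" "h = cat a p (f, g)"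
proof
  let ?f = "\<lambda>k. if k \<in> idx a then shift (- cat_shift a p) h k else 0"
  let ?g = "\<lambda>k. if k \<in> idx (Seg p) then shift (cat_cut a p) h k else 0"
  have "h \<in> l2" using h by (rule side_l2)
  then show f: "?f \<in> side a" and g: "?g \<in> side (Seg p)"
    unfolding side_def' by (auto intro!: l2_restrict simp only: l2_shift mem_Collect_eq) auto
  show "h = cat a p (?f, ?g)"
  proof
    fix k
    show "h k = cat a p (?f, ?g) k"
      unfolding cat_eq_shift[OF f g] using side_eq_0[OF h, of k]
      by (cases a) (auto simp: shift_def)
  qed
qed

lemma cat_assoc:
  "cat (ext_plus a p) q (cat a p (f, g), h) = cat a (p + q) (f, cat (Seg p) q (g, h))"
  by (cases a) (auto simp: DL_def fun_eq_iff algebra_simps)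

subsection \<open>Boundary data\<close>

text \<open>Here \<open>b\<close> is the extent perpendicular to the side of extent
  \<open>a\<close>: an infinite \<open>b\<close> removes the side at its far end. Concatenation
  along \<open>a\<close> respects this, which keeps the gluing lemmas free of case
  distinctions.\<close>

definition opt_side :: "extent \<Rightarrow> extent \<Rightarrow> (int \<Rightarrow> 'h::real_inner) set" where
  "opt_side b a = (if b = Half then {0} else side a)"

lemma opt_side_Seg [simp]: "opt_side (Seg p) a = side a"
  by (simp add: opt_side_def)

lemma opt_side_ext_plus [simp]: "opt_side (ext_plus b p) a = opt_side b a"
  by (cases b) (simp_all add: opt_side_def)

lemma opt_side_side: "f \<in> opt_side b a \<Longrightarrow> f \<in> side a"
  by (auto simp: opt_side_def side_zero split: if_splits)

lemma opt_side_zero: "0 \<in> opt_side b a"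
  by (simp add: opt_side_def side_zero)

lemma opt_side_diff: "f \<in> opt_side b a \<Longrightarrow> g \<in> opt_side b a \<Longrightarrow> f - g \<in> opt_side b a"
  by (auto simp: opt_side_def side_diff)

lemma cat_opt_mem:
  "f \<in> opt_side b a \<Longrightarrow> g \<in> opt_side b (Seg p) \<Longrightarrow> cat a p (f, g) \<in> opt_side b (ext_plus a p)"
  by (auto simp: opt_side_def cat_mem cat_zero split: if_splits)

lemma cat_opt_surj:
  assumes "h \<in> opt_side b (ext_plus a p)"
  obtains f g where "f \<in> opt_side b a" "g \<in> opt_side b (Seg p)" "h = cat a p (f, g)"
  using assms by (metis cat_surj cat_zero opt_side_def singleton_iff)

lemma bspace_iff:
  "x \<in> bspace a b \<longleftrightarrow> fst x South \<in> opt_side b a \<and> fst x North \<in> side a \<and>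
     snd x West \<in> opt_side a b \<and> snd x East \<in> side b"
  by (cases x) (simp add: bspace_def opt_side_def)

lemma bspace_components:
  assumes "x \<in> bspace a b"
  shows "fst x s \<in> side a" and "snd x t \<in> side b"
proof -
  show "fst x s \<in> side a" using assms by (cases s) (auto simp: bspace_iff dest: opt_side_side)
  show "snd x t \<in> side b" using assms by (cases t) (auto simp: bspace_iff dest: opt_side_side)
qed

lemma bdry_eqI:
  assumes "fst x South = fst y South" "fst x North = fst y North"
    "snd x West = snd y West" "snd x East = snd y East"
  shows "x = y"
proof (rule prod_eqI)
  show "fst x = fst y"
  proof
    show "fst x s = fst y s" for s using assms by (cases s) simp_all
  qed
  show "snd x = snd y"
  proof
    show "snd x t = snd y t" for t using assms by (cases t) simp_all
  qed
qed

definition rbip :: "('a::real_inner, 'b::real_inner) bdry \<Rightarrow> ('a, 'b) bdry \<Rightarrow> real" where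
  "rbip x y = rip (fst x South) (fst y South) + rip (fst x North) (fst y North)
            + rip (snd x West) (snd y West) + rip (snd x East) (snd y East)"

interpretation bs: form_space "bspace a b" rbip
proof
  show "(0 :: ('a, 'b) bdry) \<in> bspace a b" by (simp add: bspace_iff opt_side_zero side_zero)
  fix x y :: "('a, 'b) bdry" assume x: "x \<in> bspace a b" 
  show "0 < rbip x x" if "x \<noteq> 0"
  proof (rule ccontr)
    have nn: "rip (fst x s) (fst x s) \<ge> 0" "rip (snd x t) (snd x t) \<ge> 0" for s t
      by (rule rip_nonneg)+
    assume "\<not> 0 < rbip x x"
    then have "rip (fst x South) (fst x South) = 0" "rip (fst x North) (fst x North) = 0"
      "rip (snd x West) (snd x West) = 0" "rip (snd x East) (snd x East) = 0"
      unfolding rbip_def using nn(1)[of South] nn(1)[of North] nn(2)[of West] nn(2)[of East]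
      by linarith+
    then have "fst x South = 0" "fst x North = 0" "snd x West = 0" "snd x East = 0"
      using side.form_pos[OF bspace_components(1)[OF x]] side.form_pos[OF bspace_components(2)[OF x]]
      by (metis less_irrefl)+
    then have "x = 0" by (intro bdry_eqI) simp_all
    with that show False by simp
  qed
  assume y: "y \<in> bspace a b"
  show "x - y \<in> bspace a b" using x y by (simp add: bspace_iff opt_side_diff side_diff)
  show "rbip x y = rbip y x" by (simp add: rbip_def rip_commute)
  fix z :: "('a, 'b) bdry" assume z: "z \<in> bspace a b"
  note mem = bspace_components[OF x] bspace_components[OF y] bspace_components[OF z]
  show "rbip (x - y) z = rbip x z - rbip y z"
    by (simp add: rbip_def side.form_diff_left[OF mem(1,3,5)] side.form_diff_left[OF mem(2,4,6)])
qed

text \<open>The real counterpart of \<open>Qset\<close>: the data that are stable under gluing and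
  under transposition alike.\<close>

definition RQ :: "extent \<Rightarrow> extent \<Rightarrow> ('a::real_inner, 'b::real_inner) shaped_op \<Rightarrow> bool" where
  "RQ a b M \<longleftrightarrow> width M = a \<and> height M = b \<and> coercive_op (bspace a b) rbip (act M)"

context
  fixes a b :: extent and M :: "('a::real_inner, 'b::real_inner) shaped_op"
  assumes M: "RQ a b M"
begin

lemma RQ_sym: "sym_op (bspace a b) rbip (act M)"
  using M by (simp add: RQ_def coercive_op_def)

lemma RQ_mem: "x \<in> bspace a b \<Longrightarrow> act M x \<in> bspace a b"
  using RQ_sym by (simp add: sym_op_def)

lemma RQ_symD: "x \<in> bspace a b \<Longrightarrow> y \<in> bspace a b \<Longrightarrow> rbip (act M x) y = rbip x (act M y)"
  using RQ_sym by (simp add: sym_op_def)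

lemmas RQ_diff = bs.sym_op_diff[OF RQ_sym] and RQ_add = bs.sym_op_add[OF RQ_sym]
  and RQ_zero = bs.sym_op_zero[OF RQ_sym]

lemma RQ_nonneg: "x \<in> bspace a b \<Longrightarrow> 0 \<le> rbip (act M x) x"
  using M bs.form_nonneg[of x a b] unfolding RQ_def coercive_op_def
  by (meson mult_nonneg_nonneg less_imp_le order_trans)

end

lemma set_v_components [simp]:
  "fst (set_v t g x) = fst x" "snd (set_v t g x) t' = (if t' = t then g else snd x t')"
  by (simp_all add: set_v_def)

lemma set_h_components [simp]:
  "snd (set_h s f x) = snd x" "fst (set_h s f x) s' = (if s' = s then f else fst x s')"
  by (simp_all add: set_h_def)

lemma set_East_mem: "g \<in> side b \<Longrightarrow> set_v East g 0 \<in> bspace a b"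
  by (simp add: bspace_iff opt_side_zero side_zero)

lemma set_West_mem: "g \<in> side b \<Longrightarrow> set_v West g 0 \<in> bspace (Seg p) b"
  by (simp add: bspace_iff opt_side_zero side_zero)

lemma rbip_set_v: "rbip x (set_v t g 0) = rip (snd x t) g"
  by (cases t) (simp_all add: rbip_def bsum_0[OF bounded_bilinear_inner])

subsection \<open>Horizontal gluing\<close>

text \<open>\<open>hglue M M' z w\<close> describes the operator \<open>M beside M'\<close> as a relation between boundary data
  and fluxes: there is a common value on the shared side for which the two fluxes cancel.\<close>

definition hglue :: "('a::real_inner, 'b::real_inner) shaped_op \<Rightarrow> ('a, 'b) shaped_op \<Rightarrow>
    ('a, 'b) bdry \<Rightarrow> ('a, 'b) bdry \<Rightarrow> bool" where
  "hglue M M' z w \<longleftrightarrow> (\<exists>x\<in>bspace (width M) (height M). \<exists>x'\<in>bspace (width M') (height M').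
     snd x East = snd x' West \<and> snd (act M x) East + snd (act M' x') West = 0 \<and>
     z = h_join M M' (x, x') \<and> w = h_join M M' (act M x, act M' x'))"

text \<open>The extents \<open>a\<close> and \<open>b\<close> may each be finite or infinite, so one
  argument covers rectangles, half-strips and the corner.\<close>

locale hpair =
  fixes M M' :: "('a::real_inner, 'b::real_inner) shaped_op" and a b :: extent and p :: nat
  assumes complete: "complete (UNIV :: 'b set)" and M: "RQ a b M" and M': "RQ (Seg p) b M'"
begin

abbreviation "join \<equiv> h_join M M'"
abbreviation "L \<equiv> blk_vv M East East + blk_vv M' West West"

lemma shape: "width M = a" "height M = b" "width M' = Seg p" "height M' = b"
  using M M' by (simp_all add: RQ_def)

lemma join_components:
  "fst (join (x, x')) s = cat a p (fst x s, fst x' s)"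
  "snd (join (x, x')) West = snd x West" "snd (join (x, x')) East = snd x' East"
  by (simp_all add: h_join_def shape)

lemma join_mem:
  assumes "x \<in> bspace a b" "x' \<in> bspace (Seg p) b"
  shows "join (x, x') \<in> bspace (ext_plus a p) b"
  using assms by (simp add: bspace_iff join_components cat_mem cat_opt_mem)

lemma join_inject:
  assumes "x \<in> bspace a b" "x' \<in> bspace (Seg p) b" "y \<in> bspace a b" "y' \<in> bspace (Seg p) b"
    and "join (x, x') = join (y, y')"
  shows "fst x = fst y" "fst x' = fst y'" "snd x West = snd y West" "snd x' East = snd y' East"
proof -
  have eq: "fst (join (x, x')) s = fst (join (y, y')) s" "snd (join (x, x')) t = snd (join (y, y')) t"
    for s t using assms(5) by simp_all
  have "fst x s = fst y s \<and> fst x' s = fst y' s" for s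
    using eq(1)[of s] assms(1-4)[THEN bspace_components(1)]
    unfolding join_components by (intro cat_inject)
  then show "fst x = fst y" "fst x' = fst y'" by auto
  show "snd x West = snd y West" "snd x' East = snd y' East"
    using eq(2)[of West] eq(2)[of East] by (simp_all add: join_components)
qed

lemma join_surj:
  assumes "z \<in> bspace (ext_plus a p) b"
  obtains x x' where "x \<in> bspace a b" "x' \<in> bspace (Seg p) b" "snd x East = 0" "snd x' West = 0"
    "z = join (x, x')"
proof -
  obtain s s' where s: "s \<in> opt_side b a" "s' \<in> opt_side b (Seg p)" "fst z South = cat a p (s, s')"
    using assms by (auto simp: bspace_iff elim: cat_opt_surj)
  obtain n n' where n: "n \<in> side a" "n' \<in> side (Seg p)" "fst z North = cat a p (n, n')"
    using assms by (auto simp: bspace_iff elim: cat_surj)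
  define x :: "('a, 'b) bdry" where
    "x = (\<lambda>d. case d of South \<Rightarrow> s | North \<Rightarrow> n, \<lambda>d. case d of West \<Rightarrow> snd z West | East \<Rightarrow> 0)"
  define x' :: "('a, 'b) bdry" where
    "x' = (\<lambda>d. case d of South \<Rightarrow> s' | North \<Rightarrow> n', \<lambda>d. case d of West \<Rightarrow> 0 | East \<Rightarrow> snd z East)"
  show ?thesis
  proof (rule that)
    show "x \<in> bspace a b" "x' \<in> bspace (Seg p) b"
      using assms s n by (simp_all add: x_def x'_def bspace_iff side_zero)
    show "snd x East = 0" "snd x' West = 0" by (simp_all add: x_def x'_def)
    show "z = join (x, x')"
      by (intro bdry_eqI) (simp_all add: join_components, simp_all add: x_def x'_def s n)
  qed
qed

lemma rbip_join:
  assumes "x \<in> bspace a b" "x' \<in> bspace (Seg p) b" "y \<in> bspace a b" "y' \<in> bspace (Seg p) b"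
  shows "rbip (join (x, x')) (join (y, y'))
    = rbip x y + rbip x' y' - rip (snd x East) (snd y East) - rip (snd x' West) (snd y' West)"
  using assms[THEN bspace_components(1)]
  by (simp add: rbip_def join_components rip_cat)

text \<open>Here \<open>y\<close>, \<open>y'\<close> stand for fluxes and \<open>u\<close>,
  \<open>u'\<close> for values. The shared-side terms pair one common value with two opposite fluxes
  and cancel, so the glued form is the sum of the two forms.\<close>

lemma rbip_join_flux:
  assumes "y \<in> bspace a b" "y' \<in> bspace (Seg p) b" "u \<in> bspace a b" "u' \<in> bspace (Seg p) b"
    and "snd u East = snd u' West" and "snd y East + snd y' West = 0"
  shows "rbip (join (y, y')) (join (u, u')) = rbip y u + rbip y' u'"
proof -
  have "rip (snd y East) (snd u East) + rip (snd y' West) (snd u East)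
      = rip (snd y East + snd y' West) (snd u East)"
    using bspace_components(2) assms(1-3) by (intro side.form_add_left[symmetric, of _ b]) blast+
  also have "\<dots> = 0" using assms(6) by (simp add: bsum_0[OF bounded_bilinear_inner])
  finally show ?thesis using rbip_join[OF assms(1-4)] assms(5) by simp
qed

section \<open>The operator on the shared side and the solution of the gluing relation\<close>

lemma L_eq: "L g = snd (act M (set_v East g 0)) East + snd (act M' (set_v West g 0)) West"
  by (simp add: blk_vv_def)

lemma L_form:
  assumes "g \<in> side b" "h \<in> side b"
  shows "rip (L g) h = rbip (act M (set_v East g 0)) (set_v East h 0)
    + rbip (act M' (set_v West g 0)) (set_v West h 0)"
  unfolding L_eq rbip_set_v using assms
  by (intro side.form_add_left[of _ b] bspace_components(2)[OF RQ_mem[OF M]]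
      bspace_components(2)[OF RQ_mem[OF M']] set_East_mem set_West_mem)

lemma L_mem: "g \<in> side b \<Longrightarrow> L g \<in> side b"
  unfolding L_eq
  by (intro side_add bspace_components(2)[OF RQ_mem[OF M]] bspace_components(2)[OF RQ_mem[OF M']]
      set_East_mem set_West_mem)

text \<open>\<open>L\<close> is the sum of the compressions of \<open>M\<close> and
  \<open>M'\<close> to the shared side; hence it is symmetric and the constants add.\<close>

lemma L_coercive: "coercive_op (side b) rip L"
proof -
  obtain c C c' C' where c: "c > 0" "c' > 0"
    and bd: "\<And>x. x \<in> bspace a b \<Longrightarrow> c * rbip x x \<le> rbip (act M x) x \<and> rbip (act M x) x \<le> C * rbip x x"
    and bd': "\<And>x. x \<in> bspace (Seg p) b \<Longrightarrow>
      c' * rbip x x \<le> rbip (act M' x) x \<and> rbip (act M' x) x \<le> C' * rbip x x"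
    using M M' unfolding RQ_def coercive_op_def by metis
  have "sym_op (side b) rip L"
    unfolding sym_op_def
  proof (intro conjI ballI L_mem)
    fix g h :: "int \<Rightarrow> 'b" assume gh: "g \<in> side b" "h \<in> side b"
    show "rip (L g) h = rip g (L h)"
      unfolding rip_commute[of g] L_form[OF gh] L_form[OF gh(2,1)]
      using gh by (simp add: RQ_symD[OF M] RQ_symD[OF M'] set_East_mem set_West_mem RQ_mem[OF M]
          RQ_mem[OF M'] bs.form_commute[of "set_v East h 0" a b] bs.form_commute[of "set_v West h 0" "Seg p" b])
  qed
  moreover have "(c + c') * rip g g \<le> rip (L g) g \<and> rip (L g) g \<le> (C + C') * rip g g"
    if g: "g \<in> side b" for g
    using bd[OF set_East_mem[OF g]] bd'[OF set_West_mem[OF g]] L_form[OF g g]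
    by (simp add: rbip_set_v[of "set_v East g 0"] rbip_set_v[of "set_v West g 0"] distrib_right)
  ultimately show ?thesis unfolding coercive_op_def using c by (metis add_pos_pos)
qed

lemma L_bij: "bij_betw L (side b) (side b)"
  by (rule coercive_op_bij[OF complete L_coercive])

lemma L_inv:
  assumes "s \<in> side b"
  shows "inv_into (side b) L s \<in> side b" "L (inv_into (side b) L s) = s"
  using L_bij assms unfolding bij_betw_def by (blast intro: inv_into_into, metis f_inv_into_f)

lemma beside_shape: "width (M beside M') = ext_plus a p" "height (M beside M') = b"
  by (simp_all add: beside_def Let_def shape)

lemma join_inj_on: "inj_on join (h_outer M M')"
proof (rule inj_onI, clarify)
  fix u u' y y' :: "('a, 'b) bdry"
  assume *: "(u, u') \<in> h_outer M M'" "(y, y') \<in> h_outer M M'" "join (u, u') = join (y, y')"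
  then have mem: "u \<in> bspace a b" "u' \<in> bspace (Seg p) b" "y \<in> bspace a b" "y' \<in> bspace (Seg p) b"
    by (simp_all add: h_outer_def shape)
  show "u = y \<and> u' = y'"
    using * join_inject[OF mem *(3)] by (auto intro!: bdry_eqI simp: h_outer_def)
qed

text \<open>The Schur complement on representatives that vanish on the shared side. \<open>L\<close>
  maps \<open>v\<close> to the flux mismatch of \<open>x\<close> and \<open>x'\<close>, so the
  common value that balances the fluxes will be \<open>- v\<close>.\<close>

lemma act_beside:
  assumes x: "x \<in> bspace a b" "snd x East = 0" and x': "x' \<in> bspace (Seg p) b" "snd x' West = 0"
  defines "v \<equiv> inv_into (side b) L (snd (act M x) East + snd (act M' x') West)"
  shows "act (M beside M') (join (x, x'))
    = join (act M x - act M (set_v East v 0), act M' x' - act M' (set_v West v 0))"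
proof -
  have inv: "inv_into (h_outer M M') join (join (x, x')) = (x, x')"
    using x x' join_inj_on by (intro inv_into_f_f) (simp_all add: h_outer_def shape)
  have drop: "set_v East 0 x = x" "set_v West 0 x' = x'"
    using x(2) x'(2) by (auto intro!: bdry_eqI)
  have L: "(\<lambda>v. snd (h_form_sum M M' (0, v))) = L"
    by (rule ext) (simp only: L_eq, simp add: h_form_sum_def Let_def zero_prod_def)
  have "act (M beside M') (join (x, x')) = join (schur (side b) (h_form_sum M M') (x, x'))"
    using join_mem[OF x(1) x'(1)] by (simp add: beside_def Let_def shape inv)
  also have "schur (side b) (h_form_sum M M') (x, x')
      = (set_v East 0 (act M x) - set_v East 0 (act M (set_v East v 0)),
         set_v West 0 (act M' x') - set_v West 0 (act M' (set_v West v 0)))"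
    unfolding schur_def L
    by (simp add: h_form_sum_def Let_def drop v_def) (simp add: zero_prod_def)
  \<comment> \<open>\<open>join\<close> forgets the components on the shared side, so resetting them
    to 0 has no effect.\<close>
  also have "join \<dots> = join (act M x - act M (set_v East v 0), act M' x' - act M' (set_v West v 0))"
    by (intro bdry_eqI) (simp_all add: join_components)
  finally show ?thesis .
qed

text \<open>Subtracting \<open>v\<close> on both copies of the shared side changes the total flux by
  \<open>- L v\<close>, which cancels the mismatch, and \<open>join\<close> does not see the
  change.\<close>

lemma beside_solution:
  assumes x: "x \<in> bspace a b" "snd x East = 0" and x': "x' \<in> bspace (Seg p) b" "snd x' West = 0"
  obtains u u' where "u \<in> bspace a b" "u' \<in> bspace (Seg p) b" "snd u East = snd u' West"
    "snd (act M u) East + snd (act M' u') West = 0" "join (u, u') = join (x, x')"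
    "act (M beside M') (join (x, x')) = join (act M u, act M' u')"
proof -
  define s where "s = snd (act M x) East + snd (act M' x') West"
  define v where "v = inv_into (side b) L s"
  have s: "s \<in> side b"
    unfolding s_def by (intro side_add bspace_components(2)[OF RQ_mem[OF M x(1)]]
        bspace_components(2)[OF RQ_mem[OF M' x'(1)]])
  have v: "v \<in> side b" "L v = s" using L_inv[OF s] by (simp_all add: v_def)
  note vE = set_East_mem[OF v(1), of a] and vW = set_West_mem[OF v(1), of p]
  let ?u = "x - set_v East v 0" and ?u' = "x' - set_v West v 0"
  have Mu: "act M ?u = act M x - act M (set_v East v 0)" "act M' ?u' = act M' x' - act M' (set_v West v 0)"
    by (rule RQ_diff[OF M x(1) vE], rule RQ_diff[OF M' x'(1) vW])
  show ?thesis
  proof (rule that)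
    show "?u \<in> bspace a b" "?u' \<in> bspace (Seg p) b"
      by (rule bs.diff_mem[OF x(1) vE], rule bs.diff_mem[OF x'(1) vW])
    show "snd ?u East = snd ?u' West" using x x' by simp
    have "snd (act M ?u) East + snd (act M' ?u') West = s - L v"
      unfolding Mu s_def L_eq by simp
    then show "snd (act M ?u) East + snd (act M' ?u') West = 0" using v by simp
    show "join (?u, ?u') = join (x, x')" by (intro bdry_eqI) (simp_all add: join_components)
    show "act (M beside M') (join (x, x')) = join (act M ?u, act M' ?u')"
      unfolding Mu unfolding v_def s_def by (rule act_beside[OF x x'])
  qed
qed

lemma hglue_beside:
  assumes "z \<in> bspace (ext_plus a p) b"
  shows "hglue M M' z (act (M beside M') z)"
proof -
  obtain x x' where x: "x \<in> bspace a b" "snd x East = 0" "x' \<in> bspace (Seg p) b" "snd x' West = 0"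
    and z: "z = join (x, x')" using assms by (rule join_surj)
  show ?thesis
    using beside_solution[OF x] unfolding hglue_def shape z by metis
qed

text \<open>Two solutions with the same outer data differ by a common value \<open>v\<close> on the
  shared side. Vanishing of both total fluxes gives \<open>L v = 0\<close>, and coercivity forces
  \<open>v = 0\<close>.\<close>

lemma hglue_unique:
  assumes "hglue M M' z w" "hglue M M' z w'"
  shows "w = w'"
proof -
  obtain x x' where x: "x \<in> bspace a b" "x' \<in> bspace (Seg p) b" "snd x East = snd x' West"
    "snd (act M x) East + snd (act M' x') West = 0" "z = join (x, x')" "w = join (act M x, act M' x')"
    using assms(1) unfolding hglue_def shape by blast
  obtain y y' where y: "y \<in> bspace a b" "y' \<in> bspace (Seg p) b" "snd y East = snd y' West"
    "snd (act M y) East + snd (act M' y') West = 0" "z = join (y, y')" "w' = join (act M y, act M' y')"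
    using assms(2) unfolding hglue_def shape by blast
  define v where "v = snd x East - snd y East"
  have v: "v \<in> side b" unfolding v_def using x y by (intro side_diff bspace_components(2))
  have eq: "join (x, x') = join (y, y')" using x y by simp
  note inj = join_inject[OF x(1,2) y(1,2) eq]
  have "x - y = set_v East v 0" "x' - y' = set_v West v 0"
    using inj x(3) y(3) by (auto intro!: bdry_eqI simp: v_def)
  then have "L v = snd (act M (x - y)) East + snd (act M' (x' - y')) West" by (simp only: L_eq)
  also have "\<dots> = (snd (act M x) East + snd (act M' x') West) - (snd (act M y) East + snd (act M' y') West)"
    by (simp add: RQ_diff[OF M x(1) y(1)] RQ_diff[OF M' x(2) y(2)])
  also have "\<dots> = 0" by (simp only: x(4) y(4) diff_self)
  finally have "v = 0"
    by (intro side.coercive_op_kernel[OF L_coercive v]) (simp add: bsum_0[OF bounded_bilinear_inner])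
  then have "x = y" "x' = y'" using inj x(3) y(3) by (auto intro!: bdry_eqI simp: v_def)
  then show ?thesis using x y by simp
qed

lemma hglue_iff:
  assumes "z \<in> bspace (ext_plus a p) b"
  shows "hglue M M' z w \<longleftrightarrow> act (M beside M') z = w"
  using hglue_beside[OF assms] hglue_unique by blast

lemma hglueE:
  assumes "z \<in> bspace (ext_plus a p) b"
  obtains x x' where "x \<in> bspace a b" "x' \<in> bspace (Seg p) b" "snd x East = snd x' West"
    "snd (act M x) East + snd (act M' x') West = 0" "z = join (x, x')"
    "act (M beside M') z = join (act M x, act M' x')"
  using hglue_beside[OF assms] unfolding hglue_def shape by blast

lemma hglueI:
  assumes "x \<in> bspace a b" "x' \<in> bspace (Seg p) b" "snd x East = snd x' West"
    "snd (act M x) East + snd (act M' x') West = 0"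
  shows "act (M beside M') (join (x, x')) = join (act M x, act M' x')"
  using assms hglue_iff[OF join_mem[OF assms(1,2)]] unfolding hglue_def shape by blast

text \<open>The form of the gluing at \<open>z\<close> is the energy of the solution
  \<open>(x, x')\<close>. The norm of the solution dominates that of \<open>z\<close>, whence the
  lower bound. The solution minimises the energy among the extensions of \<open>z\<close>, and
  comparison with the zero extension \<open>(y, y')\<close> gives the upper bound.\<close>

lemma RQ_beside: "RQ (ext_plus a p) b (M beside M')"
proof -
  let ?S = "bspace (ext_plus a p) b :: ('a, 'b) bdry set" and ?N = "act (M beside M')"
  obtain c C c' C' where c: "c > 0" "c' > 0"
    and bd: "\<And>x. x \<in> bspace a b \<Longrightarrow> c * rbip x x \<le> rbip (act M x) x \<and> rbip (act M x) x \<le> C * rbip x x"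
    and bd': "\<And>x. x \<in> bspace (Seg p) b \<Longrightarrow>
      c' * rbip x x \<le> rbip (act M' x) x \<and> rbip (act M' x) x \<le> C' * rbip x x"
    using M M' unfolding RQ_def coercive_op_def by metis
  have mem: "?N z \<in> ?S" if z: "z \<in> ?S" for z
    using z by (rule hglueE) (simp add: join_mem RQ_mem[OF M] RQ_mem[OF M'])
  have "sym_op ?S rbip ?N"
    unfolding sym_op_def
  proof (intro conjI ballI mem)
    fix z w assume zw: "z \<in> ?S" "w \<in> ?S"
    obtain x x' where x: "x \<in> bspace a b" "x' \<in> bspace (Seg p) b" "snd x East = snd x' West"
      "snd (act M x) East + snd (act M' x') West = 0" "z = join (x, x')"
      "?N z = join (act M x, act M' x')" using zw(1) by (rule hglueE)
    obtain y y' where y: "y \<in> bspace a b" "y' \<in> bspace (Seg p) b" "snd y East = snd y' West"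
      "snd (act M y) East + snd (act M' y') West = 0" "w = join (y, y')"
      "?N w = join (act M y, act M' y')" using zw(2) by (rule hglueE)
    have "rbip (?N z) w = rbip (act M x) y + rbip (act M' x') y'"
      unfolding x(6) y(5)
      by (rule rbip_join_flux[OF RQ_mem[OF M x(1)] RQ_mem[OF M' x(2)] y(1-3) x(4)])
    also have "\<dots> = rbip (act M y) x + rbip (act M' y') x'"
      using x y by (simp add: RQ_symD[OF M] RQ_symD[OF M'] RQ_mem[OF M] RQ_mem[OF M']
          bs.form_commute[of x a b] bs.form_commute[of x' "Seg p" b])
    also have "\<dots> = rbip (?N w) z"
      unfolding x(5) y(6)
      by (rule rbip_join_flux[OF RQ_mem[OF M y(1)] RQ_mem[OF M' y(2)] x(1-3) y(4), symmetric])
    also have "\<dots> = rbip z (?N w)" using zw mem by (simp add: bs.form_commute[of _ "ext_plus a p" b])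
    finally show "rbip (?N z) w = rbip z (?N w)" .
  qed
  moreover have "min c c' * rbip z z \<le> rbip (?N z) z \<and> rbip (?N z) z \<le> max C C' * rbip z z"
    if z: "z \<in> ?S" for z
  proof -
    obtain y y' where y: "y \<in> bspace a b" "snd y East = 0" "y' \<in> bspace (Seg p) b" "snd y' West = 0"
      and zy: "z = join (y, y')" using z by (rule join_surj)
    obtain x x' where x: "x \<in> bspace a b" "x' \<in> bspace (Seg p) b" "snd x East = snd x' West"
      "snd (act M x) East + snd (act M' x') West = 0" "z = join (x, x')"
      "?N z = join (act M x, act M' x')" using z by (rule hglueE)
    have E: "rbip (?N z) z = rbip (act M x) x + rbip (act M' x') x'"
      unfolding x(6) unfolding x(5)
      by (rule rbip_join_flux[OF RQ_mem[OF M x(1)] RQ_mem[OF M' x(2)] x(1-4)])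
    \<comment> \<open>Tested against the zero extension instead of the solution, the fluxes give the
      same number, because the total flux through the shared side is 0.\<close>
    have E': "rbip (?N z) z = rbip (act M x) y + rbip (act M' x') y'"
      unfolding x(6) unfolding zy
      by (rule rbip_join_flux[OF RQ_mem[OF M x(1)] RQ_mem[OF M' x(2)] y(1,3) _ x(4)]) (simp add: y)
    have zz: "rbip z z = rbip y y + rbip y' y'"
      unfolding zy rbip_join[OF y(1,3) y(1,3)] y(2,4) by (simp add: bsum_0[OF bounded_bilinear_inner])
    have "rbip z z = rbip x x + rbip x' x' - rip (snd x East) (snd x East) - rip (snd x' West) (snd x' West)"
      unfolding x(5) by (rule rbip_join[OF x(1,2) x(1,2)])
    then have "rbip z z \<le> rbip x x + rbip x' x'"
      using rip_nonneg[of "snd x East"] rip_nonneg[of "snd x' West"] by linarith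
    then have "min c c' * rbip z z \<le> min c c' * rbip x x + min c c' * rbip x' x'"
      using c by (simp flip: distrib_left)
    also have "\<dots> \<le> c * rbip x x + c' * rbip x' x'"
      using bs.form_nonneg[OF x(1)] bs.form_nonneg[OF x(2)] by (intro add_mono mult_right_mono) auto
    also have "\<dots> \<le> rbip (?N z) z" using bd[OF x(1)] bd'[OF x(2)] by (simp add: E)
    finally have lower: "min c c' * rbip z z \<le> rbip (?N z) z" .
    have expand: "rbip (act N (u - v)) (u - v) = rbip (act N u) u - 2 * rbip (act N v) u + rbip (act N v) v"
      if "RQ d b N" "u \<in> bspace d b" "v \<in> bspace d b" for d N and u v :: "('a, 'b) bdry"
      using that(2,3) RQ_symD[OF that] RQ_mem[OF that(1)]
      by (simp add: RQ_diff[OF that(1)] bs.form_diff_left[of _ d b] bs.form_diff_right[of _ d b] bs.diff_mem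
          bs.form_commute[of u d b])
    \<comment> \<open>Minimum principle: by \<open>E\<close> and \<open>E'\<close> the energy of
      \<open>(y - x, y' - x')\<close> is the energy of the trial pair minus that of the
      solution.\<close>
    have "0 \<le> rbip (act M (y - x)) (y - x) + rbip (act M' (y' - x')) (y' - x')"
      using x y by (intro add_nonneg_nonneg RQ_nonneg[OF M] RQ_nonneg[OF M'] bs.diff_mem)
    also have "\<dots> = rbip (act M y) y + rbip (act M' y') y' - rbip (?N z) z"
      unfolding expand[OF M y(1) x(1)] expand[OF M' y(3) x(2)] using E E' by linarith
    finally have "rbip (?N z) z \<le> C * rbip y y + C' * rbip y' y'"
      using bd[OF y(1)] bd'[OF y(3)] by linarith
    also have "\<dots> \<le> max C C' * rbip y y + max C C' * rbip y' y'"
      using bs.form_nonneg[OF y(1)] bs.form_nonneg[OF y(3)] by (intro add_mono mult_right_mono) auto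
    finally show ?thesis using lower by (simp add: zz distrib_left)
  qed
  ultimately show ?thesis
    unfolding RQ_def coercive_op_def beside_shape using c by (meson min_less_iff_conj)
qed

end

subsection \<open>Transposition and vertical gluing\<close>

text \<open>Exchanging the two directions (South with West, North with East) turns vertical gluings into
  horizontal ones.\<close>

definition tr :: "('a, 'b) bdry \<Rightarrow> ('b, 'a) bdry" where
  "tr x = (\<lambda>s. case s of South \<Rightarrow> snd x West | North \<Rightarrow> snd x East,
           \<lambda>t. case t of West \<Rightarrow> fst x South | East \<Rightarrow> fst x North)"

lemma tr_components [simp]:
  "fst (tr x) South = snd x West" "fst (tr x) North = snd x East"
  "snd (tr x) West = fst x South" "snd (tr x) East = fst x North"
  by (simp_all add: tr_def)

lemma tr_tr [simp]: "tr (tr x) = x"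
  by (rule bdry_eqI) simp_all

lemma tr_linear: "tr 0 = 0" "tr (x + y) = tr x + tr y" "tr (x - y) = tr x - tr y"
  by (rule bdry_eqI; simp)+

lemma tr_mem [simp]: "tr x \<in> bspace b a \<longleftrightarrow> x \<in> bspace a b"
  by (auto simp: bspace_iff)

lemma rbip_tr: "rbip (tr x) (tr y) = rbip x y"
  by (simp add: rbip_def)

lemma rbip_tr_left: "rbip (tr x) y = rbip x (tr y)"
  using rbip_tr[of x "tr y"] by simp

lemma tr_set: "tr (set_v West g x) = set_h South g (tr x)" "tr (set_v East g x) = set_h North g (tr x)"
  "tr (set_h South f y) = set_v West f (tr y)" "tr (set_h North f y) = set_v East f (tr y)"
  by (rule bdry_eqI; simp)+

definition trop :: "('a, 'b) shaped_op \<Rightarrow> ('b, 'a) shaped_op" where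
  "trop M = Shaped_op (height M) (width M) (\<lambda>x. tr (act M (tr x)))"

lemma trop_simps [simp]:
  "width (trop M) = height M" "height (trop M) = width M" "act (trop M) x = tr (act M (tr x))"
  by (simp_all add: trop_def)

lemma trop_trop [simp]: "trop (trop M) = M"
  by (simp add: trop_def)

lemma RQ_trop [simp]: "RQ b a (trop M) \<longleftrightarrow> RQ a b M"
proof -
  \<comment> \<open>Stated for other element types, so that it applies both to \<open>M\<close> and
    to \<open>trop M\<close>.\<close>
  have "RQ b a (trop M)" if M: "RQ a b M" for a b and M :: "('c::real_inner, 'd::real_inner) shaped_op"
  proof -
    obtain c C where c: "c > 0"
      and bd: "\<And>x. x \<in> bspace a b \<Longrightarrow> c * rbip x x \<le> rbip (act M x) x \<and> rbip (act M x) x \<le> C * rbip x x"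
      using M unfolding RQ_def coercive_op_def by metis
    have "c * rbip x x \<le> rbip (act (trop M) x) x \<and> rbip (act (trop M) x) x \<le> C * rbip x x"
      if "x \<in> bspace b a" for x
      using bd[of "tr x"] that by (simp add: rbip_tr_left)
    moreover have "sym_op (bspace b a) rbip (act (trop M))"
      unfolding sym_op_def
    proof (intro conjI ballI)
      fix x y :: "('d, 'c) bdry" assume "x \<in> bspace b a" "y \<in> bspace b a"
      then show "act (trop M) x \<in> bspace b a" "rbip (act (trop M) x) y = rbip x (act (trop M) y)"
        using RQ_mem[OF M] RQ_symD[OF M, of "tr x" "tr y"] by (simp_all add: rbip_tr_left)
    qed
    ultimately have "coercive_op (bspace b a) rbip (act (trop M))"
      unfolding coercive_op_def using c by blast
    then show ?thesis using M by (simp add: RQ_def)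
  qed
  from this[of a b M] this[of b a "trop M"] show ?thesis by auto
qed

text \<open>Equality on the carrier only. Off the carrier \<open>trop\<close> turns
  \<open>undefined\<close> into \<open>tr undefined\<close>, so identities obtained by transposition
  hold first in this sense; \<open>op_eqI\<close> upgrades them for extensional operators.\<close>

definition op_agree :: "('a::real_inner, 'b::real_inner) shaped_op \<Rightarrow> ('a, 'b) shaped_op \<Rightarrow> bool" where
  "op_agree M N \<longleftrightarrow> width M = width N \<and> height M = height N \<and>
     (\<forall>z\<in>bspace (width M) (height M). act M z = act N z)"

lemma op_agree_sym: "op_agree M N \<Longrightarrow> op_agree N M"
  by (simp add: op_agree_def)

lemma op_agree_trans: "op_agree M N \<Longrightarrow> op_agree N K \<Longrightarrow> op_agree M K"
  by (simp add: op_agree_def)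

lemma op_agree_trop: "op_agree M N \<Longrightarrow> op_agree (trop M) (trop N)"
  by (simp add: op_agree_def)

lemma coercive_op_cong:
  assumes "\<And>x. x \<in> S \<Longrightarrow> L x = L' x"
  shows "coercive_op S form L \<longleftrightarrow> coercive_op S form L'"
  unfolding coercive_op_def sym_op_def by (simp add: assms cong: ball_cong)

lemma RQ_agree: "op_agree M N \<Longrightarrow> RQ a b M \<Longrightarrow> RQ a b N"
  by (simp add: RQ_def op_agree_def cong: coercive_op_cong)

abbreviation ext_op :: "('a::real_inner, 'b::real_inner) shaped_op \<Rightarrow> bool" where
  "ext_op M \<equiv> act M \<in> extensional (bspace (width M) (height M))"

lemma op_eqI: "op_agree M N \<Longrightarrow> ext_op M \<Longrightarrow> ext_op N \<Longrightarrow> M = N"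
  unfolding op_agree_def by (intro shaped_op.expand conjI extensionalityI) auto

lemma ext_beside: "ext_op (M beside M')"
  by (simp add: beside_def Let_def)

lemma ext_below: "ext_op (M below M')"
  by (simp add: below_def Let_def)

locale vpair =
  fixes M M' :: "('a::real_inner, 'b::real_inner) shaped_op" and a b :: extent and q :: nat
  assumes complete: "complete (UNIV :: 'a set)" and M: "RQ a b M" and M': "RQ a (Seg q) M'"
begin

sublocale T: hpair "trop M" "trop M'" b a q
  using complete M M' by unfold_locales simp_all

lemma shape: "width M = a" "height M = b" "width M' = a" "height M' = Seg q"
  using M M' by (simp_all add: RQ_def)

abbreviation "vjoin \<equiv> v_join M M'"

lemma vjoin_components:
  "snd (vjoin (x, x')) t = cat b q (snd x t, snd x' t)"
  "fst (vjoin (x, x')) South = fst x South" "fst (vjoin (x, x')) North = fst x' North"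
  by (simp_all add: v_join_def shape)

lemma tr_join: "tr (T.join (x, x')) = vjoin (tr x, tr x')"
  by (rule bdry_eqI) (simp_all add: vjoin_components T.join_components)

lemma tr_vjoin: "tr (vjoin (x, x')) = T.join (tr x, tr x')"
  by (rule bdry_eqI) (simp_all add: vjoin_components T.join_components)

lemma vjoin_mem:
  assumes "x \<in> bspace a b" "x' \<in> bspace a (Seg q)"
  shows "vjoin (x, x') \<in> bspace a (ext_plus b q)"
  using T.join_mem[of "tr x" "tr x'"] assms tr_mem[of "vjoin (x, x')"] by (simp add: tr_vjoin)

lemma below_shape: "width (M below M') = a" "height (M below M') = ext_plus b q"
  by (simp_all add: below_def Let_def shape)

abbreviation tr2 :: "('b, 'a) bdry \<times> ('b, 'a) bdry \<Rightarrow> ('a, 'b) bdry \<times> ('a, 'b) bdry" where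
  "tr2 \<equiv> map_prod tr tr"

lemma v_form_sum_eq: "v_form_sum M M' (tr2 u, v)
    = map_prod tr2 id (h_form_sum (trop M) (trop M') (u, v))"
  by (cases u) (simp add: v_form_sum_def h_form_sum_def Let_def tr_set)

lemma schur_tr:
  "schur (side a) (v_form_sum M M') (tr2 u) = tr2 (schur (side a) (h_form_sum (trop M) (trop M')) u)"
proof -
  have z: "0 = tr2 0" by (simp add: prod_eq_iff tr_linear)
  have diff: "tr2 (u - v) = tr2 u - tr2 v" for u v
    by (rule prod_eqI) (simp_all add: tr_linear)
  show ?thesis
    unfolding schur_def z v_form_sum_eq
    by (simp add: diff)
qed

text \<open>Transposition carries \<open>v_form_sum\<close>, \<open>v_join\<close> and the Schur
  complement into their horizontal counterparts. The existence, uniqueness and coercivity results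
  for vertical gluing are read off from this.\<close>

lemma below_agree: "op_agree (M below M') (trop (trop M beside trop M'))"
  unfolding op_agree_def
proof (intro conjI ballI)
  show "width (M below M') = width (trop (trop M beside trop M'))"
    "height (M below M') = height (trop (trop M beside trop M'))"
    by (simp_all add: below_shape T.beside_shape)
  fix z :: "('a, 'b) bdry" assume "z \<in> bspace (width (M below M')) (height (M below M'))"
  then have z: "z \<in> bspace a (ext_plus b q)" by (simp add: below_shape)
  then have "tr z \<in> bspace (ext_plus b q) a" by simp
  then obtain x x' where x: "x \<in> bspace b a" "x' \<in> bspace (Seg q) a" "snd x East = 0" "snd x' West = 0"
    and zx: "tr z = T.join (x, x')" by (rule T.join_surj)
  have zv: "z = vjoin (tr2 (x, x'))" using zx tr_join[of x x'] by (metis map_prod_simp tr_tr)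
  have outer: "(x, x') \<in> h_outer (trop M) (trop M')" using x by (simp add: h_outer_def shape)
  then have vouter: "tr2 (x, x') \<in> v_outer M M'" by (simp add: h_outer_def v_outer_def)
  have "inj_on vjoin (v_outer M M')"
  proof (rule inj_onI, clarify)
    fix u u' y y' :: "('a, 'b) bdry"
    assume *: "(u, u') \<in> v_outer M M'" "(y, y') \<in> v_outer M M'" "vjoin (u, u') = vjoin (y, y')"
    then have "(tr u, tr u') \<in> h_outer (trop M) (trop M')" "(tr y, tr y') \<in> h_outer (trop M) (trop M')"
      "T.join (tr u, tr u') = T.join (tr y, tr y')"
      by (simp_all add: v_outer_def h_outer_def flip: tr_vjoin)
    then have "(tr u, tr u') = (tr y, tr y')" using T.join_inj_on by (meson inj_onD)
    then show "u = y \<and> u' = y'" by (metis prod.inject tr_tr)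
  qed
  then have inv: "inv_into (v_outer M M') vjoin z = tr2 (x, x')"
    unfolding zv using vouter by (rule inv_into_f_f)
  have inv': "inv_into (h_outer (trop M) (trop M')) T.join (tr z) = (x, x')"
    unfolding zx using T.join_inj_on outer by (rule inv_into_f_f)
  have "act (M below M') z = vjoin (tr2 (schur (side a) (h_form_sum (trop M) (trop M')) (x, x')))"
    using z by (simp add: below_def Let_def shape inv schur_tr del: map_prod_simp)
  also have "\<dots> = tr (T.join (schur (side a) (h_form_sum (trop M) (trop M')) (x, x')))"
    by (cases "schur (side a) (h_form_sum (trop M) (trop M')) (x, x')") (simp add: tr_join)
  also have "\<dots> = act (trop (trop M beside trop M')) z"
    using z by (simp add: beside_def Let_def shape inv')
  finally show "act (M below M') z = act (trop (trop M beside trop M')) z" .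
qed

lemma act_below: "z \<in> bspace a (ext_plus b q) \<Longrightarrow> act (M below M') z = tr (act (trop M beside trop M') (tr z))"
  using below_agree by (simp add: op_agree_def below_shape)

lemma RQ_below: "RQ a (ext_plus b q) (M below M')"
  using RQ_agree[OF op_agree_sym[OF below_agree]] T.RQ_beside by simp

lemma vglueE:
  assumes z: "z \<in> bspace a (ext_plus b q)"
  obtains x x' where "x \<in> bspace a b" "x' \<in> bspace a (Seg q)" "fst x North = fst x' South"
    "fst (act M x) North + fst (act M' x') South = 0" "z = vjoin (x, x')"
    "act (M below M') z = vjoin (act M x, act M' x')"
proof -
  from z have "tr z \<in> bspace (ext_plus b q) a" by simp
  then obtain x x' where x: "x \<in> bspace b a" "x' \<in> bspace (Seg q) a" "snd x East = snd x' West"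
    "snd (act (trop M) x) East + snd (act (trop M') x') West = 0" "tr z = T.join (x, x')"
    "act (trop M beside trop M') (tr z) = T.join (act (trop M) x, act (trop M') x')"
    by (rule T.hglueE)
  show ?thesis
  proof (rule that)
    show "tr x \<in> bspace a b" "tr x' \<in> bspace a (Seg q)" using x by simp_all
    show "fst (tr x) North = fst (tr x') South" using x by simp
    show "fst (act M (tr x)) North + fst (act M' (tr x')) South = 0" using x by simp
    show "z = vjoin (tr x, tr x')" using x(5) by (metis tr_join tr_tr)
    show "act (M below M') z = vjoin (act M (tr x), act M' (tr x'))"
      unfolding act_below[OF z] x(6) tr_join by simp
  qed
qed

lemma vglueI:
  assumes x: "x \<in> bspace a b" "x' \<in> bspace a (Seg q)" "fst x North = fst x' South"
    "fst (act M x) North + fst (act M' x') South = 0"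
  shows "act (M below M') (vjoin (x, x')) = vjoin (act M x, act M' x')"
proof -
  have "act (trop M beside trop M') (T.join (tr x, tr x'))
      = T.join (act (trop M) (tr x), act (trop M') (tr x'))"
    using x by (intro T.hglueI) simp_all
  then show ?thesis
    by (simp add: act_below[OF vjoin_mem[OF x(1,2)]] tr_vjoin tr_join)
qed

end

subsection \<open>Associativity and interchange\<close>

text \<open>Lets agreement be used under \<open>beside\<close>: the gluing depends only on values on
  the carriers, and its result is extensional again, so that \<open>=\<close> is recovered.\<close>

lemma beside_cong:
  assumes "hpair M M' a b p" and MN: "op_agree M N" "op_agree M' N'"
  shows "M beside M' = N beside N'"
proof (rule op_eqI[OF _ ext_beside ext_beside])
  interpret M: hpair M M' a b p by fact
  interpret N: hpair N N' a b p
    using M.complete RQ_agree[OF MN(1) M.M] RQ_agree[OF MN(2) M.M'] by unfold_locales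
  show "op_agree (M beside M') (N beside N')"
    unfolding op_agree_def M.beside_shape N.beside_shape
  proof (intro conjI ballI refl)
    fix z :: "('a, 'b) bdry" assume "z \<in> bspace (ext_plus a p) b"
    then obtain x x' where x: "x \<in> bspace a b" "x' \<in> bspace (Seg p) b" "snd x East = snd x' West"
      "snd (act M x) East + snd (act M' x') West = 0" "z = M.join (x, x')"
      "act (M beside M') z = M.join (act M x, act M' x')" by (rule M.hglueE)
    have eq: "act N x = act M x" "act N' x' = act M' x'"
      using MN x by (simp_all add: op_agree_def M.shape)
    have join: "N.join = M.join" by (simp add: h_join_def M.shape N.shape)
    show "act (M beside M') z = act (N beside N') z"
      unfolding x(6) using N.hglueI[OF x(1-3)] x(4,5) by (simp add: eq join)
  qed
qed

lemma beside_assoc: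
  fixes A B C :: "('a::real_inner, 'b::real_inner) shaped_op"
  assumes compl: "complete (UNIV :: 'b set)" and A: "RQ a b A" and B: "RQ (Seg p) b B" and C: "RQ (Seg q) b C"
  shows "(A beside B) beside C = A beside (B beside C)"
proof (rule op_eqI[OF _ ext_beside ext_beside])
  interpret AB: hpair A B a b p using compl A B by unfold_locales
  interpret BC: hpair B C "Seg p" b q using compl B C by unfold_locales
  interpret AB_C: hpair "A beside B" C "ext_plus a p" b q using compl AB.RQ_beside C by unfold_locales
  interpret A_BC: hpair A "B beside C" a b "p + q" using compl A BC.RQ_beside by unfold_locales simp_all
  have ext: "ext_plus (ext_plus a p) q = ext_plus a (p + q)" by (cases a) simp_all
  show "op_agree ((A beside B) beside C) (A beside (B beside C))"
    unfolding op_agree_def AB_C.beside_shape A_BC.beside_shape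
  proof (intro conjI ballI refl ext)
    fix z :: "('a, 'b) bdry" assume "z \<in> bspace (ext_plus (ext_plus a p) q) b"
    then obtain x xC where x: "x \<in> bspace (ext_plus a p) b" "xC \<in> bspace (Seg q) b" "snd x East = snd xC West"
      "snd (act (A beside B) x) East + snd (act C xC) West = 0" "z = AB_C.join (x, xC)"
      "act ((A beside B) beside C) z = AB_C.join (act (A beside B) x, act C xC)" by (rule AB_C.hglueE)
    obtain xA xB where y: "xA \<in> bspace a b" "xB \<in> bspace (Seg p) b" "snd xA East = snd xB West"
      "snd (act A xA) East + snd (act B xB) West = 0" "x = AB.join (xA, xB)"
      "act (A beside B) x = AB.join (act A xA, act B xB)" using x(1) by (rule AB.hglueE)
    \<comment> \<open>The East side of \<open>AB.join (xA, xB)\<close> is that of \<open>xB\<close>,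
      so the outer matching condition is the one between \<open>B\<close> and
      \<open>C\<close>.\<close>
    have BC: "act (B beside C) (BC.join (xB, xC)) = BC.join (act B xB, act C xC)"
      using x y by (intro BC.hglueI) (simp_all add: AB.join_components)
    have "act (A beside (B beside C)) (A_BC.join (xA, BC.join (xB, xC)))
        = A_BC.join (act A xA, act (B beside C) (BC.join (xB, xC)))"
      using x y BC.join_mem[OF y(2) x(2)] by (intro A_BC.hglueI) (simp_all add: BC BC.join_components)
    moreover have "AB_C.join (AB.join (u, v), w) = A_BC.join (u, BC.join (v, w))" for u v w
      by (rule bdry_eqI) (simp_all add: AB_C.join_components AB.join_components A_BC.join_components
          BC.join_components cat_assoc)
    ultimately show "act ((A beside B) beside C) z = act (A beside (B beside C)) z"
      using x y by (simp add: BC)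
  qed
qed

lemma below_assoc:
  fixes A B C :: "('a::real_inner, 'b::real_inner) shaped_op"
  assumes compl: "complete (UNIV :: 'a set)" and A: "RQ a b A" and B: "RQ a (Seg p) B" and C: "RQ a (Seg q) C"
  shows "(A below B) below C = A below (B below C)"
proof (rule op_eqI[OF _ ext_below ext_below])
  interpret AB: vpair A B a b p using compl A B by unfold_locales
  interpret BC: vpair B C a "Seg p" q using compl B C by unfold_locales
  interpret AB_C: vpair "A below B" C a "ext_plus b p" q using compl AB.RQ_below C by unfold_locales
  interpret A_BC: vpair A "B below C" a b "p + q" using compl A BC.RQ_below by unfold_locales simp_all
  have agree: "op_agree (trop M) (trop M)" for M :: "('a, 'b) shaped_op" by (simp add: op_agree_def)
  have "trop (A below B) beside trop C = (trop A beside trop B) beside trop C"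
    using op_agree_trop[OF AB.below_agree] by (intro beside_cong[OF AB_C.T.hpair_axioms _ agree]) simp
  also have "\<dots> = trop A beside (trop B beside trop C)"
    using compl A B C by (intro beside_assoc[where a = b and b = a and p = p and q = q]) simp_all
  also have "\<dots> = trop A beside trop (B below C)"
    using op_agree_trop[OF BC.below_agree]
    by (intro beside_cong[OF A_BC.T.hpair_axioms agree, symmetric]) simp
  finally have "trop (A below B) beside trop C = trop A beside trop (B below C)" .
  then show "op_agree ((A below B) below C) (A below (B below C))"
    using AB_C.below_agree A_BC.below_agree by (metis op_agree_sym op_agree_trans)
qed

lemma interchange:
  fixes A B C D :: "('a::real_inner, 'b::real_inner) shaped_op"
  assumes compl: "complete (UNIV :: 'a set)" "complete (UNIV :: 'b set)"
    and A: "RQ a b A" and B: "RQ (Seg p) b B" and C: "RQ a (Seg q) C" and D: "RQ (Seg p) (Seg q) D"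
  shows "(A beside B) below (C beside D) = (A below C) beside (B below D)"
proof (rule op_eqI[OF _ ext_below ext_beside])
  interpret AB: hpair A B a b p using compl A B by unfold_locales
  interpret CD: hpair C D a "Seg q" p using compl C D by unfold_locales
  interpret AC: vpair A C a b q using compl A C by unfold_locales
  interpret BD: vpair B D "Seg p" b q using compl B D by unfold_locales
  interpret V: vpair "A beside B" "C beside D" "ext_plus a p" b q
    using compl AB.RQ_beside CD.RQ_beside by unfold_locales
  interpret H: hpair "A below C" "B below D" a "ext_plus b q" p
    using compl AC.RQ_below BD.RQ_below by unfold_locales
  show "op_agree ((A beside B) below (C beside D)) ((A below C) beside (B below D))"
    unfolding op_agree_def V.below_shape H.beside_shape
  proof (intro conjI ballI refl)
    fix z :: "('a, 'b) bdry" assume "z \<in> bspace (ext_plus a p) (ext_plus b q)"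
    then obtain x x' where x: "x \<in> bspace (ext_plus a p) b" "x' \<in> bspace (ext_plus a p) (Seg q)"
      "fst x North = fst x' South" "fst (act (A beside B) x) North + fst (act (C beside D) x') South = 0"
      "z = V.vjoin (x, x')"
      "act ((A beside B) below (C beside D)) z = V.vjoin (act (A beside B) x, act (C beside D) x')"
      by (rule V.vglueE)
    obtain xA xB where y: "xA \<in> bspace a b" "xB \<in> bspace (Seg p) b" "snd xA East = snd xB West"
      "snd (act A xA) East + snd (act B xB) West = 0" "x = AB.join (xA, xB)"
      "act (A beside B) x = AB.join (act A xA, act B xB)" using x(1) by (rule AB.hglueE)
    obtain xC xD where y': "xC \<in> bspace a (Seg q)" "xD \<in> bspace (Seg p) (Seg q)" "snd xC East = snd xD West"
      "snd (act C xC) East + snd (act D xD) West = 0" "x' = CD.join (xC, xD)"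
      "act (C beside D) x' = CD.join (act C xC, act D xD)" using x(2) by (rule CD.hglueE)
    note mem = bspace_components(1)[OF y(1)] bspace_components(1)[OF y(2)]
      bspace_components(1)[OF y'(1)] bspace_components(1)[OF y'(2)]
    note fmem = bspace_components(1)[OF RQ_mem[OF A y(1)]] bspace_components(1)[OF RQ_mem[OF B y(2)]]
      bspace_components(1)[OF RQ_mem[OF C y'(1)]] bspace_components(1)[OF RQ_mem[OF D y'(2)]]
    have "cat a p (fst xA North, fst xB North) = cat a p (fst xC South, fst xD South)"
      using x(3) by (simp add: y(5) y'(5) AB.join_components CD.join_components)
    then have shared: "fst xA North = fst xC South" "fst xB North = fst xD South"
      using cat_inject[OF mem(1) mem(3) mem(2) mem(4)] by auto
    \<comment> \<open>The flux through the long horizontal line is a concatenation; its vanishing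
      splits into one condition for \<open>A\<close> and \<open>C\<close> and one for
      \<open>B\<close> and \<open>D\<close>.\<close>
    have "cat a p (fst (act A xA) North + fst (act C xC) South, fst (act B xB) North + fst (act D xD) South)
        = cat a p (0, 0)"
      using x(4) by (simp add: y(6) y'(6) AB.join_components CD.join_components cat_zero
          cat_add[OF fmem(1) fmem(3) fmem(2) fmem(4)])
    then have flux: "fst (act A xA) North + fst (act C xC) South = 0"
      "fst (act B xB) North + fst (act D xD) South = 0"
      using cat_inject[OF side_add[OF fmem(1) fmem(3)] side_zero side_add[OF fmem(2) fmem(4)] side_zero]
      by auto
    have AC: "act (A below C) (AC.vjoin (xA, xC)) = AC.vjoin (act A xA, act C xC)"
      by (rule AC.vglueI[OF y(1) y'(1) shared(1) flux(1)])
    have BD: "act (B below D) (BD.vjoin (xB, xD)) = BD.vjoin (act B xB, act D xD)"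
      by (rule BD.vglueI[OF y(2) y'(2) shared(2) flux(2)])
    note fmem2 = bspace_components(2)[OF RQ_mem[OF A y(1)]] bspace_components(2)[OF RQ_mem[OF B y(2)]]
      bspace_components(2)[OF RQ_mem[OF C y'(1)]] bspace_components(2)[OF RQ_mem[OF D y'(2)]]
    \<comment> \<open>Along the vertical line it is the other way round: the two given flux
      conditions are concatenated into one.\<close>
    have "snd (AC.vjoin (act A xA, act C xC)) East + snd (BD.vjoin (act B xB, act D xD)) West = 0"
      using y(4) y'(4) by (simp add: AC.vjoin_components BD.vjoin_components cat_zero
          flip: cat_add[OF fmem2(1) fmem2(2) fmem2(3) fmem2(4)])
    then have "act ((A below C) beside (B below D)) (H.join (AC.vjoin (xA, xC), BD.vjoin (xB, xD)))
        = H.join (AC.vjoin (act A xA, act C xC), BD.vjoin (act B xB, act D xD))"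
      using y y' by (subst H.hglueI) (simp_all add: AC BD AC.vjoin_mem BD.vjoin_mem
          AC.vjoin_components BD.vjoin_components)
    moreover have "V.vjoin (AB.join (u, v), CD.join (u', v')) = H.join (AC.vjoin (u, u'), BD.vjoin (v, v'))"
      for u v u' v'
      by (rule bdry_eqI) (simp_all add: V.vjoin_components H.join_components AB.join_components
          CD.join_components AC.vjoin_components BD.vjoin_components)
    ultimately show "act ((A beside B) below (C beside D)) z = act ((A below C) beside (B below D)) z"
      using x y y' by simp
  qed
qed

subsection \<open>Cancellation\<close>

text \<open>If the second operator couples its West and East sides by an isomorphism (here half the
  identity), every boundary value and flux of the first one can be prescribed from the far side.\<close>

lemma beside_cancel:
  fixes M N B :: "('a::real_inner, 'b::real_inner) shaped_op"
  assumes compl: "complete (UNIV :: 'b set)" and M: "RQ a b M" and N: "RQ a b N" and B: "RQ (Seg p) b B"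
    and BW: "\<And>x. x \<in> bspace (Seg p) b \<Longrightarrow> snd (act B x) West = snd x West + scale_seq (1/2) (snd x East)"
    and BE: "\<And>x. x \<in> bspace (Seg p) b \<Longrightarrow> snd (act B x) East = snd x East + scale_seq (1/2) (snd x West)"
    and eq: "M beside B = N beside B"
  shows "op_agree M N"
proof -
  interpret M: hpair M B a b p using compl M B by unfold_locales
  interpret N: hpair N B a b p using compl N B by unfold_locales
  have join: "N.join = M.join" by (simp add: h_join_def M.shape N.shape)
  have half: "f = g" if "scale_seq (1/2) f = scale_seq (1/2) g" for f g :: "int \<Rightarrow> 'b"
    using that by (simp add: scale_seq_def fun_eq_iff)
  have "act M x = act N x" if x: "x \<in> bspace a b" for x
  proof -
    define y where "y = act M x"
    have y: "y \<in> bspace a b" unfolding y_def by (rule RQ_mem[OF M x])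
    \<comment> \<open>Chosen so that the West flux of \<open>B\<close>, which is the shared value
      plus half of \<open>e\<close>, equals the negative of \<open>snd y East\<close>.\<close>
    define e where "e = scale_seq (- 2) (snd y East + snd x East)"
    have e: "e \<in> side b" unfolding e_def using x y by (intro side_scale side_add bspace_components(2))
    define x' :: "('a, 'b) bdry" where "x' = set_v West (snd x East) (set_v East e 0)"
    have x': "x' \<in> bspace (Seg p) b"
      using e bspace_components(2)[OF x] by (simp add: x'_def bspace_iff opt_side_zero side_zero)
    have flux: "snd y East + snd (act B x') West = 0"
      unfolding BW[OF x'] by (simp add: x'_def e_def scale_seq_def fun_eq_iff)
    let ?z = "M.join (x, x')"
    have z: "?z \<in> bspace (ext_plus a p) b" by (rule M.join_mem[OF x x'])
    have w: "act (N beside B) ?z = M.join (y, act B x')"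
      using M.hglueI[OF x x'] flux unfolding y_def eq[symmetric] by (simp add: x'_def)
    obtain u u' where u: "u \<in> bspace a b" "u' \<in> bspace (Seg p) b" "snd u East = snd u' West"
      "snd (act N u) East + snd (act B u') West = 0" "?z = N.join (u, u')"
      "act (N beside B) ?z = N.join (act N u, act B u')" using z by (rule N.hglueE)
    have Nu: "act N u \<in> bspace a b" by (rule RQ_mem[OF N u(1)])
    note inj = M.join_inject[OF x x' u(1,2) u(5)[unfolded join]]
    note inj' = M.join_inject[OF y RQ_mem[OF B x'] Nu RQ_mem[OF B u(2)], OF trans[OF w[symmetric] u(6)[unfolded join]]]
    \<comment> \<open>Equal East values and equal East fluxes of \<open>B\<close> leave equal halves
      of the West values. The shared value is thus determined by the outer data and outer flux of
      the gluing.\<close>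
    have W: "snd x' West = snd u' West"
      using inj'(4) inj(4) unfolding BE[OF x'] BE[OF u(2)] by - (rule half, simp)
    have "x = u" using inj W u(3) by (intro bdry_eqI) (simp_all add: x'_def)
    moreover have "x' = u'" using inj W by (intro bdry_eqI) simp_all
    ultimately have "snd y East = snd (act N u) East" using flux u(4) by (metis add_right_cancel)
    then have "y = act N u" using inj' by (intro bdry_eqI) simp_all
    then show ?thesis by (simp add: y_def \<open>x = u\<close>)
  qed
  then show ?thesis by (simp add: op_agree_def M.shape N.shape)
qed

subsection \<open>Fixed point equations in blocks\<close>

text \<open>Common form of all four systems of block equations: \<open>hs\<close> is the set of
  horizontal sides present, two for a half-strip and one for the corner. The systems for
  \<open>below\<close> are obtained through \<open>trop\<close>.\<close>

definition h_fix_eqs :: "('k::rc_field, 'a::real_inner) hilbert \<Rightarrow> hside set \<Rightarrow> extent \<Rightarrow>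
    ('a, 'b::real_inner) shaped_op \<Rightarrow> ('a, 'b) shaped_op \<Rightarrow> bool" where
  "h_fix_eqs H hs b M M' \<longleftrightarrow>
    (let Ki = inv_into (side b) (blk_vv M East East + blk_vv M' West West)
     in (\<forall>g \<in> side b. blk_vv M East East g =
           (blk_vv M' East East - (blk_vv M' East West \<circ> Ki \<circ> blk_vv M' West East)) g) \<and>
        (\<forall>s\<in>hs. \<forall>g \<in> side b. blk_hv M s East g =
           DL 1 (col (- (blk_hv M s East \<circ> Ki \<circ> blk_vv M' West East))
                     (blk_hv M' s East - (blk_hv M' s West \<circ> Ki \<circ> blk_vv M' West East)) g)) \<and>
        (\<forall>s\<in>hs. \<forall>s'\<in>hs. \<forall>f \<in> side Half. blk_hh M s s' f =
           DL 1 ((diag (blk_hh M s s') (blk_hh M' s s')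
                  - (col (blk_hv M s East) (blk_hv M' s West) \<circ> Ki
                     \<circ> row (blk_vh M East s') (blk_vh M' West s'))) (DLadj H 1 f))))"

lemma set_h_mem:
  assumes "f \<in> side a" "s = South \<longrightarrow> b \<noteq> Half"
  shows "set_h s f 0 \<in> bspace a b"
  using assms by (cases s) (auto simp: bspace_iff opt_side_zero side_zero opt_side_def)

text \<open>The blocks from a horizontal side to East are not listed, since symmetry determines them
  from the blocks in the opposite direction. West does not occur because the width is
  infinite.\<close>

lemma agree_iff_blocks:
  fixes M N :: "('a::real_inner, 'b::real_inner) shaped_op"
  assumes M: "RQ Half b M" and N: "RQ Half b N" and hs: "hs = (if b = Half then {North} else UNIV)"
  shows "op_agree N M \<longleftrightarrow>
    (\<forall>g\<in>side b. blk_vv N East East g = blk_vv M East East g) \<and>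
    (\<forall>s\<in>hs. \<forall>g\<in>side b. blk_hv N s East g = blk_hv M s East g) \<and>
    (\<forall>s\<in>hs. \<forall>s'\<in>hs. \<forall>f\<in>side Half. blk_hh N s s' f = blk_hh M s s' f)"
  (is "_ \<longleftrightarrow> ?R")
proof
  have hs_mem: "(set_h s f 0 :: ('a, 'b) bdry) \<in> bspace Half b" if "s \<in> hs" "f \<in> side Half" for s f
    using that by (intro set_h_mem) (auto simp: hs split: if_splits)
  have shape: "width M = Half" "height M = b" "width N = Half" "height N = b"
    using M N by (simp_all add: RQ_def)
  show ?R if "op_agree N M"
    using that hs_mem
    by (auto simp: op_agree_def shape blk_vv_def blk_hv_def blk_hh_def set_East_mem)
  assume R: ?R
  have West: "snd x West = 0" if "x \<in> bspace Half b" for x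
    using that by (simp add: bspace_iff opt_side_def)
  have South: "fst x South = 0" if "x \<in> bspace Half b" "South \<notin> hs" for x
    using that by (auto simp: bspace_iff opt_side_def hs split: if_splits)
  have East_eq: "act N (set_v East g 0) = act M (set_v East g 0)" if g: "g \<in> side b" for g
  proof -
    note mN = RQ_mem[OF N set_East_mem[OF g]] and mM = RQ_mem[OF M set_East_mem[OF g]]
    have "fst (act N (set_v East g 0)) s = fst (act M (set_v East g 0)) s" if "s \<in> hs" for s
      using R g that by (auto simp: blk_hv_def)
    then show ?thesis
      using R g South[OF mN] South[OF mM] West[OF mN] West[OF mM]
      by (intro bdry_eqI) (auto simp: blk_vv_def hs split: if_splits)
  qed
  have hs_eq: "act N (set_h s' f 0) = act M (set_h s' f 0)" if s': "s' \<in> hs" "f \<in> side Half" for s' f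
  proof -
    note mem = hs_mem[OF s']
    note mN = RQ_mem[OF N mem] and mM = RQ_mem[OF M mem]
    have "fst (act N (set_h s' f 0)) s = fst (act M (set_h s' f 0)) s" for s
    proof (cases "s \<in> hs")
      case True
      then show ?thesis using R s' by (auto simp: blk_hh_def)
    next
      case False
      then have "s = South" by (cases s) (auto simp: hs split: if_splits)
      with False show ?thesis using South[OF mN] South[OF mM] by simp
    qed
    moreover have "snd (act N (set_h s' f 0)) East = snd (act M (set_h s' f 0)) East"
    \<comment> \<open>Tested against East data, symmetry moves the operators onto
      \<open>set_v East g 0\<close>, where they are already known to agree.\<close>
    proof (rule side.form_eqI[of _ b])
      show "snd (act N (set_h s' f 0)) East \<in> side b" "snd (act M (set_h s' f 0)) East \<in> side b"
        using bspace_components(2)[OF mN] bspace_components(2)[OF mM] by simp_all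
      fix g :: "int \<Rightarrow> 'b" assume g: "g \<in> side b"
      note gm = set_East_mem[OF g, of Half]
      have "rbip (act N (set_h s' f 0)) (set_v East g 0) = rbip (act M (set_h s' f 0)) (set_v East g 0)"
        by (simp only: RQ_symD[OF N mem gm] RQ_symD[OF M mem gm] East_eq[OF g])
      then show "rip (snd (act N (set_h s' f 0)) East) g = rip (snd (act M (set_h s' f 0)) East) g"
        by (simp add: rbip_set_v)
    qed
    ultimately show ?thesis
      using West[OF mN] West[OF mM] by (intro bdry_eqI) simp_all
  qed
  have "act N z = act M z" if z: "z \<in> bspace Half b" for z
  proof -
    let ?e = "set_v East (snd z East) 0 :: ('a, 'b) bdry" and ?n = "set_h North (fst z North) 0 :: ('a, 'b) bdry"
      and ?s = "set_h South (fst z South) 0 :: ('a, 'b) bdry"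
    have e: "?e \<in> bspace Half b" and n: "?n \<in> bspace Half b"
      using z by (auto simp: bspace_iff opt_side_zero side_zero)
    have s: "?s \<in> bspace Half b"
      using z by (auto simp: bspace_iff opt_side_zero side_zero)
    have split: "z = ?e + ?n + ?s"
      using West[OF z] by (intro bdry_eqI) simp_all
    have "act N ?n = act M ?n"
      using z by (intro hs_eq) (auto simp: hs bspace_iff)
    moreover have "act N ?s = act M ?s"
    proof (cases "South \<in> hs")
      case True
      then show ?thesis using bspace_components(1)[OF z] by (intro hs_eq)
    next
      case False
      then have "?s = 0" using South[OF z] by (intro bdry_eqI) simp_all
      then show ?thesis by (simp only: RQ_zero[OF M] RQ_zero[OF N])
    qed
    moreover have "act N ?e = act M ?e" using bspace_components(2)[OF z] by (rule East_eq)
    ultimately have "act N (?e + ?n + ?s) = act M (?e + ?n + ?s)"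
      by (simp only: RQ_add[OF N] RQ_add[OF M] e n s bs.add_mem[OF e n])
    then show ?thesis by (simp only: split[symmetric])
  qed
  then show "op_agree N M" by (simp add: op_agree_def shape)
qed

section \<open>The adjoint of \<open>DL\<close> and the blocks of a gluing\<close>

context fd_hilbert
begin

lemma sip_eqI:
  assumes "x \<in> side a" "y \<in> side a" "\<And>u. u \<in> side a \<Longrightarrow> sip H u x = sip H u y"
  shows "x = y"
proof (rule side.form_eqI[of _ a])
  fix z :: "int \<Rightarrow> 'h" assume "z \<in> side a"
  then show "rip x z = rip y z"
    using assms rc_re_sip[of z x] rc_re_sip[of z y] by (simp add: side_l2[of _ a] rip_commute[of _ z])
qed (use assms in auto)

lemma adjoint_on_eqI:
  assumes "x \<in> side a" "\<And>u. u \<in> side a \<Longrightarrow> ipV (T u) y = sip H u x"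
  shows "adjoint_on (sip H) (side a) ipV T y = x"
  unfolding adjoint_on_def using assms by (intro the_equality) (auto intro: sip_eqI)

text \<open>\<open>DL p\<close> preserves inner products, so its adjoint is a left inverse.
  Uniqueness for \<open>THE\<close> follows by testing against pairs \<open>(u, 0)\<close> and
  \<open>(0, v)\<close> separately.\<close>

lemma DLadj_DL:
  assumes w: "w \<in> side Half" and h: "h \<in> side (Seg p)"
  shows "DLadj H p (DL p (w, h)) = (w, h)"
proof -
  have DL: "sip H (DL p (u, v)) (DL p (w, h)) = sip H u w + sip H v h"
    if "u \<in> side Half" "v \<in> side (Seg p)" for u v
    using bsum_cat[OF bounded_bilinear_ip that(1) w that(2) h] by (simp add: sip_eq_bsum)
  have z: "sip H 0 f = 0" for f by (simp add: sip_eq_bsum bsum_0[OF bounded_bilinear_ip])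
  show ?thesis
    unfolding DLadj_def adjoint_on_def
  proof (rule the_equality, use w h in \<open>simp add: DL\<close>, clarify)
    fix w' h' assume mem: "w' \<in> side Half" "h' \<in> side (Seg p)"
      and eq: "\<forall>u\<in>side Half \<times> side (Seg p). sip H (DL p u) (DL p (w, h)) =
        (case u of (w, h) \<Rightarrow> \<lambda>(w', h'). sip H w w' + sip H h h') (w', h')"
    have eq': "sip H u w + sip H v h = sip H u w' + sip H v h'"
      if "u \<in> side Half" "v \<in> side (Seg p)" for u v
      using bspec[OF eq, of "(u, v)"] that by (simp add: DL)
    have "w' = w" using eq'[OF _ side_zero] by (intro sip_eqI[OF mem(1) w]) (simp add: z)
    moreover have "h' = h" using eq'[OF side_zero] by (intro sip_eqI[OF mem(2) h]) (simp add: z)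
    ultimately show "w' = w \<and> h' = h" ..
  qed
qed

text \<open>The blocks of \<open>M beside M'\<close> come from \<open>act_beside\<close>: East data
  live on \<open>M'\<close> alone, and horizontal data on the half-line split through
  \<open>DL 1\<close> into one part for each operand. Equating them with the blocks of
  \<open>M\<close> is the system itself.\<close>

lemma h_fix_eqs_iff:
  fixes M M' :: "('h, 'b::real_inner) shaped_op"
  assumes "hpair M M' Half b 1" and hs: "hs = (if b = Half then {North} else UNIV)"
  shows "op_agree (M beside M') M \<longleftrightarrow> h_fix_eqs H hs b M M'"
proof -
  interpret hpair M M' Half b 1 by fact
  let ?N = "M beside M'" and ?Ki = "inv_into (side b) L"
  have N: "RQ Half b ?N" using RQ_beside by simp
  have E: "act ?N (set_v East g 0) = join (- act M (set_v East (?Ki (blk_vv M' West East g)) 0),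
      act M' (set_v East g 0) - act M' (set_v West (?Ki (blk_vv M' West East g)) 0))"
    if g: "g \<in> side b" for g
  proof -
    have "act ?N (join (0, set_v East g 0)) = join (act M 0 - act M (set_v East
        (?Ki (snd (act M 0) East + snd (act M' (set_v East g 0)) West)) 0),
      act M' (set_v East g 0) - act M' (set_v West
        (?Ki (snd (act M 0) East + snd (act M' (set_v East g 0)) West)) 0))"
      using g by (intro act_beside) (simp_all add: bs.zero_mem set_East_mem)
    moreover have "join (0, set_v East g 0) = set_v East g 0"
      by (rule bdry_eqI) (simp_all add: join_components cat_zero del: cat.simps)
    ultimately show ?thesis by (simp add: RQ_zero[OF M] blk_vv_def)
  qed
  have S: "act ?N (set_h s (DL 1 (u, h)) 0) =
      join (act M (set_h s u 0) - act M (set_v East (?Ki (blk_vh M East s u + blk_vh M' West s h)) 0),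
        act M' (set_h s h 0) - act M' (set_v West (?Ki (blk_vh M East s u + blk_vh M' West s h)) 0))"
    if s: "s \<in> hs" and u: "u \<in> side Half" and h: "h \<in> side (Seg 1)" for s u h
  proof -
    have "s = South \<longrightarrow> b \<noteq> Half" using s by (auto simp: hs split: if_splits)
    then have "act ?N (join (set_h s u 0, set_h s h 0)) =
      join (act M (set_h s u 0) - act M (set_v East (?Ki (blk_vh M East s u + blk_vh M' West s h)) 0),
        act M' (set_h s h 0) - act M' (set_v West (?Ki (blk_vh M East s u + blk_vh M' West s h)) 0))"
      unfolding blk_vh_def using u h by (intro act_beside set_h_mem) simp_all
    moreover have "join (set_h s u 0, set_h s h 0) = set_h s (DL 1 (u, h)) 0"
      using cat_zero[of Half 1]
      by (cases s; intro bdry_eqI) (simp_all add: join_components)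
    ultimately show ?thesis by simp
  qed
  have vv: "blk_vv ?N East East g =
      (blk_vv M' East East - (blk_vv M' East West \<circ> ?Ki \<circ> blk_vv M' West East)) g"
    if "g \<in> side b" for g
    using E[OF that] by (simp add: blk_vv_def[of ?N] join_components) (simp add: blk_vv_def)
  have hv: "blk_hv ?N s East g =
      DL 1 (col (- (blk_hv M s East \<circ> ?Ki \<circ> blk_vv M' West East))
                     (blk_hv M' s East - (blk_hv M' s West \<circ> ?Ki \<circ> blk_vv M' West East)) g)"
    if "g \<in> side b" for s g
    using E[OF that] by (simp add: blk_hv_def[of ?N] join_components) (simp add: blk_hv_def col_def)
  have hh: "blk_hh ?N s s' f = DL 1 ((diag (blk_hh M s s') (blk_hh M' s s')
                  - (col (blk_hv M s East) (blk_hv M' s West) \<circ> ?Ki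
                     \<circ> row (blk_vh M East s') (blk_vh M' West s'))) (DLadj H 1 f))"
    if s': "s' \<in> hs" and f: "f \<in> side Half" for s s' f
  proof -
    obtain u h where uh: "u \<in> side Half" "h \<in> side (Seg 1)" "f = DL 1 (u, h)"
      using cat_surj[of f Half 1] f by auto
    show ?thesis
      using S[OF s' uh(1,2)] unfolding uh(3) DLadj_DL[OF uh(1,2)]
      by (simp add: blk_hh_def[of ?N] join_components)
         (simp add: diag_def col_def row_def blk_hh_def blk_hv_def)
  qed
  show ?thesis
    unfolding agree_iff_blocks[OF M N hs] h_fix_eqs_def Let_def
    by (intro arg_cong2[of _ _ _ _ "(\<and>)"] ball_cong refl) (metis vv hv hh)+
qed

end

subsection \<open>Membership in the spaces of positive operators\<close>

lemma rbip_le: 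
  assumes "x \<in> bspace a b" "y \<in> bspace a b"
  shows "2 * rbip x y \<le> rbip x x + rbip y y"
  using bs.form_nonneg[OF bs.diff_mem[OF assms]] assms
  by (simp add: bs.form_diff_left[of _ a b] bs.form_diff_right[of _ a b] bs.diff_mem
      bs.form_commute[of y a b x])

lemma rip_bounds:
  assumes "f \<in> side a" "g \<in> side a"
  shows "2 * rip f g \<le> rip f f + rip g g" and "- (2 * rip f g) \<le> rip f f + rip g g"
proof -
  note mem = assms side_add[OF assms] side_diff[OF assms]
  show "2 * rip f g \<le> rip f f + rip g g"
    using rip_nonneg[of "f - g"] mem rip_commute[of g f]
    by (simp add: side.form_diff_left[of _ a] side.form_diff_right[of _ a])
  show "- (2 * rip f g) \<le> rip f f + rip g g"
    using rip_nonneg[of "f + g"] mem rip_commute[of g f]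
    by (simp add: side.form_add_left[of _ a] side.form_add_right[of _ a])
qed

fun hflip :: "hside \<Rightarrow> hside" where
  "hflip South = North" | "hflip North = South"

fun vflip :: "vside \<Rightarrow> vside" where
  "vflip West = East" | "vflip East = West"

text \<open>Test operators for the cancellation lemmas. A coefficient must be 0 in a direction where
  one of the two opposite sides is absent, since the exchange would leave the carrier there.\<close>

definition coupling :: "real \<Rightarrow> real \<Rightarrow> extent \<Rightarrow> extent \<Rightarrow> ('a::real_inner, 'b::real_inner) shaped_op" where
  "coupling \<alpha> \<beta> a b = Shaped_op a b (\<lambda>z\<in>bspace a b.
     (\<lambda>s. fst z s + scale_seq \<alpha> (fst z (hflip s)), \<lambda>t. snd z t + scale_seq \<beta> (snd z (vflip t))))"

locale hilbert_pair = A: fd_hilbert H1 + B: fd_hilbert H2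
  for H1 :: "('k::rc_field, 'a::real_inner) hilbert" and H2 :: "('k, 'b::real_inner) hilbert"
begin

lemma complete_A: "complete (UNIV :: 'a set)"
  using A.real_span_finite complete_finite_span by blast

lemma complete_B: "complete (UNIV :: 'b set)"
  using B.real_span_finite complete_finite_span by blast

lemma bip_eq: "bip H1 H2 x y = sip H1 (fst x South) (fst y South) + sip H1 (fst x North) (fst y North)
    + (sip H2 (snd x West) (snd y West) + sip H2 (snd x East) (snd y East))"
  by (simp add: bip_def)

lemma rc_re_bip:
  assumes "x \<in> bspace a b" "y \<in> bspace a b"
  shows "rc_re (bip H1 H2 x y) = rbip x y"
  using assms[THEN bspace_components(1), THEN side_l2] assms[THEN bspace_components(2), THEN side_l2]
  by (simp add: bip_eq linear_add[OF bounded_linear.linear[OF bounded_linear_rc_re]]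
      A.rc_re_sip B.rc_re_sip rbip_def)

lemma bnorm_sq: "x \<in> bspace a b \<Longrightarrow> (bnorm H1 H2 x)\<^sup>2 = rbip x x"
  by (simp add: bnorm_def rc_re_bip bs.form_nonneg)

lemma self_adjoint_sym:
  assumes "self_adjoint_op H1 H2 a b M"
  shows "sym_op (bspace a b) rbip (act M)"
  unfolding sym_op_def
proof (intro conjI ballI)
  fix x y :: "('a, 'b) bdry" assume xy: "x \<in> bspace a b" "y \<in> bspace a b"
  have mem: "act M z \<in> bspace a b" if "z \<in> bspace a b" for z
    using assms that by (auto simp: self_adjoint_op_def)
  then show "act M x \<in> bspace a b" using xy by simp
  have "bip H1 H2 (act M x) y = bip H1 H2 x (act M y)"
    using assms xy by (simp add: self_adjoint_op_def)
  then show "rbip (act M x) y = rbip x (act M y)"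
    using xy mem by (metis rc_re_bip)
qed

lemma Qset_RQ:
  assumes "M \<in> Qset H1 H2 a b"
  shows "RQ a b M"
proof -
  have sa: "self_adjoint_op H1 H2 a b M" using assms by (simp add: Qset_def)
  note sym = self_adjoint_sym[OF sa]
  then have mem: "x \<in> bspace a b \<Longrightarrow> act M x \<in> bspace a b" for x by (simp add: sym_op_def)
  obtain C c where C: "\<And>x. x \<in> bspace a b \<Longrightarrow> bnorm H1 H2 (act M x) \<le> C * bnorm H1 H2 x"
    and c: "c > 0" "\<And>x. x \<in> bspace a b \<Longrightarrow> c * rc_re (bip H1 H2 x x) \<le> rc_re (bip H1 H2 x (act M x))"
    using assms by (auto simp: Qset_def)
  \<comment> \<open>From \<open>2 <M x, x> <= |M x|^2 + |x|^2\<close>, the norm bound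
    \<open>C\<close> yields the form bound \<open>(C^2 + 1) / 2\<close>.\<close>
  have "c * rbip x x \<le> rbip (act M x) x \<and> rbip (act M x) x \<le> (C\<^sup>2 + 1) / 2 * rbip x x"
    if x: "x \<in> bspace a b" for x
  proof
    show "c * rbip x x \<le> rbip (act M x) x"
      using c(2)[OF x] x mem[OF x] by (simp add: rc_re_bip bs.form_commute[of "act M x" a b])
    have "(bnorm H1 H2 (act M x))\<^sup>2 \<le> (C * bnorm H1 H2 x)\<^sup>2"
      using C[OF x] mem[OF x] by (intro power_mono) (simp_all add: bnorm_def rc_re_bip bs.form_nonneg)
    then have "rbip (act M x) (act M x) \<le> C\<^sup>2 * rbip x x"
      by (simp add: power_mult_distrib bnorm_sq[OF x] bnorm_sq[OF mem[OF x]])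
    then show "rbip (act M x) x \<le> (C\<^sup>2 + 1) / 2 * rbip x x"
      using rbip_le[OF mem[OF x] x] by (simp add: field_simps)
  qed
  then show ?thesis
    using sa sym c(1) unfolding RQ_def coercive_op_def self_adjoint_op_def by blast
qed

lemma Qset_ext: "M \<in> Qset H1 H2 a b \<Longrightarrow> ext_op M"
  by (auto simp: Qset_def self_adjoint_op_def PiE_def)

lemma smult_add: "smult H1 c (x + y) = smult H1 c x + smult H1 c y"
  "smult H2 c (u + v) = smult H2 c u + smult H2 c v"
  using A.finite_dim B.finite_dim
  by (auto simp: finite_dimensional_vector_space_def vector_space_def)

lemma smult_scaleR: "smult H1 c (r *\<^sub>R x) = r *\<^sub>R smult H1 c x"
  "smult H2 c (r *\<^sub>R u) = r *\<^sub>R smult H2 c u"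
proof -
  have "smult H1 c (smult H1 d x) = smult H1 (c * d) x" "smult H2 c (smult H2 d u) = smult H2 (c * d) u" for c d
    using A.finite_dim B.finite_dim
    by (auto simp: finite_dimensional_vector_space_def vector_space_def)
  then show "smult H1 c (r *\<^sub>R x) = r *\<^sub>R smult H1 c x" "smult H2 c (r *\<^sub>R u) = r *\<^sub>R smult H2 c u"
    by (metis A.smult_of_real mult.commute, metis B.smult_of_real mult.commute)
qed

lemma smult_side:
  "f \<in> side a \<Longrightarrow> (\<lambda>k. smult H1 c (f k)) \<in> side a"
  "g \<in> side a \<Longrightarrow> (\<lambda>k. smult H2 c (g k)) \<in> side a"
  using smult_scaleR(1)[of c 0 0] smult_scaleR(2)[of c 0 0]
  by (auto simp: side_def A.norm_smult B.norm_smult power_mult_distrib intro: summable_on_cmult_right)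

lemma bscale_mem: "x \<in> bspace a b \<Longrightarrow> bscale H1 H2 c x \<in> bspace a b"
  using smult_scaleR(1)[of c 0 0] smult_scaleR(2)[of c 0 0]
  by (auto simp: bspace_iff bscale_def opt_side_def smult_side fun_eq_iff split: if_splits)

lemma coupling_Qset:
  assumes \<alpha>: "\<alpha> = 0 \<or> \<alpha> = 1/2 \<and> b \<noteq> Half" and \<beta>: "\<beta> = 0 \<or> \<beta> = 1/2 \<and> a \<noteq> Half"
  shows "coupling \<alpha> \<beta> a b \<in> Qset H1 H2 a b"
proof -
  let ?M = "coupling \<alpha> \<beta> a b :: ('a, 'b) shaped_op"
  have M: "fst (act ?M x) s = fst x s + scale_seq \<alpha> (fst x (hflip s))"
    "snd (act ?M x) t = snd x t + scale_seq \<beta> (snd x (vflip t))" if "x \<in> bspace a b" for x s t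
    using that by (simp_all add: coupling_def)
  have scale0: "scale_seq 0 f = 0" "scale_seq r 0 = 0" for f :: "int \<Rightarrow> 'c::real_inner" and r
    by (simp_all add: scale_seq_def fun_eq_iff)
  have mem: "act ?M x \<in> bspace a b" if x: "x \<in> bspace a b" for x
    using x \<alpha> \<beta> unfolding bspace_iff[of "act ?M x"] M[OF x]
    by (auto simp: bspace_iff opt_side_def scale0 side_zero side_scale intro!: side_add side_scale split: if_splits)
  note c = bspace_components
  have "bip H1 H2 (act ?M x) y = bip H1 H2 x (act ?M y)" if x: "x \<in> bspace a b" and y: "y \<in> bspace a b" for x y
    using x[THEN c(1), THEN side_l2] y[THEN c(1), THEN side_l2] x[THEN c(2), THEN side_l2] y[THEN c(2), THEN side_l2]
    by (simp add: bip_eq M[OF x] M[OF y] sip_eq_bsum l2_scale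
        bsum_add_left[OF A.bounded_bilinear_ip] bsum_add_right[OF A.bounded_bilinear_ip]
        bsum_add_left[OF B.bounded_bilinear_ip] bsum_add_right[OF B.bounded_bilinear_ip]
        bsum_scale_left[OF A.bounded_bilinear_ip] bsum_scale_right[OF A.bounded_bilinear_ip]
        bsum_scale_left[OF B.bounded_bilinear_ip] bsum_scale_right[OF B.bounded_bilinear_ip])
  moreover have "act ?M (x + y) = act ?M x + act ?M y" if "x \<in> bspace a b" "y \<in> bspace a b" for x y
    using that by (intro bdry_eqI) (simp_all add: M bs.add_mem, simp_all add: scale_seq_def fun_eq_iff scaleR_right_distrib)
  moreover have "act ?M (bscale H1 H2 d x) = bscale H1 H2 d (act ?M x)" if "x \<in> bspace a b" for x d
    using that
    by (intro bdry_eqI) (simp_all add: M bscale_mem bscale_def[of _ _ _ "act ?M x"],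
        simp_all add: bscale_def scale_seq_def fun_eq_iff smult_add smult_scaleR)
  moreover have "act ?M \<in> bspace a b \<rightarrow>\<^sub>E bspace a b"
    using mem by (auto simp: PiE_def) (simp add: coupling_def)
  ultimately have sa: "self_adjoint_op H1 H2 a b ?M"
    by (simp add: self_adjoint_op_def) (simp add: coupling_def)
  \<comment> \<open>The norm of the operator is at most 3/2; the constant 4 is the square of the
    cruder bound 2 in \<open>upper\<close>.\<close>
  have form: "1/2 * rbip x x \<le> rbip x (act ?M x)" "rbip (act ?M x) (act ?M x) \<le> 4 * rbip x x"
    if x: "x \<in> bspace a b" for x
  proof -
    note mem = x[THEN c(1), THEN side_l2] x[THEN c(2), THEN side_l2]
    have 1: "rbip x (act ?M x) = rbip x x + 2 * \<alpha> * rip (fst x South) (fst x North)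
        + 2 * \<beta> * rip (snd x West) (snd x East)"
      using mem by (simp add: rbip_def M[OF x] bsum_add_right[OF bounded_bilinear_inner] rip_scale_right l2_scale
          rip_commute[of "fst x North" "fst x South"] rip_commute[of "snd x East" "snd x West"])
    have 2: "rbip (act ?M x) (act ?M x) = (1 + \<alpha>\<^sup>2) * rip (fst x South) (fst x South)
        + (1 + \<alpha>\<^sup>2) * rip (fst x North) (fst x North) + (1 + \<beta>\<^sup>2) * rip (snd x West) (snd x West)
        + (1 + \<beta>\<^sup>2) * rip (snd x East) (snd x East)
        + 4 * \<alpha> * rip (fst x South) (fst x North) + 4 * \<beta> * rip (snd x West) (snd x East)"
      using mem by (simp add: rbip_def M[OF x] bsum_add_right[OF bounded_bilinear_inner] rip_add_left
          rip_scale_right rip_scale_left l2_scale l2_add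
          rip_commute[of "fst x North" "fst x South"] rip_commute[of "snd x East" "snd x West"]
          algebra_simps power2_eq_square)
    note b1 = rip_bounds[OF c(1)[OF x, of South] c(1)[OF x, of North]]
      and b2 = rip_bounds[OF c(2)[OF x, of West] c(2)[OF x, of East]]
      and nn = rip_nonneg[of "fst x South"] rip_nonneg[of "fst x North"]
        rip_nonneg[of "snd x West"] rip_nonneg[of "snd x East"]
    have \<alpha>': "\<alpha> = 0 \<or> \<alpha> = 1/2" and \<beta>': "\<beta> = 0 \<or> \<beta> = 1/2" using \<alpha> \<beta> by auto
    show "1/2 * rbip x x \<le> rbip x (act ?M x)"
      unfolding 1 using \<alpha>' \<beta>'
      by (elim disjE; hypsubst; use b1 b2 nn in \<open>simp add: rbip_def\<close>)
    show "rbip (act ?M x) (act ?M x) \<le> 4 * rbip x x"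
      unfolding 2 using \<alpha>' \<beta>'
      by (elim disjE; hypsubst; use b1 b2 nn in \<open>simp add: rbip_def power2_eq_square\<close>)
  qed
  have upper: "bnorm H1 H2 (act ?M x) \<le> 2 * bnorm H1 H2 x" if x: "x \<in> bspace a b" for x
  proof (rule power2_le_imp_le)
    show "(bnorm H1 H2 (act ?M x))\<^sup>2 \<le> (2 * bnorm H1 H2 x)\<^sup>2"
      using form(2)[OF x] by (simp add: power_mult_distrib bnorm_sq[OF x] bnorm_sq[OF mem[OF x]])
    show "0 \<le> 2 * bnorm H1 H2 x" by (simp add: bnorm_def rc_re_bip[OF x x] bs.form_nonneg[OF x])
  qed
  have lower: "1/2 * rc_re (bip H1 H2 x x) \<le> rc_re (bip H1 H2 x (act ?M x))" if "x \<in> bspace a b" for x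
    using form(1)[OF that] that by (simp add: rc_re_bip mem)
  show ?thesis
    unfolding Qset_def
    using sa upper lower by (intro CollectI conjI exI[of _ 2] exI[of _ "1/2"] ballI) simp_all
qed

text \<open>Supplies the clause of both corner systems that makes one off-diagonal block the adjoint
  of the other: self-adjointness is tested on data supported on a single side each.\<close>

lemma adjoint_blocks:
  assumes M: "M \<in> Qset H1 H2 Half Half"
  shows "g \<in> side Half \<Longrightarrow> adjoint_on (sip H1) (side Half) (sip H2) (blk_vh M East North) g = blk_hv M North East g"
    and "f \<in> side Half \<Longrightarrow> adjoint_on (sip H2) (side Half) (sip H1) (blk_hv M North East) f = blk_vh M East North f"
proof -
  have sa: "bip H1 H2 (act M x) y = bip H1 H2 x (act M y)" if "x \<in> bspace Half Half" "y \<in> bspace Half Half" for x y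
    using M that by (simp add: Qset_def self_adjoint_op_def)
  note mem = RQ_mem[OF Qset_RQ[OF M]]
  have n: "set_h North f 0 \<in> bspace Half Half" and e: "set_v East g 0 \<in> bspace Half Half"
    if "f \<in> side Half" "g \<in> side Half" for f :: "int \<Rightarrow> 'a" and g :: "int \<Rightarrow> 'b"
    using that by (auto intro: set_h_mem set_East_mem)
  note z = bsum_0[OF A.bounded_bilinear_ip, folded sip_eq_bsum] bsum_0[OF B.bounded_bilinear_ip, folded sip_eq_bsum]
  have 1: "sip H2 (blk_vh M East North f) g = sip H1 f (blk_hv M North East g)"
    and 2: "sip H1 (blk_hv M North East g) f = sip H2 g (blk_vh M East North f)"
    if "f \<in> side Half" "g \<in> side Half" for f g
    using sa[OF n[OF that] e[OF that]] sa[OF e[OF that] n[OF that]]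
    by (simp_all add: bip_eq z blk_vh_def blk_hv_def)
  show "adjoint_on (sip H1) (side Half) (sip H2) (blk_vh M East North) g = blk_hv M North East g"
    if g: "g \<in> side Half"
    using 1[OF _ g] bspace_components(1)[OF mem[OF e[OF side_zero g]]]
    by (intro A.adjoint_on_eqI) (simp_all add: blk_hv_def)
  show "adjoint_on (sip H2) (side Half) (sip H1) (blk_hv M North East) f = blk_vh M East North f"
    if f: "f \<in> side Half"
    using 2[OF f] bspace_components(2)[OF mem[OF n[OF f side_zero]]]
    by (intro B.adjoint_on_eqI) (simp_all add: blk_vh_def)
qed

end

section \<open>Coercivity of face operators\<close>

lemma finite_span_prod:
  fixes S :: "'v::real_vector set" and T :: "'w::real_vector set"
  assumes "finite S" "span S = UNIV" "finite T" "span T = UNIV"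
  shows "\<exists>U. finite U \<and> span U = (UNIV :: ('v \<times> 'w) set)"
proof (intro exI conjI)
  let ?f = "\<lambda>x::'v. (x, 0::'w)" and ?g = "\<lambda>y::'w. (0::'v, y)"
  show "finite (?f ` S \<union> ?g ` T)" using assms by simp
  have lin: "linear ?f" "linear ?g" by (auto intro!: linearI)
  have "(x, y) \<in> span (?f ` S \<union> ?g ` T)" for x y
  proof -
    have "?f x \<in> span (?f ` S)" "?g y \<in> span (?g ` T)"
      using assms by (simp_all add: linear_span_image lin)
    then have "?f x \<in> span (?f ` S \<union> ?g ` T)" "?g y \<in> span (?f ` S \<union> ?g ` T)"
      using span_mono[of "?f ` S" "?f ` S \<union> ?g ` T"] span_mono[of "?g ` T" "?f ` S \<union> ?g ` T"] by auto
    from span_add[OF this] show ?thesis by simp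
  qed
  then show "span (?f ` S \<union> ?g ` T) = UNIV" by auto
qed

lemma symmetric_imp_linear:
  fixes T :: "'v::real_inner \<Rightarrow> 'v"
  assumes sym: "\<And>x y. inner (T x) y = inner x (T y)"
  shows "linear T"
proof (rule linearI)
  have "\<forall>z. inner (T (x + y)) z = inner (T x + T y) z" for x y
    by (simp add: sym inner_add_left)
  then show "T (x + y) = T x + T y" for x y by (simp only: vector_eq_rdot)
  have "\<forall>z. inner (T (r *\<^sub>R x)) z = inner (r *\<^sub>R T x) z" for r x
    by (simp add: sym)
  then show "T (r *\<^sub>R x) = r *\<^sub>R T x" for r x by (simp only: vector_eq_rdot)
qed

definition pt :: "'h \<Rightarrow> int \<Rightarrow> 'h::real_inner" where
  "pt h = (\<lambda>k. if k = 1 then h else 0)"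

lemma pt_mem: "pt h \<in> side (Seg 1)"
proof -
  have "(\<lambda>k. (norm (pt h k))\<^sup>2) summable_on UNIV \<longleftrightarrow> (\<lambda>k. (norm (pt h k))\<^sup>2) summable_on {1}"
    by (rule summable_on_cong_neutral) (auto simp: pt_def)
  then show ?thesis by (simp add: side_def) (simp add: pt_def)
qed

lemma rip_pt: "rip (pt u) (pt v) = inner u v"
proof -
  have "rip (pt u) (pt v) = (\<Sum>\<^sub>\<infinity>k\<in>{1}. inner (pt u k) (pt v k))"
    unfolding bsum_def by (rule infsum_cong_neutral) (auto simp: pt_def)
  then show ?thesis by (simp add: pt_def)
qed

lemma side_pt: "f \<in> side (Seg 1) \<Longrightarrow> pt (f 1) = f"
  by (auto simp: side_def pt_def fun_eq_iff)

text \<open>\<open>pos_def_coercive\<close> speaks about a whole type. Boundary data of the unit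
  square are therefore identified with a product type, whose inner product corresponds to
  \<open>rbip\<close>.\<close>

definition emb :: "'a \<times> 'a \<times> 'b \<times> 'b \<Rightarrow> ('a::real_inner, 'b::real_inner) bdry" where
  "emb = (\<lambda>(s, n, w, e). (\<lambda>d. case d of South \<Rightarrow> pt s | North \<Rightarrow> pt n,
                          \<lambda>d. case d of West \<Rightarrow> pt w | East \<Rightarrow> pt e))"

definition proj :: "('a::real_inner, 'b::real_inner) bdry \<Rightarrow> 'a \<times> 'a \<times> 'b \<times> 'b" where
  "proj x = (fst x South 1, fst x North 1, snd x West 1, snd x East 1)"

lemma emb_mem: "emb u \<in> bspace (Seg 1) (Seg 1)"
  by (cases u) (simp add: emb_def bspace_iff pt_mem del: One_nat_def)

lemma emb_proj: "x \<in> bspace (Seg 1) (Seg 1) \<Longrightarrow> emb (proj x) = x"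
  by (intro bdry_eqI) (auto simp: emb_def proj_def bspace_iff intro: side_pt)

lemma rbip_emb: "rbip (emb u) (emb v) = inner u v"
  by (cases u; cases v) (simp add: emb_def rbip_def rip_pt inner_prod_def)

context hilbert_pair
begin

text \<open>Positive definiteness becomes a uniform bound by finite dimension, through the copy
  \<open>T\<close> of the operator on the product type.\<close>

lemma face_RQ:
  assumes Q: "face_operator H1 H2 Q"
  shows "RQ (Seg 1) (Seg 1) Q"
proof -
  \<comment> \<open>Keeps \<open>Seg 1\<close> from being rewritten to
    \<open>Seg (Suc 0)\<close>.\<close>
  note One_nat_def [simp del]
  let ?S = "bspace (Seg 1) (Seg 1) :: ('a, 'b) bdry set"
  have sa: "self_adjoint_op H1 H2 (Seg 1) (Seg 1) Q" using Q by (simp add: face_operator_def)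
  note sym = self_adjoint_sym[OF sa]
  have mem: "x \<in> ?S \<Longrightarrow> act Q x \<in> ?S" for x using sym by (simp add: sym_op_def)
  define T where "T = (\<lambda>u. proj (act Q (emb u)))"
  have T: "inner (T u) v = rbip (act Q (emb u)) (emb v)" for u v
    unfolding T_def rbip_emb[symmetric] emb_proj[OF mem[OF emb_mem]] ..
  have T_sym: "inner (T u) v = inner u (T v)" for u v
    using sym unfolding inner_commute[of u] T
    by (simp add: sym_op_def emb_mem mem bs.form_commute[of "emb u" "Seg 1" "Seg 1"])
  have T_pos: "inner (T u) u > 0" if "u \<noteq> 0" for u
  proof -
    have "emb u \<noteq> 0"
      using that rbip_emb[of u u] bs.form_zero_left[OF emb_mem[of u]] by auto
    then have "0 < rc_re (bip H1 H2 (emb u) (act Q (emb u)))"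
      using Q emb_mem[of u] by (simp add: face_operator_def)
    then show ?thesis
      unfolding T using rc_re_bip[OF emb_mem mem[OF emb_mem], of u u]
        bs.form_commute[OF mem[OF emb_mem] emb_mem, of u u] by simp
  qed
  obtain SA :: "'a set" and SB :: "'b set" where S: "finite SA" "span SA = UNIV" "finite SB" "span SB = UNIV"
    using A.real_span_finite B.real_span_finite by blast
  obtain S2 :: "('b \<times> 'b) set" where S2: "finite S2" "span S2 = UNIV"
    using finite_span_prod[OF S(3,4) S(3,4)] by blast
  obtain S3 :: "('a \<times> 'b \<times> 'b) set" where S3: "finite S3" "span S3 = UNIV"
    using finite_span_prod[OF S(1,2) S2] by blast
  obtain S4 :: "('a \<times> 'a \<times> 'b \<times> 'b) set" where S4: "finite S4" "span S4 = UNIV"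
    using finite_span_prod[OF S(1,2) S3] by blast
  obtain c C where c: "c > 0" and bd: "\<And>u. c * inner u u \<le> inner (T u) u" "\<And>u. inner (T u) u \<le> C * inner u u"
    using pos_def_coercive[OF S4 symmetric_imp_linear[OF T_sym] T_sym T_pos] by metis
  have "c * rbip x x \<le> rbip (act Q x) x \<and> rbip (act Q x) x \<le> C * rbip x x" if "x \<in> ?S" for x
    using bd[of "proj x"] unfolding T unfolding rbip_emb[symmetric] emb_proj[OF that] by blast
  then show ?thesis
    using sa sym c unfolding RQ_def coercive_op_def self_adjoint_op_def by blast
qed

end

subsection \<open>Stacks\<close>

lemma hstack_1: "hstack (Suc 0) M = M"
  by (simp add: hstack_def)

lemma hstack_Suc: "1 \<le> n \<Longrightarrow> hstack (Suc n) M = hstack n M beside M"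
  by (cases n) (simp_all add: hstack_def)

lemma vstack_1: "vstack (Suc 0) M = M"
  by (simp add: vstack_def)

lemma vstack_Suc: "1 \<le> n \<Longrightarrow> vstack (Suc n) M = vstack n M below M"
  by (cases n) (simp_all add: vstack_def)

lemma RQ_hstack:
  fixes M :: "('a::real_inner, 'b::real_inner) shaped_op"
  assumes compl: "complete (UNIV :: 'b set)" and M: "RQ (Seg 1) b M" and "1 \<le> n"
  shows "RQ (Seg n) b (hstack n M)"
  using \<open>1 \<le> n\<close>
proof (induction n rule: nat_induct_at_least)
  case base
  show ?case using M by (simp add: hstack_1)
next
  case (Suc n)
  interpret hpair "hstack n M" M "Seg n" b 1 using compl M Suc by unfold_locales
  show ?case using RQ_beside Suc by (simp add: hstack_Suc)
qed

lemma RQ_vstack: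
  fixes M :: "('a::real_inner, 'b::real_inner) shaped_op"
  assumes compl: "complete (UNIV :: 'a set)" and M: "RQ a (Seg 1) M" and "1 \<le> n"
  shows "RQ a (Seg n) (vstack n M)"
  using \<open>1 \<le> n\<close>
proof (induction n rule: nat_induct_at_least)
  case base
  show ?case using M by (simp add: vstack_1)
next
  case (Suc n)
  interpret vpair "vstack n M" M a "Seg n" 1 using compl M Suc by unfold_locales
  show ?case using RQ_below Suc by (simp add: vstack_Suc)
qed

text \<open>Associativity lets one copy be absorbed at a time, so the single-step equation extends
  to all stacks.\<close>

lemma beside_hstack_absorb:
  fixes M N :: "('a::real_inner, 'b::real_inner) shaped_op"
  assumes compl: "complete (UNIV :: 'b set)" and M: "RQ a b M" and N: "RQ (Seg 1) b N"
    and eq: "M beside N = M" and "1 \<le> n"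
  shows "M beside hstack n N = M"
  using \<open>1 \<le> n\<close>
proof (induction n rule: nat_induct_at_least)
  case (Suc n)
  have "M beside (hstack n N beside N) = (M beside hstack n N) beside N"
    by (rule beside_assoc[OF compl M RQ_hstack[OF compl N Suc(1)] N, symmetric])
  then show ?case using Suc eq by (simp add: hstack_Suc)
qed (simp add: hstack_1 eq)

lemma below_vstack_absorb:
  fixes M N :: "('a::real_inner, 'b::real_inner) shaped_op"
  assumes compl: "complete (UNIV :: 'a set)" and M: "RQ a b M" and N: "RQ a (Seg 1) N"
    and eq: "M below N = M" and "1 \<le> n"
  shows "M below vstack n N = M"
  using \<open>1 \<le> n\<close>
proof (induction n rule: nat_induct_at_least)
  case (Suc n)
  have "M below (vstack n N below N) = (M below vstack n N) below N"
    by (rule below_assoc[OF compl M RQ_vstack[OF compl N Suc(1)] N, symmetric])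
  then show ?case using Suc eq by (simp add: vstack_Suc)
qed (simp add: vstack_1 eq)

lemma below_cancel:
  fixes M N B :: "('a::real_inner, 'b::real_inner) shaped_op"
  assumes compl: "complete (UNIV :: 'a set)" and M: "RQ a b M" and N: "RQ a b N" and B: "RQ a (Seg q) B"
    and BS: "\<And>x. x \<in> bspace a (Seg q) \<Longrightarrow> fst (act B x) South = fst x South + scale_seq (1/2) (fst x North)"
    and BN: "\<And>x. x \<in> bspace a (Seg q) \<Longrightarrow> fst (act B x) North = fst x North + scale_seq (1/2) (fst x South)"
    and eq: "M below B = N below B"
  shows "op_agree M N"
proof -
  interpret M: vpair M B a b q using compl M B by unfold_locales
  interpret N: vpair N B a b q using compl N B by unfold_locales
  have "op_agree (trop (M below B)) (trop M beside trop B)" "op_agree (trop (M below B)) (trop N beside trop B)"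
    using op_agree_trop[OF M.below_agree] op_agree_trop[OF N.below_agree] by (simp_all add: eq)
  then have "trop M beside trop B = trop N beside trop B"
    by (intro op_eqI[OF _ ext_beside ext_beside]) (metis op_agree_sym op_agree_trans)
  then have "op_agree (trop M) (trop N)"
    using compl M N B BS BN by (intro beside_cancel[where p = q and B = "trop B" and a = b and b = a]) simp_all
  from op_agree_trop[OF this] show ?thesis by simp
qed

subsection \<open>The corner system\<close>

lemma all_hside: "(\<forall>s. P s) \<longleftrightarrow> P South \<and> P North"
  by (metis hside.exhaust)

lemma all_vside: "(\<forall>t. P t) \<longleftrightarrow> P West \<and> P East"
  by (metis vside.exhaust)

fun vof :: "hside \<Rightarrow> vside" where
  "vof South = West" | "vof North = East"

fun hof :: "vside \<Rightarrow> hside" where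
  "hof West = South" | "hof East = North"

lemma blk_trop:
  "blk_hh (trop M) s s' = blk_vv M (vof s) (vof s')"
  "blk_hv (trop M) s t = blk_vh M (vof s) (hof t)"
  "blk_vh (trop M) t s = blk_hv M (hof t) (vof s)"
  "blk_vv (trop M) t t' = blk_hh M (hof t) (hof t')"
proof -
  note defs = blk_hh_def blk_hv_def blk_vh_def blk_vv_def fun_eq_iff tr_set tr_linear
  show "blk_hh (trop M) s s' = blk_vv M (vof s) (vof s')" by (cases s; cases s'; simp add: defs)
  show "blk_hv (trop M) s t = blk_vh M (vof s) (hof t)" by (cases s; cases t; simp add: defs)
  show "blk_vh (trop M) t s = blk_hv M (hof t) (vof s)" by (cases s; cases t; simp add: defs)
  show "blk_vv (trop M) t t' = blk_hh M (hof t) (hof t')" by (cases t; cases t'; simp add: defs)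
qed

lemma west_eqs_iff: "west_eqs H1 Q QW \<longleftrightarrow> h_fix_eqs H1 UNIV (Seg 1) QW Q"
  unfolding west_eqs_def h_fix_eqs_def Let_def by simp

lemma south_eqs_iff: "south_eqs H2 Q QS \<longleftrightarrow> h_fix_eqs H2 UNIV (Seg 1) (trop QS) (trop Q)"
  unfolding south_eqs_def h_fix_eqs_def Let_def blk_trop ball_UNIV all_hside all_vside vof.simps hof.simps ..

lemma (in vpair) below_fix_iff: "op_agree (M below M') M \<longleftrightarrow> op_agree (trop M beside trop M') (trop M)"
  using below_agree op_agree_trop[OF below_agree] op_agree_trop[of "trop M beside trop M'" "trop M"]
    op_agree_trop[of "M below M'" M]
  by (metis op_agree_sym op_agree_trans trop_trop)

context hilbert_pair
begin

lemma corner_eqs_S_iff: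
  assumes C: "QSW \<in> Qset H1 H2 Half Half"
  shows "corner_eqs_S H1 H2 QS QSW \<longleftrightarrow> h_fix_eqs H1 {North} Half QSW QS"
  unfolding corner_eqs_S_def h_fix_eqs_def Let_def using adjoint_blocks(1)[OF C] by simp

lemma corner_eqs_W_iff:
  assumes C: "QSW \<in> Qset H1 H2 Half Half"
  shows "corner_eqs_W H1 H2 QW QSW \<longleftrightarrow> h_fix_eqs H2 {North} Half (trop QSW) (trop QW)"
  unfolding corner_eqs_W_def h_fix_eqs_def Let_def blk_trop vof.simps hof.simps
  using adjoint_blocks(2)[OF C] by simp

end

text \<open>The four bijectivity claims at the end show that each \<open>inv_into\<close> in the
  equations is a genuine inverse operator. The two equivalences before them translate the corner
  gluing equations into blocks.\<close>

theorem theorem2p17: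
  fixes H1 :: "('k::rc_field, 'a::real_inner) hilbert"
    and H2 :: "('k, 'b::real_inner) hilbert"
    and Q QW QS QSW :: "('a, 'b) shaped_op"
  assumes "fd_hilbert H1" and "fd_hilbert H2"
    and "face_operator H1 H2 Q"
    and "QW \<in> Qset H1 H2 Half (Seg 1)"
    and "QS \<in> Qset H1 H2 (Seg 1) Half"
    and "QSW \<in> Qset H1 H2 Half Half"
  shows "(sw_corner_system H1 H2 Q QW QS QSW \<longleftrightarrow>
           west_eqs H1 Q QW \<and> south_eqs H2 Q QS \<and>
           QSW = QSW beside QS \<and> QSW = QSW below QW) \<and>
         (QSW = QSW beside QS \<longleftrightarrow> corner_eqs_S H1 H2 QS QSW) \<and>
         (QSW = QSW below QW \<longleftrightarrow> corner_eqs_W H1 H2 QW QSW) \<and>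
         bij_betw (blk_vv QW East East + blk_vv Q West West) (side (Seg 1)) (side (Seg 1)) \<and>
         bij_betw (blk_hh QS North North + blk_hh Q South South) (side (Seg 1)) (side (Seg 1)) \<and>
         bij_betw (blk_vv QSW East East + blk_vv QS West West) (side Half) (side Half) \<and>
         bij_betw (blk_hh QSW North North + blk_hh QW South South) (side Half) (side Half)"
proof -
  interpret hilbert_pair H1 H2 using assms by (simp add: hilbert_pair_def)
  note cA = complete_A and cB = complete_B
  have Q: "RQ (Seg 1) (Seg 1) Q" by (rule face_RQ[OF assms(3)])
  note QW = Qset_RQ[OF assms(4)] and QS = Qset_RQ[OF assms(5)] and C = Qset_RQ[OF assms(6)]
  note eW = Qset_ext[OF assms(4)] and eS = Qset_ext[OF assms(5)] and eC = Qset_ext[OF assms(6)]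
  interpret W: hpair QW Q Half "Seg 1" 1 using cB QW Q by unfold_locales
  interpret S: vpair QS Q "Seg 1" Half 1 using cA QS Q by unfold_locales
  interpret CS: hpair QSW QS Half Half 1 using cB C QS by unfold_locales
  interpret CW: vpair QSW QW Half Half 1 using cA C QW by unfold_locales
  have agree_eq: "op_agree X Y \<longleftrightarrow> X = Y" if "ext_op X" "ext_op Y" for X Y :: "('a, 'b) shaped_op"
    using that op_eqI[of X Y] by (auto simp: op_agree_def)
  have west: "QW beside Q = QW \<longleftrightarrow> west_eqs H1 Q QW"
    unfolding agree_eq[OF ext_beside eW, symmetric] west_eqs_iff
    by (rule A.h_fix_eqs_iff[OF W.hpair_axioms]) simp
  have south: "QS below Q = QS \<longleftrightarrow> south_eqs H2 Q QS"
    unfolding agree_eq[OF ext_below eS, symmetric] S.below_fix_iff south_eqs_iff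
    by (rule B.h_fix_eqs_iff[OF S.T.hpair_axioms]) simp
  have cornerS: "QSW = QSW beside QS \<longleftrightarrow> corner_eqs_S H1 H2 QS QSW"
    unfolding eq_commute[of QSW "QSW beside QS"] agree_eq[OF ext_beside eC, symmetric] corner_eqs_S_iff[OF assms(6)]
    by (rule A.h_fix_eqs_iff[OF CS.hpair_axioms]) simp
  have cornerW: "QSW = QSW below QW \<longleftrightarrow> corner_eqs_W H1 H2 QW QSW"
    unfolding eq_commute[of QSW "QSW below QW"] agree_eq[OF ext_below eC, symmetric] CW.below_fix_iff
      corner_eqs_W_iff[OF assms(6)]
    by (rule B.h_fix_eqs_iff[OF CW.T.hpair_axioms]) simp
  have fwd: "QW beside Q = QW \<and> QS below Q = QS \<and> QSW beside QS = QSW \<and> QSW below QW = QSW"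
    if sys: "sw_corner_system H1 H2 Q QW QS QSW"
  proof (intro conjI)
    have sf: "south_fixed_point H1 H2 Q QS" and wf: "west_fixed_point H1 H2 Q QW"
      using sys by (simp_all add: sw_corner_system_def)
    have g1: "grid Q 1 1 = Q" by (simp add: grid_def hstack_1 vstack_1)
    show "QS below Q = QS"
      using sf[unfolded south_fixed_point_def, rule_format, of 1 1] by (simp add: g1[simplified] hstack_1)
    show "QW beside Q = QW"
      using wf[unfolded west_fixed_point_def, rule_format, of 1 1] by (simp add: g1[simplified] vstack_1)
    \<comment> \<open>Case \<open>p = 0\<close>, \<open>q = r = 1\<close> of condition (i). The
      shared side with \<open>?B\<close> is the horizontal half-line, so South and North are
      coupled.\<close>
    let ?B = "coupling (1/2) 0 Half (Seg 1) :: ('a, 'b) shaped_op"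
    have B: "?B \<in> Qset H1 H2 Half (Seg 1)" by (rule coupling_Qset) simp_all
    have "(QSW below vstack 1 QW) below ?B = QSW below ?B"
      using sys[unfolded sw_corner_system_def Let_def, THEN conjunct2, THEN conjunct1,
          THEN spec[of _ 0], THEN spec[of _ 1], THEN mp, OF order_refl,
          THEN spec[of _ 1], THEN mp, OF order_refl, THEN bspec, OF B] by simp
    then have "op_agree (QSW below QW) QSW"
      using CW.RQ_below
      by (intro below_cancel[OF cA _ C Qset_RQ[OF B]]) (simp_all add: vstack_1 coupling_def)
    then show "QSW below QW = QSW" using agree_eq[OF ext_below eC] by simp
    \<comment> \<open>Case \<open>q = 0\<close>, \<open>p = r = 1\<close> of condition (ii), with
      West and East coupled across the vertical half-line.\<close>
    let ?D = "coupling 0 (1/2) (Seg 1) Half :: ('a, 'b) shaped_op"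
    have D: "?D \<in> Qset H1 H2 (Seg 1) Half" by (rule coupling_Qset) simp_all
    have "(QSW beside hstack 1 QS) beside ?D = QSW beside ?D"
      using sys[unfolded sw_corner_system_def Let_def, THEN conjunct2, THEN conjunct2, THEN conjunct2,
          THEN spec[of _ 0], THEN spec[of _ 1], THEN mp, OF order_refl,
          THEN spec[of _ 1], THEN mp, OF order_refl, THEN bspec, OF D] by simp
    then have "op_agree (QSW beside QS) QSW"
      using CS.RQ_beside
      by (intro beside_cancel[OF cB _ C Qset_RQ[OF D]]) (simp_all add: hstack_1 coupling_def)
    then show "QSW beside QS = QSW" using agree_eq[OF ext_beside eC] by simp
  qed
  have bwd: "sw_corner_system H1 H2 Q QW QS QSW"
    if fW: "QW beside Q = QW" and fS: "QS below Q = QS" and fCS: "QSW beside QS = QSW" and fCW: "QSW below QW = QSW"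
  proof -
    \<comment> \<open>A row of height 1 is absorbed column by column through interchange; further
      rows then follow by associativity.\<close>
    have S1: "hstack p QS below hstack p Q = hstack p QS" if "1 \<le> p" for p
      using that
    proof (induction p rule: nat_induct_at_least)
      case (Suc p)
      have "(hstack p QS beside QS) below (hstack p Q beside Q)
          = (hstack p QS below hstack p Q) beside (QS below Q)"
        using Suc by (intro interchange[OF cA cB RQ_hstack[OF cB QS] QS RQ_hstack[OF cB Q] Q]) simp_all
      then show ?case using Suc fS by (simp add: hstack_Suc)
    qed (simp add: hstack_1 fS)
    have S: "hstack p QS below grid Q p q = hstack p QS" if "1 \<le> p" "1 \<le> q" for p q
      unfolding grid_def
      by (rule below_vstack_absorb[OF cA RQ_hstack[OF cB QS that(1)] RQ_hstack[OF cB Q that(1)] S1[OF that(1)] that(2)])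
    \<comment> \<open>The order is reversed here: \<open>grid\<close> is a stack of rows, so each
      row is absorbed by associativity and the rows are then combined by interchange.\<close>
    have W: "vstack q QW beside grid Q p q = vstack q QW" if p: "1 \<le> p" and "1 \<le> q" for p q
      using \<open>1 \<le> q\<close> unfolding grid_def
    proof (induction q rule: nat_induct_at_least)
      case base
      show ?case using beside_hstack_absorb[OF cB QW Q fW p] by (simp add: vstack_1)
    next
      case (Suc q)
      note P = RQ_hstack[OF cB Q p]
      have "(vstack q QW beside vstack q (hstack p Q)) below (QW beside hstack p Q)
          = (vstack q QW below QW) beside (vstack q (hstack p Q) below hstack p Q)"
        using Suc by (intro interchange[OF cA cB RQ_vstack[OF cA QW] RQ_vstack[OF cA P] QW P]) simp_all
      then show ?case using Suc beside_hstack_absorb[OF cB QW Q fW p] by (simp add: vstack_Suc)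
    qed
    have CSp: "QSW beside hstack p QS = QSW" if "1 \<le> p" for p
      by (rule beside_hstack_absorb[OF cB C QS fCS that])
    have CWq: "QSW below vstack q QW = QSW" if "1 \<le> q" for q
      by (rule below_vstack_absorb[OF cA C QW fCW that])
    show ?thesis
      \<comment> \<open>Every rectangle, strip or column next to a fixed point has been absorbed, so
        both sides of each tested identity become the same gluing with \<open>B\<close>.\<close>
      unfolding sw_corner_system_def south_fixed_point_def west_fixed_point_def Let_def
      by (simp add: S W CSp CWq Suc_le_eq)
  qed
  show ?thesis
    using fwd bwd west south cornerS cornerW W.L_bij S.T.L_bij[unfolded blk_trop hof.simps] CS.L_bij
      CW.T.L_bij[unfolded blk_trop hof.simps]
    by metis
qed

end
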